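(* Temporal Reachability Edge Deletion can be solved in time $(n\Lambda)^{O(1)}\phi^{O(\phi^3)}$, where the input temporal graph has $n$ vertices, lifetime $\Lambda$ and TIM width $\phi$.
   Context: A temporal graph $\mathcal{G}=(G,\lambda)$: static graph $G=(V,E)$ and $\lambda:E\to 2^{\mathbb{N}}$; time-edges $(e,t)$ with $t\in\lambda(e)$; lifetime $\Lambda=\max_e\max\lambda(e)$. A (strict) temporal path is a sequence of time-edges $(e_0,t_0),\dots,(e_l,t_l)$ forming a walk with $t_i<t_{i+1}$, each vertex traversed at most once. A vertex $v$ is temporally reachable from $u$ if there is a temporal path from $u$ to $v$; every vertex is reachable from itself. Temporal Reachability Edge Deletion: given $\mathcal{G}$, a source vertex $v_s$ and positive integers $r,h$, decide whether there is a set of at most $h$ time-edges whose deletion from $\mathcal{G}$ leaves at most $r$ vertices temporally reachable from $v_s$. TIM decomposition: triple $(T,B,\tau)$, $T$ a directed tree, bags $B(s)\subseteq V$, $\tau$ assigning each bag a time in $[\Lambda]$, such that (1) each vertex $v$ and time $t\in[\Lambda]$ lies in exactly one bag labelled $t$; (2) each time-edge $(uv,t)$ has a unique node $i$ with $\{u,v\}\subseteq B(i)$, $\tau(B(i))=t$; (3) arcs of $T$ are exactly the pairs $(i,j)$ with $B(i)\cap B(j)\neq\emptyset$ and $\tau(B(j))=\tau(B(i))+1$. Width is the maximum bag size; TIM width is the minimum width over TIM decompositions. *)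

theory Defs
  imports Main
begin

section \<open>Temporal graphs\<close>

text \<open>Static edges are two-element vertex sets. Label sets may be empty, so that deleting time-edges
  stays within the class; times are positive, since TIM decompositions only speak about times
  in \<open>{1..\<Lambda>}\<close>.\<close>

record 'a temporal_graph =
  tverts :: "'a set"
  tedges :: "'a set set"
  tlabels :: "'a set \<Rightarrow> nat set"

definition is_temporal_graph :: "'a temporal_graph \<Rightarrow> bool" where
  "is_temporal_graph G \<longleftrightarrow>
     finite (tverts G) \<and>
     (\<forall>e\<in>tedges G. \<exists>u\<in>tverts G. \<exists>v\<in>tverts G. u \<noteq> v \<and> e = {u, v}) \<and>
     (\<forall>e\<in>tedges G. finite (tlabels G e) \<and> 0 \<notin> tlabels G e)"

definition time_edges :: "'a temporal_graph \<Rightarrow> ('a set \<times> nat) set" where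
  "time_edges G = {(e, t). e \<in> tedges G \<and> t \<in> tlabels G e}"

text \<open>Unspecified (\<^term>\<open>Max {}\<close>) if there are no time-edges.\<close>

definition lifetime :: "'a temporal_graph \<Rightarrow> nat" where
  "lifetime G = Max (\<Union>e\<in>tedges G. tlabels G e)"

definition delete_time_edges ::
  "'a temporal_graph \<Rightarrow> ('a set \<times> nat) set \<Rightarrow> 'a temporal_graph" where
  "delete_time_edges G D = G\<lparr>tlabels := \<lambda>e. {t \<in> tlabels G e. (e, t) \<notin> D}\<rparr>"

text \<open>The list \<open>vs\<close> records the vertices in the order in which the walk visits them.\<close>

definition temporal_path ::
  "'a temporal_graph \<Rightarrow> 'a \<Rightarrow> ('a set \<times> nat) list \<Rightarrow> 'a \<Rightarrow> bool" where
  "temporal_path G u p v \<longleftrightarrow>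
     p \<noteq> [] \<and> set p \<subseteq> time_edges G \<and> sorted_wrt (<) (map snd p) \<and>
     (\<exists>vs. length vs = Suc (length p) \<and> hd vs = u \<and> last vs = v \<and> distinct vs \<and>
           (\<forall>i<length p. fst (p ! i) = {vs ! i, vs ! Suc i}))"

definition temporally_reachable :: "'a temporal_graph \<Rightarrow> 'a \<Rightarrow> 'a \<Rightarrow> bool" where
  "temporally_reachable G u v \<longleftrightarrow> u = v \<or> (\<exists>p. temporal_path G u p v)"

definition temporal_reachability_edge_deletion ::
  "'a temporal_graph \<Rightarrow> 'a \<Rightarrow> nat \<Rightarrow> nat \<Rightarrow> bool" where
  "temporal_reachability_edge_deletion G vs r h \<longleftrightarrow>
     (\<exists>D \<subseteq> time_edges G. card D \<le> h \<and>
        card {v \<in> tverts G. temporally_reachable (delete_time_edges G D) vs v} \<le> r)"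


section \<open>TIM decompositions\<close>

text \<open>A directed tree is an orientation of an undirected tree; arcs need not all point away from (or
  towards) a root. Note that acyclicity is that of the underlying undirected graph.\<close>

definition directed_tree :: "'n set \<Rightarrow> ('n \<times> 'n) set \<Rightarrow> bool" where
  "directed_tree N A \<longleftrightarrow>
     finite N \<and> N \<noteq> {} \<and> A \<subseteq> N \<times> N \<and>
     (\<forall>i j. (i, j) \<in> A \<longrightarrow> (j, i) \<notin> A) \<and>
     (\<forall>i\<in>N. \<forall>j\<in>N. (i, j) \<in> (A \<union> A\<inverse>)\<^sup>*) \<and>
     \<not> (\<exists>c. 3 \<le> length c \<and> distinct c \<and>
            (\<forall>k<length c. (c ! k, c ! (Suc k mod length c)) \<in> A \<union> A\<inverse>))"

text \<open>The times \<open>\<tau>\<close> label nodes rather than bags, as two nodes may carry the same vertex set.\<close>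

definition tim_decomposition ::
  "'a temporal_graph \<Rightarrow> 'n set \<Rightarrow> ('n \<times> 'n) set \<Rightarrow> ('n \<Rightarrow> 'a set) \<Rightarrow> ('n \<Rightarrow> nat) \<Rightarrow> bool" where
  "tim_decomposition G N A B \<tau> \<longleftrightarrow>
     directed_tree N A \<and>
     (\<forall>i\<in>N. B i \<subseteq> tverts G \<and> \<tau> i \<in> {1..lifetime G}) \<and>
     (\<forall>v\<in>tverts G. \<forall>t\<in>{1..lifetime G}. \<exists>!i. i \<in> N \<and> v \<in> B i \<and> \<tau> i = t) \<and>
     (\<forall>(e, t)\<in>time_edges G. \<exists>!i. i \<in> N \<and> e \<subseteq> B i \<and> \<tau> i = t) \<and>
     A = {(i, j). i \<in> N \<and> j \<in> N \<and> B i \<inter> B j \<noteq> {} \<and> \<tau> j = \<tau> i + 1}"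

definition decomposition_width :: "'n set \<Rightarrow> ('n \<Rightarrow> 'a set) \<Rightarrow> nat" where
  "decomposition_width N B = Max ((\<lambda>i. card (B i)) ` N)"

text \<open>Every finite tree is isomorphic to one on natural numbers, so nodes of type
  \<^typ>\<open>nat\<close> suffice.\<close>

definition tim_width :: "'a temporal_graph \<Rightarrow> nat" where
  "tim_width G = (LEAST w. \<exists>(N :: nat set) A B \<tau>.
      tim_decomposition G N A B \<tau> \<and> decomposition_width N B = w)"

text \<open>The minimum is over a nonempty set as soon as \<open>G\<close> has a vertex and a time-edge: a directed path
  with all vertices in every bag is a TIM decomposition.\<close>

lemma trivial_tim_decomposition:
  assumes "is_temporal_graph G" "tverts G \<noteq> {}" "time_edges G \<noteq> {}"
  shows "tim_decomposition G {1..lifetime G} {(i, j). 1 \<le> i \<and> j \<le> lifetime G \<and> j = i + 1}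
           (\<lambda>_. tverts G) (\<lambda>i. i)"
proof -
  let ?L = "lifetime G"
  let ?A = "{(i::nat, j). 1 \<le> i \<and> j \<le> ?L \<and> j = i + 1}"
  have fin: "finite (tedges G)"
  proof (rule finite_subset)
    show "tedges G \<subseteq> Pow (tverts G)" using assms(1) by (fastforce simp: is_temporal_graph_def)
    show "finite (Pow (tverts G))" using assms(1) by (simp add: is_temporal_graph_def)
  qed
  have te: "e \<subseteq> tverts G \<and> t \<in> {1..?L}" if "(e, t) \<in> time_edges G" for e t
  proof -
    have et: "e \<in> tedges G" "t \<in> tlabels G e" using that by (auto simp: time_edges_def)
    have "finite (\<Union>e\<in>tedges G. tlabels G e)"
      using fin assms(1) by (auto simp: is_temporal_graph_def)
    then have "t \<le> ?L" unfolding lifetime_def by (rule Max_ge) (use et in auto)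
    moreover have "t \<noteq> 0" using et assms(1) by (metis is_temporal_graph_def)
    moreover have "e \<subseteq> tverts G" using et assms(1) by (fastforce simp: is_temporal_graph_def)
    ultimately show ?thesis by auto
  qed
  have L: "1 \<le> ?L" using assms(3) te by fastforce
  have reach: "(1, i) \<in> (?A \<union> ?A\<inverse>)\<^sup>*" if "1 \<le> i" "i \<le> ?L" for i
    using that
  proof (induction i rule: dec_induct)
    case (step i)
    then have "(1, i) \<in> (?A \<union> ?A\<inverse>)\<^sup>*" "(i, Suc i) \<in> ?A \<union> ?A\<inverse>" by auto
    then show ?case by (rule rtrancl_into_rtrancl)
  qed simp
  have sym: "(?A \<union> ?A\<inverse>)\<inverse> = ?A \<union> ?A\<inverse>" by auto
  have conn: "(i, j) \<in> (?A \<union> ?A\<inverse>)\<^sup>*" if "i \<in> {1..?L}" "j \<in> {1..?L}" for i j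
  proof -
    have "(1, i) \<in> (?A \<union> ?A\<inverse>)\<^sup>*" "(1, j) \<in> (?A \<union> ?A\<inverse>)\<^sup>*" using reach that by auto
    moreover from rtrancl_converseI[OF this(1)] have "(i, 1) \<in> (?A \<union> ?A\<inverse>)\<^sup>*"
      unfolding sym .
    ultimately show ?thesis by simp
  qed
  have nocyc: False
    if c: "3 \<le> length c" "distinct c"
      "\<forall>k<length c. (c ! k, c ! (Suc k mod length c)) \<in> ?A \<union> ?A\<inverse>" for c :: "nat list"
  proof -
    let ?n = "length c"
    have ne: "set c \<noteq> {}" using c(1) by auto
    then obtain k where k: "k < ?n" "c ! k = Max (set c)"
      using Max_in[OF finite_set ne] by (metis in_set_conv_nth)
    define k1 where "k1 = Suc k mod ?n"
    define k2 where "k2 = (if k = 0 then ?n - 1 else k - 1)"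
    have k12: "k1 < ?n" "k2 < ?n" "k1 \<noteq> k2" "Suc k2 mod ?n = k"
      using k(1) c(1) by (auto simp: k1_def k2_def mod_Suc)
    have le: "c ! k1 \<le> c ! k" "c ! k2 \<le> c ! k" using k k12 by auto
    have "(c ! k, c ! k1) \<in> ?A \<union> ?A\<inverse>"
      using c(3)[rule_format, OF k(1)] unfolding k1_def .
    moreover have "(c ! k2, c ! k) \<in> ?A \<union> ?A\<inverse>"
      using c(3)[rule_format, OF k12(2)] unfolding k12(4) .
    ultimately have "c ! k1 = c ! k2" using le by auto
    then show False using k12 c(2) by (simp add: nth_eq_iff_index_eq)
  qed
  have tree: "directed_tree {1..?L} ?A"
    unfolding directed_tree_def
  proof (intro conjI)
    show "\<forall>i\<in>{1..?L}. \<forall>j\<in>{1..?L}. (i, j) \<in> (?A \<union> ?A\<inverse>)\<^sup>*" using conn by blast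
    show "\<not> (\<exists>c. 3 \<le> length c \<and> distinct c \<and>
            (\<forall>k<length c. (c ! k, c ! (Suc k mod length c)) \<in> ?A \<union> ?A\<inverse>))" using nocyc by blast
  qed (use L in auto)
  have "\<exists>!i. i \<in> {1..?L} \<and> e \<subseteq> tverts G \<and> i = t" if "(e, t) \<in> time_edges G" for e t
    using te[OF that] by auto
  moreover have "?A = {(i, j). i \<in> {1..?L} \<and> j \<in> {1..?L} \<and> tverts G \<inter> tverts G \<noteq> {} \<and> j = i + 1}"
    using assms(2) by auto
  moreover have "\<exists>!i. i \<in> {1..?L} \<and> v \<in> tverts G \<and> i = t" if "v \<in> tverts G" "t \<in> {1..?L}" for v t
    using that by auto
  ultimately show ?thesis
    unfolding tim_decomposition_def by (intro conjI tree) blast+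
qed


section \<open>Random access machines\<close>

text \<open>
  The model of computation is the usual random access machine with unit cost and with addition and
  truncated subtraction as its only arithmetic, presented as a structured language. Memory consists
  of a fixed number of unbounded arrays of natural numbers (a program mentions finitely many array
  names); a scalar is cell 0 of an array. Evaluating an operator, a memory access, a
  test and a store each cost one step. There is no multiplication, so within \<open>k\<close> steps the binary
  length of numbers grows by \<open>O(k)\<close>, and the model is polynomially equivalent to
  Turing machines.
\<close>

type_synonym ram_state = "string \<Rightarrow> nat \<Rightarrow> nat"

datatype ram_exp =
    Const nat
  | Load string ram_exp
  | Add ram_exp ram_exp
  | Sub ram_exp ram_exp

datatype ram_prog =
    Skip
  | Store string ram_exp ram_exp
  | Seq ram_prog ram_prog
  | If ram_exp ram_prog ram_prog
  | While ram_exp ram_prog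

primrec ram_val :: "ram_exp \<Rightarrow> ram_state \<Rightarrow> nat" where
  "ram_val (Const k) s = k"
| "ram_val (Load a e) s = s a (ram_val e s)"
| "ram_val (Add e f) s = ram_val e s + ram_val f s"
| "ram_val (Sub e f) s = ram_val e s - ram_val f s"

primrec ram_cost :: "ram_exp \<Rightarrow> nat" where
  "ram_cost (Const k) = 1"
| "ram_cost (Load a e) = ram_cost e + 1"
| "ram_cost (Add e f) = ram_cost e + ram_cost f + 1"
| "ram_cost (Sub e f) = ram_cost e + ram_cost f + 1"

text \<open>\<open>ram_exec P s k s'\<close>: started in \<open>s\<close>, program \<open>P\<close> halts in \<open>s'\<close> after exactly \<open>k\<close> steps.\<close>

inductive ram_exec :: "ram_prog \<Rightarrow> ram_state \<Rightarrow> nat \<Rightarrow> ram_state \<Rightarrow> bool" where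
  Skip: "ram_exec Skip s 1 s"
| Store: "ram_exec (Store a e f) s (ram_cost e + ram_cost f + 1)
            (s(a := (s a)(ram_val e s := ram_val f s)))"
| Seq: "ram_exec P s k s' \<Longrightarrow> ram_exec Q s' l s'' \<Longrightarrow> ram_exec (Seq P Q) s (k + l) s''"
| IfTrue: "ram_val e s \<noteq> 0 \<Longrightarrow> ram_exec P s k s' \<Longrightarrow>
            ram_exec (If e P Q) s (ram_cost e + 1 + k) s'"
| IfFalse: "ram_val e s = 0 \<Longrightarrow> ram_exec Q s k s' \<Longrightarrow>
            ram_exec (If e P Q) s (ram_cost e + 1 + k) s'"
| WhileFalse: "ram_val e s = 0 \<Longrightarrow> ram_exec (While e P) s (ram_cost e + 1) s"
| WhileTrue: "ram_val e s \<noteq> 0 \<Longrightarrow> ram_exec P s k s' \<Longrightarrow> ram_exec (While e P) s' l s'' \<Longrightarrow>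
            ram_exec (While e P) s (ram_cost e + 1 + k + l) s''"

lemma ram_exec_deterministic:
  "ram_exec P s k s' \<Longrightarrow> ram_exec P s l s'' \<Longrightarrow> k = l \<and> s' = s''"
proof (induction arbitrary: l s'' rule: ram_exec.induct)
  case (Skip s)
  then show ?case by cases auto
next
  case (Store a e f s)
  then show ?case by cases auto
next
  case (Seq P s k s' Q l' t)
  from Seq.prems show ?case by cases (use Seq.IH in blast)
next
  case (IfTrue e s P k s' Q)
  from IfTrue.prems show ?case by cases (use IfTrue.IH IfTrue.hyps in blast)+
next
  case (IfFalse e s Q k s' P)
  from IfFalse.prems show ?case by cases (use IfFalse.IH IfFalse.hyps in blast)+
next
  case (WhileFalse e s P)
  from WhileFalse.prems show ?case by cases (use WhileFalse.hyps in simp_all)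
next
  case (WhileTrue e s P k s' l' t)
  from WhileTrue.prems show ?case by cases (use WhileTrue.IH WhileTrue.hyps in blast)+
qed


section \<open>Input encoding\<close>

text \<open>Vertices are the numbers below \<open>n\<close>. A temporal graph is given as a list of its time-edges, each
  listed once, in any order and with its endpoints in any order. Static edges without labels
  are not listed; they affect neither the problem nor any of the parameters.\<close>

definition lists_time_edges :: "(nat \<times> nat \<times> nat) list \<Rightarrow> nat temporal_graph \<Rightarrow> bool" where
  "lists_time_edges L G \<longleftrightarrow>
     (let es = map (\<lambda>(u, v, t). ({u, v}, t)) L in distinct es \<and> set es = time_edges G)"

definition nth_or_0 :: "nat list \<Rightarrow> nat \<Rightarrow> nat" where
  "nth_or_0 xs i = (if i < length xs then xs ! i else 0)"

definition input_state ::
  "nat \<Rightarrow> (nat \<times> nat \<times> nat) list \<Rightarrow> nat \<Rightarrow> nat \<Rightarrow> nat \<Rightarrow> ram_state" where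
  "input_state n L vs r h = (\<lambda>_ _. 0)
     (''n'' := nth_or_0 [n],
      ''m'' := nth_or_0 [length L],
      ''source'' := nth_or_0 [vs],
      ''r'' := nth_or_0 [r],
      ''h'' := nth_or_0 [h],
      ''tail'' := nth_or_0 (map (\<lambda>(u, v, t). u) L),
      ''head'' := nth_or_0 (map (\<lambda>(u, v, t). v) L),
      ''time'' := nth_or_0 (map (\<lambda>(u, v, t). t) L))"

end

theory Submission
  imports Defs
begin

text \<open>
  Deleting time-edges amounts to choosing a growing chain of reached sets \<open>S t\<close> starting from \<open>S 0 = {vs}\<close>: its
  cost is the number of time-edges at time \<open>t + 1\<close> that lead from \<open>S t\<close> out of \<open>S (t + 1)\<close>, and one may
  assume that \<open>S t\<close> contains only vertices reached by time \<open>t\<close> without deletions. No TIM decomposition has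
  to be computed: put two such vertices into one class at time \<open>t\<close> if they are connected by edges of time
  at least \<open>t\<close> that leave vertices already reached. In a TIM decomposition, the bags met by reached
  vertices are the nodes on directed paths from the bag of the source at time 1; as the tree has no
  cycle, these paths never merge again, so every class lies in a single bag and has at most
  \<open>tim_width G\<close> elements. The classes form a rooted tree, and a dynamic program over it, with subsets of
  classes as states and a budget for the number of reached vertices, finds the cheapest chain.
\<close>

section \<open>Programs with counting loops\<close>

text \<open>The classes use only edges that leave vertices already reached because a directed tree
  here is merely an orientation: two bags of time \<open>t\<close> may both have an arc to the same
  bag of time \<open>t + 1\<close>. Merging over all edges could then force their union into one
  class at time \<open>t\<close>, larger than any bag. Among bags reached from the source this
  cannot happen. All loops of the program are bounded by \<open>base\<close>, a sum built from
  \<open>n\<close>, \<open>m\<close>, \<open>L\<close> and \<open>2 ^ bits\<close>, so the cost is a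
  fixed power of \<open>base\<close>, hence polynomial in \<open>n\<close>, \<open>L\<close> and
  \<open>2 ^ \<phi>\<close> for width \<open>\<phi>\<close>. The claimed bound leaves ample room for
  this, except that powers of 1 are 1: for width 1 the factor 2 has to be paid by
  \<open>n * L\<close>. Loop bounds must not change while they are in use, but the lifetime and the
  number of bits are themselves computed. This dictates the phases of the program. Since the machine
  cannot multiply, index arithmetic goes through tables of multiples.\<close>

text \<open>\<open>For x y p\<close> runs \<open>p\<close> with the scalar \<open>x\<close> going from \<open>0\<close> up to (excluding) the scalar \<open>y\<close>. Such
  programs terminate, so they denote total functions on states, and their running time is bounded
  by the nesting depth of the loops as soon as all loop bounds are.\<close>

datatype lp =
    Nop
  | Put string ram_exp ram_exp
  | Then lp lp (infixr ";;" 60)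
  | Cond ram_exp lp lp
  | For string string lp

definition upd :: "string \<Rightarrow> nat \<Rightarrow> nat \<Rightarrow> ram_state \<Rightarrow> ram_state" where
  "upd a i k s = s(a := (s a)(i := k))"

lemma upd_apply [simp]:
  "upd a i k s a = (s a)(i := k)"
  "b \<noteq> a \<Longrightarrow> upd a i k s b = s b"
  by (simp_all add: upd_def)

text \<open>The counter is assigned at the end of each round and keeps its final value after the
  loop, so the result agrees with that of the compiled while loop on every cell. The bound is read
  once, which is faithful only if the body does not write it; \<open>well_formed\<close> ensures
  this.\<close>

primrec run :: "lp \<Rightarrow> ram_state \<Rightarrow> ram_state" where
  "run Nop s = s"
| "run (Put a e f) s = upd a (ram_val e s) (ram_val f s) s"
| "run (p ;; q) s = run q (run p s)"
| "run (Cond e p q) s = (if ram_val e s \<noteq> 0 then run p s else run q s)"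
| "run (For x y p) s =
     fold (\<lambda>i s. upd x 0 (Suc i) (run p s)) [0..<s y 0] (upd x 0 0 s)"

primrec writes :: "lp \<Rightarrow> string set" where
  "writes Nop = {}"
| "writes (Put a e f) = {a}"
| "writes (p ;; q) = writes p \<union> writes q"
| "writes (Cond e p q) = writes p \<union> writes q"
| "writes (For x y p) = insert x (writes p)"

primrec bounds :: "lp \<Rightarrow> string set" where
  "bounds Nop = {}"
| "bounds (Put a e f) = {}"
| "bounds (p ;; q) = bounds p \<union> bounds q"
| "bounds (Cond e p q) = bounds p \<union> bounds q"
| "bounds (For x y p) = insert y (bounds p)"

primrec well_formed :: "lp \<Rightarrow> bool" where
  "well_formed Nop = True"
| "well_formed (Put a e f) = True"
| "well_formed (p ;; q) = (well_formed p \<and> well_formed q)"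
| "well_formed (Cond e p q) = (well_formed p \<and> well_formed q)"
| "well_formed (For x y p) = (x \<noteq> y \<and> x \<notin> writes p \<and> y \<notin> writes p \<and> well_formed p)"

primrec compile :: "lp \<Rightarrow> ram_prog" where
  "compile Nop = Skip"
| "compile (Put a e f) = Store a e f"
| "compile (p ;; q) = Seq (compile p) (compile q)"
| "compile (Cond e p q) = If e (compile p) (compile q)"
| "compile (For x y p) =
     Seq (Store x (Const 0) (Const 0))
         (While (Sub (Load y (Const 0)) (Load x (Const 0)))
            (Seq (compile p) (Store x (Const 0) (Add (Load x (Const 0)) (Const 1)))))"

text \<open>The 12 of a loop: each round pays 6 steps for the guard and 6 for the increment. The
  initial store and the last, failing guard cost 3 + 6, at most one further round.\<close>

primrec weight :: "lp \<Rightarrow> nat" where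
  "weight Nop = 1"
| "weight (Put a e f) = ram_cost e + ram_cost f + 1"
| "weight (p ;; q) = weight p + weight q"
| "weight (Cond e p q) = ram_cost e + 1 + weight p + weight q"
| "weight (For x y p) = weight p + 12"

text \<open>Sequencing adds depths instead of taking their maximum. Only a constant exponent is
  wanted, and a sum is easy to compare with its parts.\<close>

primrec depth :: "lp \<Rightarrow> nat" where
  "depth Nop = 0"
| "depth (Put a e f) = 0"
| "depth (p ;; q) = depth p + depth q"
| "depth (Cond e p q) = depth p + depth q"
| "depth (For x y p) = Suc (depth p)"

lemma run_frame: "a \<notin> writes p \<Longrightarrow> run p s a = s a"
proof (induction p arbitrary: s)
  case (For x y p)
  have "fold (\<lambda>i s. upd x 0 (Suc i) (run p s)) is s' a = s' a" for "is" s'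
    using For by (induction "is" arbitrary: s') auto
  then show ?case using For.prems by simp
qed auto

text \<open>The frame rule is built in: each round may use that arrays outside the writes of the
  body still have the contents of \<open>s0\<close>, so an invariant only has to mention what the
  loop changes.\<close>

lemma run_For_induct:
  assumes "x \<notin> writes p" "y \<notin> writes p" "x \<noteq> y"
    and "I 0 (upd x 0 0 s0)"
    and "\<And>i s. i < s0 y 0 \<Longrightarrow> s x 0 = i \<Longrightarrow> (\<And>a. a \<noteq> x \<Longrightarrow> a \<notin> writes p \<Longrightarrow> s a = s0 a) \<Longrightarrow> I i s
           \<Longrightarrow> I (Suc i) (upd x 0 (Suc i) (run p s))"
  shows "I (s0 y 0) (run (For x y p) s0)"
proof -
  define st where
    "st j = fold (\<lambda>i s. upd x 0 (Suc i) (run p s)) [0..<j] (upd x 0 0 s0)" for j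
  have "j \<le> s0 y 0 \<Longrightarrow> st j x 0 = j \<and> (\<forall>a. a \<noteq> x \<longrightarrow> a \<notin> writes p \<longrightarrow> st j a = s0 a) \<and> I j (st j)" for j
  proof (induction j)
    case (Suc j)
    then have "I (Suc j) (st (Suc j))" using assms(5)[of j "st j"] by (auto simp: st_def)
    then show ?case using Suc by (auto simp: st_def run_frame)
  qed (use assms in \<open>auto simp: st_def\<close>)
  then show ?thesis by (simp add: st_def)
qed

text \<open>As no loop bound is ever written, the bounds keep their initial values and one
  \<open>M\<close> controls every loop; each nesting level multiplies the cost by at most
  \<open>Suc M\<close>.\<close>

lemma ram_exec_compile:
  assumes "well_formed p" "bounds p \<inter> writes p = {}" "\<forall>y\<in>bounds p. s y 0 \<le> M"
  shows "\<exists>k \<le> weight p * Suc M ^ depth p. ram_exec (compile p) s k (run p s)"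
  using assms
proof (induction p arbitrary: s)
  case Nop
  then show ?case using ram_exec.Skip[of s] by auto
next
  case (Put a e f)
  then show ?case using ram_exec.Store[of a e f s, folded upd_def] by auto
next
  case (Then p q)
  obtain k where k: "k \<le> weight p * Suc M ^ depth p" "ram_exec (compile p) s k (run p s)"
    using Then.IH(1)[of s] Then.prems by auto
  have "\<forall>y\<in>bounds q. y \<notin> writes p" using Then.prems by auto
  then have "\<forall>y\<in>bounds q. run p s y 0 \<le> M" using Then.prems by (simp add: run_frame)
  then obtain l where l: "l \<le> weight q * Suc M ^ depth q" "ram_exec (compile q) (run p s) l (run q (run p s))"
    using Then.IH(2)[of "run p s"] Then.prems by auto
  have "k \<le> weight p * Suc M ^ (depth p + depth q)" "l \<le> weight q * Suc M ^ (depth p + depth q)"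
    using k(1) l(1) by (auto elim!: le_trans intro!: power_increasing)
  then have "k + l \<le> weight (p ;; q) * Suc M ^ depth (p ;; q)"
    by (simp only: weight.simps depth.simps add_mult_distrib)
  then show ?case using ram_exec.Seq[OF k(2) l(2)] by auto
next
  case (Cond e p q)
  obtain k where k: "k \<le> weight p * Suc M ^ depth p" "ram_exec (compile p) s k (run p s)"
    using Cond.IH(1)[of s] Cond.prems by auto
  obtain l where l: "l \<le> weight q * Suc M ^ depth q" "ram_exec (compile q) s l (run q s)"
    using Cond.IH(2)[of s] Cond.prems by auto
  have 1: "k \<le> weight p * Suc M ^ (depth p + depth q)" "l \<le> weight q * Suc M ^ (depth p + depth q)"
    using k(1) l(1) by (auto elim!: le_trans intro!: power_increasing)
  have "ram_cost e + 1 \<le> (ram_cost e + 1) * Suc M ^ (depth p + depth q)" by (metis One_nat_def Suc_leI mult.right_neutral mult_le_mono2 zero_less_Suc zero_less_power)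
  then have 2: "ram_cost e + 1 + k + l \<le> weight (Cond e p q) * Suc M ^ depth (Cond e p q)"
    using 1 by (simp only: weight.simps depth.simps add_mult_distrib)
  show ?case
  proof (cases "ram_val e s = 0")
    case True
    then show ?thesis using ram_exec.IfFalse[OF True l(2), of "compile p"] 2
      by (intro exI[of _ "ram_cost e + 1 + l"]) simp
  next
    case False
    then show ?thesis using ram_exec.IfTrue[OF False k(2), of "compile q"] 2
      by (intro exI[of _ "ram_cost e + 1 + k"]) simp
  qed
next
  case (For x y p)
  define N where "N = s y 0"
  define X where "X = weight p * Suc M ^ depth p"
  define W where "W = While (Sub (Load y (Const 0)) (Load x (Const 0)))
            (Seq (compile p) (Store x (Const 0) (Add (Load x (Const 0)) (Const 1))))"
  define st where
    "st j = fold (\<lambda>i s. upd x 0 (Suc i) (run p s)) [0..<j] (upd x 0 0 s)" for j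
  have st_x: "st j x 0 = j" for j by (cases j) (auto simp: st_def)
  have st_y: "st j a = s a" if "a \<noteq> x" "a \<notin> writes p" for a j
    using that by (induction j) (auto simp: st_def run_frame)
  have xy: "x \<noteq> y" "y \<notin> writes p" "x \<notin> writes p" "well_formed p" using For.prems by auto
  \<comment> \<open>Induction on the number \<open>i\<close> of rounds still to go, because
    \<open>WhileTrue\<close> puts a round in front of the remaining loop.\<close>
  have loop: "\<exists>k \<le> i * (12 + X) + 6. ram_exec W (st (N - i)) k (st N)" if "i \<le> N" for i
    using that
  proof (induction i)
    case 0
    have "ram_val (Sub (Load y (Const 0)) (Load x (Const 0))) (st N) = 0"
      using xy by (simp add: st_x st_y N_def)
    from ram_exec.WhileFalse[OF this] show ?case
      unfolding W_def by (intro exI[of _ 6]) (simp add: numeral_eq_Suc)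
  next
    case (Suc i)
    let ?j = "N - Suc i"
    have j: "N - i = Suc ?j" using Suc by simp
    obtain l where l: "l \<le> i * (12 + X) + 6" "ram_exec W (st (Suc ?j)) l (st N)"
      using Suc j by auto
    have "\<forall>z\<in>bounds p. z \<noteq> x \<and> z \<notin> writes p" using For.prems by auto
    then have "bounds p \<inter> writes p = {}" "\<forall>z\<in>bounds p. st ?j z 0 \<le> M"
      using For.prems by (auto simp: st_y)
    then obtain k where k: "k \<le> X" "ram_exec (compile p) (st ?j) k (run p (st ?j))"
      using For.IH[of "st ?j"] xy unfolding X_def by auto
    have "run p (st ?j) x 0 = ?j" using xy by (simp add: run_frame st_x)
    then have "ram_exec (Store x (Const 0) (Add (Load x (Const 0)) (Const 1))) (run p (st ?j)) 6 (st (Suc ?j))"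
      using ram_exec.Store[of x "Const 0" "Add (Load x (Const 0)) (Const 1)" "run p (st ?j)", folded upd_def]
      by (simp add: st_def numeral_eq_Suc)
    from ram_exec.Seq[OF k(2) this] have 1: "ram_exec (Seq (compile p) (Store x (Const 0) (Add (Load x (Const 0)) (Const 1))))
      (st ?j) (k + 6) (st (Suc ?j))" .
    have "ram_val (Sub (Load y (Const 0)) (Load x (Const 0))) (st ?j) \<noteq> 0"
      using xy Suc.prems by (simp add: st_x st_y N_def[symmetric])
    from ram_exec.WhileTrue[OF this 1 l(2)[unfolded W_def]]
    have "ram_exec W (st ?j) (6 + (k + 6) + l) (st N)"
      unfolding W_def by (simp add: numeral_eq_Suc)
    then show ?case using l(1) k(1) by (intro exI[of _ "6 + (k + 6) + l"]) simp
  qed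
  obtain k where k: "k \<le> N * (12 + X) + 6" "ram_exec W (st 0) k (st N)" using loop[of N] by auto
  have s0: "ram_exec (Store x (Const 0) (Const 0)) s 3 (st 0)"
    using ram_exec.Store[of x "Const 0" "Const 0" s, folded upd_def] by (simp add: st_def numeral_eq_Suc)
  have ex: "ram_exec (compile (For x y p)) s (3 + k) (run (For x y p) s)"
    using ram_exec.Seq[OF s0 k(2)] by (simp add: W_def st_def N_def)
  have NM: "N \<le> M" using For.prems by (simp add: N_def)
  have "3 + k \<le> 9 + N * (12 + X)" using k by simp
  also have "\<dots> \<le> 12 * Suc M ^ depth p + M * ((12 + weight p) * Suc M ^ depth p)"
  proof (rule add_mono)
    have 1: "1 \<le> Suc M ^ depth p" by simp
    then show "9 \<le> 12 * Suc M ^ depth p" by linarith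
    have "12 + X \<le> (12 + weight p) * Suc M ^ depth p"
      using 1 unfolding X_def add_mult_distrib by linarith
    then show "N * (12 + X) \<le> M * ((12 + weight p) * Suc M ^ depth p)" using NM by (intro mult_mono) auto
  qed
  also have "\<dots> \<le> Suc M * ((12 + weight p) * Suc M ^ depth p)" by (simp add: algebra_simps)
  also have "\<dots> = weight (For x y p) * Suc M ^ depth (For x y p)" by (simp add: algebra_simps)
  finally show ?case using ex by blast
qed

declare run.simps(5) [simp del]

section \<open>Reachability\<close>

text \<open>An edge of time \<open>Suc t\<close> may only start at a vertex reached by time
  \<open>t\<close>, which is the strict increase of times along a path. That vertices are not
  repeated needs no condition here, as first arrivals yield simple paths.\<close>

primrec reached_by :: "'a temporal_graph \<Rightarrow> 'a \<Rightarrow> nat \<Rightarrow> 'a set" where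
  "reached_by G u 0 = {u}"
| "reached_by G u (Suc t) =
     reached_by G u t \<union> {w. \<exists>v\<in>reached_by G u t. ({v, w}, Suc t) \<in> time_edges G}"

lemma reached_by_mono: "s \<le> t \<Longrightarrow> reached_by G u s \<subseteq> reached_by G u t"
  by (induction t) (auto simp: le_Suc_eq)

lemma reached_by_step:
  assumes "v \<in> reached_by G u s" "s < t" "({v, w}, t) \<in> time_edges G"
  shows "w \<in> reached_by G u t"
proof -
  have t: "Suc (t - 1) = t" "s \<le> t - 1" using assms(2) by auto
  then have "v \<in> reached_by G u (t - 1)" using assms(1) reached_by_mono[OF t(2), of G u] by auto
  then have "w \<in> reached_by G u (Suc (t - 1))"
    using assms(3) t(1) reached_by.simps(2)[of G u "t - 1"] by auto
  then show ?thesis using t(1) by simp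
qed

lemma temporal_path_reached_by:
  assumes "temporal_path G u p v" and pos: "\<And>e t. (e, t) \<in> time_edges G \<Longrightarrow> 0 < t"
  shows "v \<in> reached_by G u (snd (last p))"
proof -
  obtain vs where vs: "length vs = Suc (length p)" "hd vs = u" "last vs = v"
    "\<forall>i<length p. fst (p ! i) = {vs ! i, vs ! Suc i}"
    and p: "p \<noteq> []" "set p \<subseteq> time_edges G" "sorted_wrt (<) (map snd p)"
    using assms(1) unfolding temporal_path_def by blast
  have e: "({vs ! i, vs ! Suc i}, snd (p ! i)) \<in> time_edges G" if "i < length p" for i
    using vs(4) p(2) that by (metis nth_mem prod.collapse subsetD)
  have "i < length p \<Longrightarrow> vs ! Suc i \<in> reached_by G u (snd (p ! i))" for i
  proof (induction i)
    case 0
    have "vs ! 0 = u" using vs(1,2) by (cases vs) auto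
    then show ?case
      using reached_by_step[of "vs ! 0" G u 0 "snd (p ! 0)" "vs ! Suc 0"] e[OF 0] pos by auto
  next
    case (Suc i)
    have "snd (p ! i) < snd (p ! Suc i)"
      using sorted_wrt_nth_less[OF p(3), of i "Suc i"] Suc.prems by simp
    then show ?case using reached_by_step[OF _ _ e[OF Suc.prems]] Suc by simp
  qed
  from this[of "length p - 1"] have "vs ! length p \<in> reached_by G u (snd (p ! (length p - 1)))"
    using p(1) by simp
  moreover have "vs ! length p = v"
    using vs(1,3) by (metis diff_Suc_1 last_conv_nth length_0_conv nat.distinct(1))
  ultimately show ?thesis using p(1) by (simp add: last_conv_nth)
qed

text \<open>That the path stays inside \<open>reached_by G u t\<close> is what the induction needs:
  a vertex first reached at \<open>Suc t\<close> is not among those visited so far, so appending it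
  keeps the list distinct.\<close>

lemma reached_by_temporal_path:
  assumes "v \<in> reached_by G u t" "v \<noteq> u"
  shows "\<exists>p vs. p \<noteq> [] \<and> set p \<subseteq> time_edges G \<and> sorted_wrt (<) (map snd p) \<and>
     (\<forall>x\<in>set p. snd x \<le> t) \<and> length vs = Suc (length p) \<and> hd vs = u \<and> last vs = v \<and>
     distinct vs \<and> set vs \<subseteq> reached_by G u t \<and> (\<forall>i<length p. fst (p ! i) = {vs ! i, vs ! Suc i})"
  using assms
proof (induction t arbitrary: v)
  case (Suc t)
  show ?case
  proof (cases "v \<in> reached_by G u t")
    case True
    from Suc.IH[OF this Suc.prems(2)] obtain p vs where p: "p \<noteq> []" "set p \<subseteq> time_edges G"
      "sorted_wrt (<) (map snd p)" "\<forall>x\<in>set p. snd x \<le> t" "length vs = Suc (length p)"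
      "hd vs = u" "last vs = v" "distinct vs" "set vs \<subseteq> reached_by G u t"
      "\<forall>i<length p. fst (p ! i) = {vs ! i, vs ! Suc i}" by blast
    have "\<forall>x\<in>set p. snd x \<le> Suc t" "set vs \<subseteq> reached_by G u (Suc t)"
      using p(4,9) by (auto intro: le_SucI)
    then show ?thesis using p by (intro exI[of _ p] exI[of _ vs] conjI)
  next
    case False
    then obtain w where w: "w \<in> reached_by G u t" "({w, v}, Suc t) \<in> time_edges G"
      using Suc.prems by auto
    show ?thesis
    proof (cases "w = u")
      case True
      then have "({u, v}, Suc t) \<in> time_edges G" "u \<in> reached_by G u (Suc t)" using w by auto
      then show ?thesis using Suc.prems
        by (intro exI[of _ "[({u, v}, Suc t)]"] exI[of _ "[u, v]"] conjI) simp_all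
    next
      case False': False
      from Suc.IH[OF w(1) this] obtain p vs where p: "p \<noteq> []" "set p \<subseteq> time_edges G"
        "sorted_wrt (<) (map snd p)" "\<forall>x\<in>set p. snd x \<le> t" "length vs = Suc (length p)"
        "hd vs = u" "last vs = w" "distinct vs" "set vs \<subseteq> reached_by G u t"
        "\<forall>i<length p. fst (p ! i) = {vs ! i, vs ! Suc i}" by blast
      let ?p = "p @ [({w, v}, Suc t)]" and ?vs = "vs @ [v]"
      have "vs ! length p = w" using p(5,7) by (metis diff_Suc_1 last_conv_nth length_0_conv nat.distinct(1))
      then have "\<forall>i<length ?p. fst (?p ! i) = {?vs ! i, ?vs ! Suc i}"
        using p(5,10) by (auto simp: nth_append less_Suc_eq)
      moreover have "sorted_wrt (<) (map snd ?p)" using p(3,4) by (auto simp: sorted_wrt_append)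
      moreover have "set ?p \<subseteq> time_edges G" "\<forall>x\<in>set ?p. snd x \<le> Suc t" "?p \<noteq> []"
        using p(2,4) w(2) by (auto intro: le_SucI)
      moreover have "length ?vs = Suc (length ?p)" "last ?vs = v" "hd ?vs = u"
        using p(5,6) by (auto simp: hd_append)
      moreover have "distinct ?vs" using p(8,9) False by auto
      moreover have "set ?vs \<subseteq> reached_by G u (Suc t)" using p(9) Suc.prems(1) by auto
      ultimately show ?thesis by (intro exI[of _ ?p] exI[of _ ?vs] conjI)
    qed
  qed
qed simp

lemma temporally_reachable_iff_reached_by:
  assumes "\<And>e t. (e, t) \<in> time_edges G \<Longrightarrow> 0 < t \<and> t \<le> T"
  shows "temporally_reachable G u v \<longleftrightarrow> v \<in> reached_by G u T"
proof
  assume "temporally_reachable G u v"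
  then consider "v = u" | p where "temporal_path G u p v" unfolding temporally_reachable_def by blast
  then show "v \<in> reached_by G u T"
  proof cases
    case 1
    then show ?thesis using reached_by_mono[of 0 T G u] by simp
  next
    case 2
    then have "p \<noteq> []" "set p \<subseteq> time_edges G" by (simp_all add: temporal_path_def)
    then have "(fst (last p), snd (last p)) \<in> time_edges G" using last_in_set[of p] by auto
    then have "snd (last p) \<le> T" using assms by blast
    moreover have "v \<in> reached_by G u (snd (last p))" using temporal_path_reached_by[OF 2] assms by blast
    ultimately show ?thesis using reached_by_mono[of "snd (last p)" T G u] by blast
  qed
next
  assume "v \<in> reached_by G u T"
  then show "temporally_reachable G u v"
  proof (cases "v = u")
    case False
    from reached_by_temporal_path[OF \<open>v \<in> reached_by G u T\<close> this] obtain p where "temporal_path G u p v"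
      unfolding temporal_path_def by metis
    then show ?thesis unfolding temporally_reachable_def by blast
  qed (simp add: temporally_reachable_def)
qed

lemma time_edges_delete: "time_edges (delete_time_edges G D) = time_edges G - D"
  by (auto simp: time_edges_def delete_time_edges_def)

section \<open>Classes of vertices and the dynamic program\<close>

definition relax :: "nat \<Rightarrow> nat \<Rightarrow> nat \<Rightarrow> (nat \<Rightarrow> nat) \<Rightarrow> nat \<Rightarrow> nat" where
  "relax t u v f = (if f u < t \<and> t < f v then f(v := t) else f)"

definition merge :: "nat \<Rightarrow> nat \<Rightarrow> (nat \<Rightarrow> nat) \<Rightarrow> nat \<Rightarrow> nat" where
  "merge u v f = (\<lambda>w. if f w = f v then f u else f w)"

text \<open>A merge identifies nothing beyond what \<open>f\<close> and the pair \<open>p\<close>,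
  \<open>q\<close> force. The predicate \<open>P\<close> restricts this to reached vertices, the
  only ones whose bags are compared later.\<close>

lemma merge_respects:
  assumes f: "\<And>u v. P u \<Longrightarrow> P v \<Longrightarrow> f u = f v \<Longrightarrow> c u = c v"
    and pq: "P p" "P q" "c p = c q" and uv: "P u" "P v" "merge p q f u = merge p q f v"
  shows "c u = c v"
proof -
  have "c w = c p" if "P w" "f w = f q \<or> f w = f p" for w
    using f[of w q] f[of w p] pq that by auto
  then show ?thesis using f[of u v] uv by (auto simp: merge_def split: if_splits)
qed

locale edge_list =
  fixes n src :: nat and es :: "(nat \<times> nat \<times> nat) list"
  assumes edges: "(u, v, t) \<in> set es \<Longrightarrow> u < n \<and> v < n \<and> u \<noteq> v \<and> 0 < t"
    and src: "src < n"
begin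

section \<open>Edges of the list and arrival times\<close>

definition m where "m = length es"
definition ta where "ta e = fst (es ! e)"
definition he where "he e = fst (snd (es ! e))"
definition ti where "ti e = snd (snd (es ! e))"
text \<open>The inserted 0 covers the empty list, for which \<open>lifetime\<close> is
  unspecified.\<close>

definition L where "L = Max (insert 0 (ti ` {..<m}))"

lemma edge_props: "e < m \<Longrightarrow> ta e < n" "e < m \<Longrightarrow> he e < n" "e < m \<Longrightarrow> ta e \<noteq> he e"
  "e < m \<Longrightarrow> 0 < ti e" "e < m \<Longrightarrow> ti e \<le> L"
proof -
  assume e: "e < m"
  then have "(ta e, he e, ti e) \<in> set es" by (simp add: m_def ta_def he_def ti_def)
  from edges[OF this] show "ta e < n" "he e < n" "ta e \<noteq> he e" "0 < ti e" by auto
  show "ti e \<le> L" unfolding L_def using e by (intro Max_ge) auto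
qed

text \<open>\<open>arr v\<close> is the earliest time at which \<open>v\<close> is reached when nothing is deleted (\<open>Suc L\<close> if never).\<close>

definition relax_edge where
  "relax_edge t e f = (if ti e = t then relax t (he e) (ta e) (relax t (ta e) (he e) f) else f)"
definition relax_all where
  "relax_all t f = fold (relax_edge t) [0..<m] f"
definition arr where
  "arr = fold (\<lambda>t. relax_all (Suc t)) [0..<L] (\<lambda>v. if v = src then 0 else Suc L)"

text \<open>The third clause is soundness: every finite positive label is explained by a last edge.
  The fourth is completeness for the edges handled so far, those of time below \<open>t\<close> and
  those of time \<open>t\<close> among the first \<open>j\<close>.\<close>

definition arr_inv where
  "arr_inv t j f \<longleftrightarrow> (\<forall>v. f v = 0 \<longleftrightarrow> v = src) \<and> (\<forall>v. f v \<le> t \<or> f v = Suc L) \<and>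
     (\<forall>v. 0 < f v \<longrightarrow> f v \<le> L \<longrightarrow>
        (\<exists>e<m. ti e = f v \<and> (he e = v \<and> f (ta e) < f v \<or> ta e = v \<and> f (he e) < f v))) \<and>
     (\<forall>e<m. ti e < t \<or> ti e = t \<and> e < j \<longrightarrow>
        (f (ta e) < ti e \<longrightarrow> f (he e) \<le> ti e) \<and> (f (he e) < ti e \<longrightarrow> f (ta e) \<le> ti e))"

text \<open>A label given in round \<open>t\<close> equals \<open>t\<close> and so never passes the
  test \<open>f u < t\<close> in the same round. Hence edges of equal time are not chained, whatever
  their order.\<close>

lemma arr_inv_relax:
  assumes inv: "arr_inv t j f" and t: "0 < t" "t \<le> L" and e: "e < m" "ti e = t"
    and uv: "u = ta e \<and> v = he e \<or> u = he e \<and> v = ta e"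
  shows "arr_inv t j (relax t u v f)"
proof (cases "f u < t \<and> t < f v")
  case True
  \<comment> \<open>Labels are \<open>Suc L\<close> or at most \<open>t\<close>, and this one
    exceeds \<open>t\<close>: a vertex is labelled only once.\<close>
  have fv: "f v = Suc L" using inv True unfolding arr_inv_def by (metis leD)
  let ?f = "f(v := t)"
  have vs: "u \<noteq> v" using True by auto
  have 1: "?f w = 0 \<longleftrightarrow> w = src" for w
    using inv t fv unfolding arr_inv_def by (metis fun_upd_apply less_irrefl nat.distinct(1))
  have 2: "?f w \<le> t \<or> ?f w = Suc L" for w using inv unfolding arr_inv_def by auto
  have 3: "\<exists>e<m. ti e = ?f w \<and> (he e = w \<and> ?f (ta e) < ?f w \<or> ta e = w \<and> ?f (he e) < ?f w)"
    if w: "0 < ?f w" "?f w \<le> L" for w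
  proof (cases "w = v")
    case True': True
    then show ?thesis using e uv True vs by (intro exI[of _ e]) auto
  next
    case False
    then obtain e' where e': "e' < m" "ti e' = f w" "he e' = w \<and> f (ta e') < f w \<or> ta e' = w \<and> f (he e') < f w"
      using inv w unfolding arr_inv_def by (metis fun_upd_apply)
    then show ?thesis using False fv w by (intro exI[of _ e']) auto
  qed
  have 4: "(?f (ta e') < ti e' \<longrightarrow> ?f (he e') \<le> ti e') \<and> (?f (he e') < ti e' \<longrightarrow> ?f (ta e') \<le> ti e')"
    if e': "e' < m" "ti e' < t \<or> ti e' = t \<and> e' < j" for e'
  proof -
    have "(f (ta e') < ti e' \<longrightarrow> f (he e') \<le> ti e') \<and> (f (he e') < ti e' \<longrightarrow> f (ta e') \<le> ti e')"
      using inv e' unfolding arr_inv_def by blast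
    then show ?thesis using fv e'(2) t(2) by auto
  qed
  show ?thesis using True 1 2 3 4 unfolding arr_inv_def relax_def by auto
qed (use inv in \<open>auto simp: relax_def\<close>)

lemma arr_inv_relax_edge:
  assumes inv: "arr_inv t j f" and t: "0 < t" "t \<le> L" and j: "j < m"
  shows "arr_inv t (Suc j) (relax_edge t j f)"
proof (cases "ti j = t")
  case True
  let ?g = "relax t (he j) (ta j) (relax t (ta j) (he j) f)"
  have "arr_inv t j ?g" using arr_inv_relax[OF _ t j True] inv by blast
  moreover have "(?g (ta j) < t \<longrightarrow> ?g (he j) \<le> t) \<and> (?g (he j) < t \<longrightarrow> ?g (ta j) \<le> t)"
    by (auto simp: relax_def)
  ultimately show ?thesis using True unfolding arr_inv_def relax_edge_def by (auto simp: less_Suc_eq)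
next
  case False
  then show ?thesis using inv unfolding arr_inv_def relax_edge_def by (auto simp: less_Suc_eq)
qed

lemma arr_inv_Suc:
  assumes "arr_inv t m f"
  shows "arr_inv (Suc t) 0 f"
proof -
  have "\<forall>v. f v \<le> t \<or> f v = Suc L" using assms by (simp add: arr_inv_def)
  then have "\<forall>v. f v \<le> Suc t \<or> f v = Suc L" using le_SucI by blast
  moreover have "\<forall>e<m. ti e \<le> t \<longrightarrow> (f (ta e) < ti e \<longrightarrow> f (he e) \<le> ti e) \<and> (f (he e) < ti e \<longrightarrow> f (ta e) \<le> ti e)"
    using assms by (simp add: arr_inv_def le_less)
  ultimately show ?thesis using assms by (simp add: arr_inv_def less_Suc_eq_le)
qed

lemma arr_inv: "arr_inv L m arr"
proof -
  have inner: "j \<le> m \<Longrightarrow> arr_inv t j (fold (relax_edge t) [0..<j] f)"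
    if "arr_inv t 0 f" "0 < t" "t \<le> L" for t f j
    using that by (induction j) (auto intro: arr_inv_relax_edge)
  have "t \<le> L \<Longrightarrow> arr_inv t m (fold (\<lambda>t. relax_all (Suc t)) [0..<t] (\<lambda>v. if v = src then 0 else Suc L))" for t
  proof (induction t)
    case 0
    then show ?case using edge_props(4) by (auto simp: arr_inv_def)
  next
    case (Suc t)
    let ?f = "fold (\<lambda>t. relax_all (Suc t)) [0..<t] (\<lambda>v. if v = src then 0 else Suc L)"
    have "arr_inv t m ?f" using Suc by auto
    then have "arr_inv (Suc t) 0 ?f" by (rule arr_inv_Suc)
    from inner[OF this, of m] have "arr_inv (Suc t) m (relax_all (Suc t) ?f)"
      using Suc.prems by (simp add: relax_all_def)
    then show ?case by simp
  qed
  then show ?thesis unfolding arr_def by auto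
qed

lemma arr_eq_0: "arr v = 0 \<longleftrightarrow> v = src"
  using arr_inv by (simp add: arr_inv_def)

lemma arr_pred: "0 < arr v \<Longrightarrow> arr v \<le> L \<Longrightarrow>
   \<exists>e<m. ti e = arr v \<and> (he e = v \<and> arr (ta e) < arr v \<or> ta e = v \<and> arr (he e) < arr v)"
  using arr_inv by (simp add: arr_inv_def)

lemma arr_edge:
  assumes "e < m"
  shows "arr (ta e) < ti e \<Longrightarrow> arr (he e) \<le> ti e" "arr (he e) < ti e \<Longrightarrow> arr (ta e) \<le> ti e"
proof -
  have "ti e < L \<or> ti e = L \<and> e < m" using edge_props(5)[OF assms] assms by auto
  then have "(arr (ta e) < ti e \<longrightarrow> arr (he e) \<le> ti e) \<and> (arr (he e) < ti e \<longrightarrow> arr (ta e) \<le> ti e)"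
    using arr_inv assms unfolding arr_inv_def by metis
  then show "arr (ta e) < ti e \<Longrightarrow> arr (he e) \<le> ti e" "arr (he e) < ti e \<Longrightarrow> arr (ta e) \<le> ti e"
    by auto
qed

text \<open>The labels \<open>lab t\<close> are the connected components of the edges with time at least \<open>t\<close> that leave a vertex
  which has already been reached. As only \<open>src\<close> is reached at time \<open>0\<close>, one class suffices there.\<close>

definition active where
  "active e t \<longleftrightarrow> ti e = t \<and> (arr (ta e) < t \<or> arr (he e) < t)"
definition merge_edge where
  "merge_edge t e f = (if active e t then merge (ta e) (he e) f else f)"
primrec lev where
  "lev 0 = id"
| "lev (Suc d) = fold (merge_edge (L - d)) [0..<m] (lev d)"
definition lab :: "nat \<Rightarrow> nat \<Rightarrow> nat" where
  "lab t = (if t = 0 then (\<lambda>_. 0) else lev (Suc L - t))"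

section \<open>Properties of the class labels\<close>

lemma fold_merge_induct:
  assumes "P (lev d)" "\<And>e f. e < m \<Longrightarrow> active e (L - d) \<Longrightarrow> P f \<Longrightarrow> P (merge (ta e) (he e) f)"
  shows "P (lev (Suc d))"
proof -
  have "j \<le> m \<Longrightarrow> P (fold (merge_edge (L - d)) [0..<j] (lev d))" for j
    by (induction j) (use assms in \<open>auto simp: merge_edge_def\<close>)
  then show ?thesis by simp
qed

lemma lev_range: "v < n \<Longrightarrow> lev d v < n \<and> lev d (lev d v) = lev d v"
proof (induction d arbitrary: v)
  case (Suc d)
  have "\<forall>v<n. lev (Suc d) v < n \<and> lev (Suc d) (lev (Suc d) v) = lev (Suc d) v"
    by (rule fold_merge_induct) (use Suc.IH edge_props in \<open>auto simp: merge_def\<close>)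
  then show ?case using Suc.prems by blast
qed auto

text \<open>Labels are vertices representing their own classes, which lets loops over vertices
  enumerate classes.\<close>

lemma lab_range:
  assumes "v < n"
  shows "lab t v < n" "lab t (lab t v) = lab t v"
  using lev_range[OF assms, of "Suc L - t"] src by (auto simp: lab_def)

lemma lev_coarser: "lev d u = lev d v \<Longrightarrow> lev (Suc d) u = lev (Suc d) v"
  by (rule fold_merge_induct) (auto simp: merge_def)

text \<open>Labels are built from \<open>L\<close> downwards, and passing to an earlier time only
  adds merges. This refinement is what makes the classes a tree.\<close>

lemma lab_laminar:
  assumes "t < L" "lab (Suc t) u = lab (Suc t) v"
  shows "lab t u = lab t v"
  using assms lev_coarser[of "L - t" u v] by (auto simp: lab_def Suc_diff_le)

lemma lev_merged:
  assumes "e < m" "active e (L - d)"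
  shows "lev (Suc d) (ta e) = lev (Suc d) (he e)"
proof -
  have "j \<le> m \<Longrightarrow> e < j \<Longrightarrow> (fold (merge_edge (L - d)) [0..<j] (lev d)) (ta e) =
      (fold (merge_edge (L - d)) [0..<j] (lev d)) (he e)" for j
  proof (induction j)
    case (Suc j)
    then show ?case using assms by (cases "j = e") (auto simp: merge_edge_def merge_def)
  qed simp
  then show ?thesis using assms by simp
qed

lemma lab_active:
  assumes "e < m" "active e t"
  shows "lab t (ta e) = lab t (he e)"
  using assms lev_merged[of e "L - t"] edge_props(4,5)[OF assms(1)]
  by (auto simp: lab_def active_def Suc_diff_le)

text \<open>The construction of the labels respects both conditions: a merged edge has both ends
  reached by time \<open>t\<close> and satisfies \<open>A\<close>, and passing to an earlier time is
  \<open>B\<close>. So on reached vertices the labels are at least as fine as any such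
  \<open>bag\<close>, which will be instantiated with the bags of a decomposition.\<close>

lemma lab_finest:
  assumes A: "\<And>e. e < m \<Longrightarrow> active e (ti e) \<Longrightarrow> bag (ti e) (ta e) = bag (ti e) (he e)"
    and B: "\<And>t u v. 1 \<le> t \<Longrightarrow> t < L \<Longrightarrow> u < n \<Longrightarrow> v < n \<Longrightarrow> arr u \<le> t \<Longrightarrow> arr v \<le> t \<Longrightarrow>
       bag (Suc t) u = bag (Suc t) v \<Longrightarrow> bag t u = bag t v"
    and "1 \<le> t" "t \<le> L" "u < n" "v < n" "arr u \<le> t" "arr v \<le> t" "lab t u = lab t v"
  shows "bag t u = bag t v"
proof -
  define R where "R t f \<longleftrightarrow> (\<forall>u v. u < n \<and> arr u \<le> t \<longrightarrow> v < n \<and> arr v \<le> t \<longrightarrow> f u = f v \<longrightarrow> bag t u = bag t v)"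
    for t and f :: "nat \<Rightarrow> nat"
  have merge_R: "R t (merge (ta e) (he e) f)" if e: "e < m" "active e t" and f: "R t f" for e t f
  proof -
    have te: "t = ti e" using e(2) by (simp add: active_def)
    have arrs: "arr (ta e) \<le> t" "arr (he e) \<le> t" using arr_edge[OF e(1)] e(2) by (auto simp: active_def)
    have "bag t (ta e) = bag t (he e)" using A[OF e(1)] e(2) unfolding te by blast
    with merge_respects[of "\<lambda>v. v < n \<and> arr v \<le> t" f "bag t" "ta e" "he e"] f arrs edge_props(1,2)[OF e(1)]
    show ?thesis unfolding R_def by metis
  qed
  have "R (L - d) (lev (Suc d))" if "d < L" for d
    using that
  proof (induction d)
    case 0
    have "R L (lev 0)" by (simp add: R_def)
    then have "R (L - 0) (lev (Suc 0))"
      using fold_merge_induct[of "R (L - 0)" 0, OF _ merge_R] by simp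
    then show ?case .
  next
    case (Suc d)
    let ?t = "L - Suc d"
    have t: "Suc ?t = L - d" using Suc.prems by simp
    have "R ?t (lev (Suc d))"
      unfolding R_def
    proof (intro allI impI, goal_cases)
      case (1 u v)
      \<comment> \<open>Two vertices may be connected only through vertices reached after
        \<open>?t\<close>. The hypothesis at the next time already accounts for those.\<close>
      moreover have "R (Suc ?t) (lev (Suc d))" using Suc t by simp
      ultimately have "bag (Suc ?t) u = bag (Suc ?t) v" unfolding R_def by (meson le_SucI)
      moreover have "1 \<le> ?t" "?t < L" using Suc.prems by simp_all
      ultimately show ?case using B[of ?t u v] 1 by blast
    qed
    then show ?case by (rule fold_merge_induct) (rule merge_R)
  qed
  from this[of "L - t"] have "R t (lab t)" using assms(3,4) by (simp add: lab_def Suc_diff_le)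
  then show ?thesis unfolding R_def using assms(5-) by blast
qed

text \<open>Subsets of the reached part of a class are encoded by numbers: bit \<open>rank t v\<close> stands for \<open>v\<close>. Bit \<open>n\<close>
  is never set, so vertices that have not been reached belong to no encoded set.\<close>

definition rank where
  "rank t v = (if arr v \<le> t then card {w. w < v \<and> arr w \<le> t \<and> lab t w = lab t v} else n)"

text \<open>The size of the largest reached part of a class: its ranks are 0, 1, and so on without
  gaps. A maximum of ranks is what the program can track.\<close>

definition bits where
  "bits = Max (insert 0 ((\<lambda>(t, v). Suc (rank t v)) ` {(t, v). t \<le> L \<and> v < n \<and> arr v \<le> t}))"

section \<open>Ranks and codes of subsets of a class\<close>

lemma arrived_finite: "finite ((\<lambda>(t, v). Suc (rank t v)) ` {(t, v). t \<le> L \<and> v < n \<and> arr v \<le> t})"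
  by (rule finite_imageI, rule finite_subset[of _ "{..L} \<times> {..<n}"]) auto

lemma rank_less_bits: "t \<le> L \<Longrightarrow> v < n \<Longrightarrow> arr v \<le> t \<Longrightarrow> rank t v < bits"
  unfolding bits_def using arrived_finite by (intro Suc_le_lessD Max_ge) force+

lemma bits_leI:
  assumes "\<And>t v. t \<le> L \<Longrightarrow> v < n \<Longrightarrow> arr v \<le> t \<Longrightarrow> rank t v < k"
  shows "bits \<le> k"
  unfolding bits_def using arrived_finite assms by (intro Max.boundedI) (auto simp: Suc_le_eq)

lemma rank_le:
  assumes "v < n" "arr v \<le> t"
  shows "rank t v < card {w. w < n \<and> arr w \<le> t \<and> lab t w = lab t v}"
proof -
  have "rank t v < card (insert v {w. w < v \<and> arr w \<le> t \<and> lab t w = lab t v})"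
    using assms by (simp add: rank_def)
  also have "\<dots> \<le> card {w. w < n \<and> arr w \<le> t \<and> lab t w = lab t v}"
    using assms by (intro card_mono) auto
  finally show ?thesis .
qed

lemma rank_less_n: "v < n \<Longrightarrow> arr v \<le> t \<Longrightarrow> rank t v < n"
  using rank_le[of v t] card_mono[of "{..<n}" "{w. w < n \<and> arr w \<le> t \<and> lab t w = lab t v}"] by force

lemma bits_le_n: "bits \<le> n"
  by (rule bits_leI) (rule rank_less_n)

lemma bits_pos: "0 < bits"
  using rank_less_bits[of 0 src] src arr_eq_0[of src] by simp

lemma rank_inj:
  assumes "v < w" "arr v \<le> t" "arr w \<le> t" "lab t v = lab t w"
  shows "rank t v < rank t w"
proof -
  have "rank t v < card (insert v {u. u < v \<and> arr u \<le> t \<and> lab t u = lab t v})"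
    using assms by (simp add: rank_def)
  also have "\<dots> \<le> card {u. u < w \<and> arr u \<le> t \<and> lab t u = lab t w}"
    using assms by (intro card_mono) auto
  finally show ?thesis using assms by (simp add: rank_def)
qed

definition cls where "cls t a = {v. v < n \<and> lab t v = a}"
definition dec :: "nat \<Rightarrow> nat \<Rightarrow> nat \<Rightarrow> nat set" where "dec t a x = {v \<in> cls t a. bit x (rank t v)}"
definition arrived where "arrived t = {v. v < n \<and> arr v \<le> t}"

lemma finite_cls [simp]: "finite (cls t a)" by (simp add: cls_def)
lemma finite_arrived [simp]: "finite (arrived t)" by (simp add: arrived_def)

lemma bit_high: "(x::nat) < 2 ^ k \<Longrightarrow> k \<le> i \<Longrightarrow> \<not> bit x i"
  by (metis div_less bit_iff_odd even_zero less_le_trans one_le_numeral power_increasing)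

lemma dec_arrived:
  assumes "t \<le> L" "x < 2 ^ bits"
  shows "dec t a x \<subseteq> arrived t"
proof
  fix v assume v: "v \<in> dec t a x"
  then have "bit x (rank t v)" by (simp add: dec_def)
  then have "rank t v < bits" using bit_high[OF assms(2)] by (meson not_le)
  then have "rank t v \<noteq> n" using bits_le_n by auto
  then show "v \<in> arrived t" using v by (auto simp: dec_def cls_def arrived_def rank_def split: if_splits)
qed

lemma ex_code: "A \<subseteq> {..<k} \<Longrightarrow> \<exists>x::nat. x < 2 ^ k \<and> (\<forall>i. bit x i \<longleftrightarrow> i \<in> A)"
proof (induction k arbitrary: A)
  case (Suc k)
  have "{i. Suc i \<in> A} \<subseteq> {..<k}" using Suc.prems by auto
  from Suc.IH[OF this] obtain x :: nat where x: "x < 2 ^ k" "\<forall>i. bit x i \<longleftrightarrow> Suc i \<in> A" by auto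
  let ?y = "2 * x + of_bool (0 \<in> A)"
  have "bit ?y i \<longleftrightarrow> i \<in> A" for i
  proof (cases i)
    case (Suc j)
    have "?y div 2 = x" by simp
    then show ?thesis using x Suc by (simp add: bit_Suc)
  qed (simp add: bit_0)
  moreover have "?y < 2 ^ Suc k" using x(1) by (simp add: of_bool_def)
  ultimately show ?case by blast
qed auto

lemma ex_dec:
  assumes "t \<le> L" "Y \<subseteq> cls t a \<inter> arrived t"
  shows "\<exists>y < 2 ^ bits. dec t a y = Y"
proof -
  have "rank t ` Y \<subseteq> {..<bits}" using assms rank_less_bits by (auto simp: cls_def arrived_def)
  from ex_code[OF this] obtain y :: nat where y: "y < 2 ^ bits" "\<forall>i. bit y i \<longleftrightarrow> i \<in> rank t ` Y" by blast
  have "dec t a y = Y"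
  proof
    show "Y \<subseteq> dec t a y" using assms y by (auto simp: dec_def)
    show "dec t a y \<subseteq> Y"
    proof
      fix v assume v: "v \<in> dec t a y"
      then obtain w where w: "w \<in> Y" "rank t v = rank t w" using y by (auto simp: dec_def)
      have "v \<in> arrived t" using v dec_arrived[OF assms(1) y(1)] by blast
      moreover have "w \<in> cls t a" "w \<in> arrived t" "v \<in> cls t a" using w assms v by (auto simp: dec_def)
      ultimately have "v = w" using w(2) rank_inj[of v w t] rank_inj[of w v t]
        by (cases v w rule: linorder_cases) (auto simp: cls_def arrived_def)
      then show "v \<in> Y" using w by simp
    qed
  qed
  then show ?thesis using y by blast
qed

section \<open>Cuts and their independence across classes\<close>

definition cut where
  "cut t X Y = {e. e < m \<and> ti e = t \<and> (ta e \<in> X \<and> he e \<notin> Y \<or> he e \<in> X \<and> ta e \<notin> Y)}"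

lemma finite_cut [simp]: "finite (cut t X Y)" by (simp add: cut_def)

text \<open>\<open>spread d Z X c q\<close>: in the last \<open>d\<close> time steps the reached set can grow from \<open>X\<close> inside \<open>Z\<close> by at most
  \<open>c\<close> vertices at the cost of at most \<open>q\<close> deletions.\<close>

primrec spread :: "nat \<Rightarrow> nat set \<Rightarrow> nat set \<Rightarrow> nat \<Rightarrow> nat \<Rightarrow> bool" where
  "spread 0 Z X c q = True"
| "spread (Suc d) Z X c q =
     (\<exists>Y c' q'. X \<subseteq> Y \<and> Y \<subseteq> Z \<inter> arrived (L - d) \<and> card (cut (L - d) X Y) + q' \<le> q \<and>
        card (Y - X) + c' \<le> c \<and> spread d Z Y c' q')"

lemma spread_mono: "spread d Z X c q \<Longrightarrow> c \<le> c' \<Longrightarrow> q \<le> q' \<Longrightarrow> spread d Z X c' q'"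
proof (cases d)
  case (Suc e)
  assume "spread d Z X c q" "c \<le> c'" "q \<le> q'"
  then show ?thesis unfolding Suc spread.simps by (meson le_trans)
qed simp

text \<open>The unions of classes of time \<open>t\<close>, on which the problem decomposes.\<close>

definition saturated where
  "saturated t Z \<longleftrightarrow> Z \<subseteq> {..<n} \<and> (\<forall>u\<in>Z. \<forall>v<n. lab t u = lab t v \<longrightarrow> v \<in> Z)"

lemma saturated_Suc: "saturated t Z \<Longrightarrow> t < L \<Longrightarrow> saturated (Suc t) Z"
  unfolding saturated_def using lab_laminar by metis

text \<open>Here the restriction to reached vertices pays off: every edge that a chain may have to
  cut is active, and so runs inside one class of its time.\<close>

lemma active_arrived:
  assumes "e < m" "X \<subseteq> arrived (ti e - 1)" "ta e \<in> X \<or> he e \<in> X"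
  shows "active e (ti e)"
  using assms edge_props(4)[OF assms(1)] by (auto simp: active_def arrived_def)

text \<open>Both ends of an edge meeting \<open>X1 \<union> X2\<close> at time \<open>t\<close> lie
  in one class, hence in the same one of the two saturated sets. So no edge crosses, and none is
  counted twice.\<close>

lemma cut_Un:
  assumes Z: "saturated t Z1" "saturated t Z2" "Z1 \<inter> Z2 = {}"
    and X: "X1 \<subseteq> Z1 \<inter> arrived (t - 1)" "X2 \<subseteq> Z2 \<inter> arrived (t - 1)"
    and Y: "Y1 \<subseteq> Z1" "Y2 \<subseteq> Z2"
  shows "card (cut t (X1 \<union> X2) (Y1 \<union> Y2)) = card (cut t X1 Y1) + card (cut t X2 Y2)"
proof -
  have same: "ta e \<in> Z \<longleftrightarrow> he e \<in> Z"
    if "e < m" "ti e = t" "ta e \<in> X1 \<union> X2 \<or> he e \<in> X1 \<union> X2" "saturated t Z" for e Z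
  proof -
    have "active e t" using active_arrived[of e "X1 \<union> X2"] that X by auto
    from lab_active[OF that(1) this] show ?thesis
      using that(4) edge_props(1,2)[OF that(1)] unfolding saturated_def by metis
  qed
  have "cut t (X1 \<union> X2) (Y1 \<union> Y2) = cut t X1 Y1 \<union> cut t X2 Y2"
    unfolding cut_def using same[OF _ _ _ Z(1)] same[OF _ _ _ Z(2)] Z(3) X Y by blast
  moreover have "cut t X1 Y1 \<inter> cut t X2 Y2 = {}"
    unfolding cut_def using same[OF _ _ _ Z(1)] same[OF _ _ _ Z(2)] Z(3) X by blast
  ultimately show ?thesis by (simp add: card_Un_disjoint)
qed

text \<open>Cuts and newly reached vertices both add up over disjoint unions of classes. So chains
  in the two parts can be chosen independently, and only the budgets have to be divided.\<close>

lemma spread_Un: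
  assumes "d \<le> L" "saturated (Suc L - d) Z1" "saturated (Suc L - d) Z2" "Z1 \<inter> Z2 = {}"
    and "X1 \<subseteq> Z1 \<inter> arrived (L - d)" "X2 \<subseteq> Z2 \<inter> arrived (L - d)"
  shows "spread d (Z1 \<union> Z2) (X1 \<union> X2) c q \<longleftrightarrow>
    (\<exists>c1 c2 q1 q2. c1 + c2 \<le> c \<and> q1 + q2 \<le> q \<and> spread d Z1 X1 c1 q1 \<and> spread d Z2 X2 c2 q2)"
  using assms
proof (induction d arbitrary: X1 X2 c q)
  case 0
  then show ?case by (auto intro!: exI[of _ 0])
next
  case (Suc d)
  let ?t = "L - d"
  have t: "?t - 1 = L - Suc d" "Suc L - Suc d = ?t" "Suc L - d = Suc ?t" "d \<le> L" using Suc.prems(1) by auto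
  have sat: "saturated ?t Z1" "saturated ?t Z2" using Suc.prems(2,3) t(2) by auto
  \<comment> \<open>Laminarity ends at time \<open>L\<close>, so saturation is passed on only for
    \<open>d > 0\<close>. For \<open>d = 0\<close> the remaining \<open>spread\<close> is trivially
    true.\<close>
  have sat': "saturated (Suc L - d) Z1" "saturated (Suc L - d) Z2" if "d \<noteq> 0"
    using sat that saturated_Suc[of ?t] Suc.prems(1) by (auto simp: t(3))
  have IH: "spread d (Z1 \<union> Z2) (Y1 \<union> Y2) c q \<longleftrightarrow>
    (\<exists>c1 c2 q1 q2. c1 + c2 \<le> c \<and> q1 + q2 \<le> q \<and> spread d Z1 Y1 c1 q1 \<and> spread d Z2 Y2 c2 q2)"
    if "Y1 \<subseteq> Z1 \<inter> arrived ?t" "Y2 \<subseteq> Z2 \<inter> arrived ?t" for Y1 Y2 c q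
  proof (cases "d = 0")
    case True
    then show ?thesis by (auto intro!: exI[of _ 0])
  next
    case False
    then show ?thesis using Suc.IH[OF t(4) sat' Suc.prems(4) that] by simp
  qed
  have cut: "card (cut ?t (X1 \<union> X2) (Y1 \<union> Y2)) = card (cut ?t X1 Y1) + card (cut ?t X2 Y2)"
    if "Y1 \<subseteq> Z1 \<inter> arrived ?t" "Y2 \<subseteq> Z2 \<inter> arrived ?t" for Y1 Y2
    using cut_Un[OF sat Suc.prems(4)] Suc.prems(5,6) that t(1) by simp
  have new: "card ((Y1 \<union> Y2) - (X1 \<union> X2)) = card (Y1 - X1) + card (Y2 - X2)"
    if "Y1 \<subseteq> Z1 \<inter> arrived ?t" "Y2 \<subseteq> Z2 \<inter> arrived ?t" for Y1 Y2
  proof -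
    have "(Y1 \<union> Y2) - (X1 \<union> X2) = (Y1 - X1) \<union> (Y2 - X2)" using that Suc.prems(4-6) by blast
    moreover have "finite Y1" "finite Y2" using that by (meson finite_arrived finite_subset le_infE)+
    moreover have "(Y1 - X1) \<inter> (Y2 - X2) = {}" using that Suc.prems(4) by blast
    ultimately show ?thesis by (simp add: card_Un_disjoint)
  qed
  show ?case
  proof
    assume "spread (Suc d) (Z1 \<union> Z2) (X1 \<union> X2) c q"
    then obtain Y c' q' where Y: "X1 \<union> X2 \<subseteq> Y" "Y \<subseteq> (Z1 \<union> Z2) \<inter> arrived ?t"
      "card (cut ?t (X1 \<union> X2) Y) + q' \<le> q" "card (Y - (X1 \<union> X2)) + c' \<le> c" "spread d (Z1 \<union> Z2) Y c' q'"
      by auto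
    define Y1 Y2 where "Y1 = Y \<inter> Z1" and "Y2 = Y \<inter> Z2"
    have Y12: "Y = Y1 \<union> Y2" "Y1 \<subseteq> Z1 \<inter> arrived ?t" "Y2 \<subseteq> Z2 \<inter> arrived ?t" "X1 \<subseteq> Y1" "X2 \<subseteq> Y2"
      using Y(1,2) Suc.prems(5,6) by (auto simp: Y1_def Y2_def)
    obtain c1 c2 q1 q2 where s: "c1 + c2 \<le> c'" "q1 + q2 \<le> q'" "spread d Z1 Y1 c1 q1" "spread d Z2 Y2 c2 q2"
      using Y(5) IH[OF Y12(2,3)] Y12(1) by auto
    have "spread (Suc d) Z1 X1 (card (Y1 - X1) + c1) (card (cut ?t X1 Y1) + q1)"
      "spread (Suc d) Z2 X2 (card (Y2 - X2) + c2) (card (cut ?t X2 Y2) + q2)"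
      using Y12 s by (auto simp del: card_Diff_insert)
    moreover have "(card (Y1 - X1) + c1) + (card (Y2 - X2) + c2) \<le> c"
      using Y(4) s(1) new[OF Y12(2,3)] Y12(1) by simp
    moreover have "(card (cut ?t X1 Y1) + q1) + (card (cut ?t X2 Y2) + q2) \<le> q"
      using Y(3) s(2) cut[OF Y12(2,3)] Y12(1) by simp
    ultimately show "\<exists>c1 c2 q1 q2. c1 + c2 \<le> c \<and> q1 + q2 \<le> q \<and> spread (Suc d) Z1 X1 c1 q1 \<and> spread (Suc d) Z2 X2 c2 q2"
      by blast
  next
    assume "\<exists>c1 c2 q1 q2. c1 + c2 \<le> c \<and> q1 + q2 \<le> q \<and> spread (Suc d) Z1 X1 c1 q1 \<and> spread (Suc d) Z2 X2 c2 q2"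
    then obtain c1 c2 q1 q2 where s: "c1 + c2 \<le> c" "q1 + q2 \<le> q" "spread (Suc d) Z1 X1 c1 q1" "spread (Suc d) Z2 X2 c2 q2"
      by blast
    from s(3) obtain Y1 c1' q1' where Y1: "X1 \<subseteq> Y1" "Y1 \<subseteq> Z1 \<inter> arrived ?t"
      "card (cut ?t X1 Y1) + q1' \<le> q1" "card (Y1 - X1) + c1' \<le> c1" "spread d Z1 Y1 c1' q1'" by auto
    from s(4) obtain Y2 c2' q2' where Y2: "X2 \<subseteq> Y2" "Y2 \<subseteq> Z2 \<inter> arrived ?t"
      "card (cut ?t X2 Y2) + q2' \<le> q2" "card (Y2 - X2) + c2' \<le> c2" "spread d Z2 Y2 c2' q2'" by auto
    have "spread d (Z1 \<union> Z2) (Y1 \<union> Y2) (c1' + c2') (q1' + q2')"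
      using IH[OF Y1(2) Y2(2)] Y1(5) Y2(5) by blast
    moreover have "X1 \<union> X2 \<subseteq> Y1 \<union> Y2" "Y1 \<union> Y2 \<subseteq> (Z1 \<union> Z2) \<inter> arrived ?t"
      using Y1(1,2) Y2(1,2) by auto
    moreover have "card (cut ?t (X1 \<union> X2) (Y1 \<union> Y2)) + (q1' + q2') \<le> q"
      using cut[OF Y1(2) Y2(2)] Y1(3) Y2(3) s(2) by simp
    moreover have "card ((Y1 \<union> Y2) - (X1 \<union> X2)) + (c1' + c2') \<le> c"
      using new[OF Y1(2) Y2(2)] Y1(4) Y2(4) s(1) by simp
    ultimately show "spread (Suc d) (Z1 \<union> Z2) (X1 \<union> X2) c q"
      unfolding spread.simps by blast
  qed
qed

section \<open>Children of a class and the recurrence\<close>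

definition below where "below t a b = {v. v < n \<and> lab t v = a \<and> lab (Suc t) v < b}"
definition child where "child t a b \<longleftrightarrow> lab (Suc t) b = b \<and> lab t b = a"

lemma below_0 [simp]: "below t a 0 = {}"
  by (simp add: below_def)

lemma below_n: "below t a n = cls t a"
  using lab_range by (auto simp: below_def cls_def)

lemma lab_Suc_child: "t < L \<Longrightarrow> v < n \<Longrightarrow> child t (lab t v) (lab (Suc t) v)"
  unfolding child_def using lab_range lab_laminar by blast

lemma below_not_child: "t < L \<Longrightarrow> \<not> child t a b \<Longrightarrow> below t a (Suc b) = below t a b"
  unfolding below_def using lab_Suc_child by (auto simp: less_Suc_eq)

lemma cls_child:
  assumes "t < L" "child t a b"
  shows "cls (Suc t) b \<subseteq> cls t a"
proof
  fix v assume v: "v \<in> cls (Suc t) b"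
  then have "lab (Suc t) v = lab (Suc t) b" using assms(2) by (simp add: cls_def child_def)
  from lab_laminar[OF assms(1) this] show "v \<in> cls t a" using v assms(2) by (simp add: cls_def child_def)
qed

lemma below_child: "t < L \<Longrightarrow> child t a b \<Longrightarrow> below t a (Suc b) = below t a b \<union> cls (Suc t) b"
  using cls_child[of t a b] by (auto simp: below_def cls_def less_Suc_eq)

lemma saturated_below:
  assumes "t < L"
  shows "saturated (Suc t) (below t a b)"
  unfolding saturated_def
proof (intro conjI ballI allI impI)
  fix u v assume u: "u \<in> below t a b" "v < n" "lab (Suc t) u = lab (Suc t) v"
  then show "v \<in> below t a b" using lab_laminar[OF assms u(3)] by (simp add: below_def)
qed (auto simp: below_def)

lemma saturated_cls: "saturated t (cls t a)"
  unfolding saturated_def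
proof (intro conjI ballI allI impI)
  fix u v assume u: "u \<in> cls t a" "v < n" "lab t u = lab t v"
  then show "v \<in> cls t a" by (simp add: cls_def)
qed (auto simp: cls_def)

text \<open>Children are treated like the items of a knapsack, one at a time.
  \<open>spread_Un\<close> separates the new child, one unfolding of \<open>spread\<close> exposes
  its reached part at time \<open>Suc t\<close>, and that part has a code \<open>y\<close>. Giving
  the child all of the vertex budget that \<open>c1\<close> and its new vertices leave loses nothing
  by \<open>spread_mono\<close>, so only \<open>c1\<close> has to be searched.\<close>

lemma spread_below_child:
  assumes t: "t < L" and ch: "child t a b" and x: "x < 2 ^ bits"
  shows "spread (L - t) (below t a (Suc b)) (dec t a x \<inter> below t a (Suc b)) c q \<longleftrightarrow>
    (\<exists>y < 2 ^ bits. dec t a x \<inter> cls (Suc t) b \<subseteq> dec (Suc t) b y \<and>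
      (\<exists>c1 q1 q2. c1 + card (dec (Suc t) b y - dec t a x \<inter> cls (Suc t) b) \<le> c \<and>
        q1 + card (cut (Suc t) (dec t a x \<inter> cls (Suc t) b) (dec (Suc t) b y)) + q2 \<le> q \<and>
        spread (L - t) (below t a b) (dec t a x \<inter> below t a b) c1 q1 \<and>
        spread (L - Suc t) (cls (Suc t) b) (dec (Suc t) b y)
          (c - (c1 + card (dec (Suc t) b y - dec t a x \<inter> cls (Suc t) b))) q2))" (is "?l = ?r")
proof -
  let ?X = "dec t a x" and ?Z = "cls (Suc t) b" and ?U = "below t a b"
  have ar: "?X \<subseteq> arrived t" using dec_arrived t x by simp
  have d: "L - t = Suc (L - Suc t)" "Suc L - (L - t) = Suc t" "L - (L - t) = t" "L - (L - Suc t) = Suc t" using t by auto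
  have split: "?l \<longleftrightarrow> (\<exists>c1 c2 q1 q2. c1 + c2 \<le> c \<and> q1 + q2 \<le> q \<and>
      spread (L - t) ?U (?X \<inter> ?U) c1 q1 \<and> spread (L - t) ?Z (?X \<inter> ?Z) c2 q2)"
    unfolding below_child[OF t ch] Int_Un_distrib
    by (rule spread_Un) (use t ar saturated_below saturated_cls in \<open>auto simp: d below_def cls_def\<close>)
  have step: "spread (L - t) ?Z (?X \<inter> ?Z) c2 q2 \<longleftrightarrow> (\<exists>y c' q'. y < 2 ^ bits \<and> ?X \<inter> ?Z \<subseteq> dec (Suc t) b y \<and>
     card (cut (Suc t) (?X \<inter> ?Z) (dec (Suc t) b y)) + q' \<le> q2 \<and> card (dec (Suc t) b y - ?X \<inter> ?Z) + c' \<le> c2 \<and>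
     spread (L - Suc t) ?Z (dec (Suc t) b y) c' q')" (is "?s = (\<exists>y c' q'. ?P y c' q')") for c2 q2
  proof
    assume ?s
    then obtain Y c' q' where Y: "?X \<inter> ?Z \<subseteq> Y" "Y \<subseteq> ?Z \<inter> arrived (Suc t)"
      "card (cut (Suc t) (?X \<inter> ?Z) Y) + q' \<le> q2" "card (Y - ?X \<inter> ?Z) + c' \<le> c2" "spread (L - Suc t) ?Z Y c' q'"
      unfolding d(1) spread.simps d(4) by blast
    obtain y where "y < 2 ^ bits" "dec (Suc t) b y = Y" using ex_dec[OF _ Y(2)] t by auto
    then show "\<exists>y c' q'. ?P y c' q'" using Y by blast
  next
    assume "\<exists>y c' q'. ?P y c' q'"
    then obtain y c' q' where P: "?P y c' q'" by blast
    have "dec (Suc t) b y \<subseteq> ?Z \<inter> arrived (Suc t)"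
      using dec_arrived[of "Suc t" y b] P t by (auto simp: dec_def)
    then show ?s unfolding d(1) spread.simps d(4) using P by blast
  qed
  show ?thesis
  proof
    assume ?l
    then obtain c1 c2 q1 q2 where 1: "c1 + c2 \<le> c" "q1 + q2 \<le> q" "spread (L - t) ?U (?X \<inter> ?U) c1 q1"
      "spread (L - t) ?Z (?X \<inter> ?Z) c2 q2" unfolding split by blast
    from 1(4) obtain y c' q' where y: "y < 2 ^ bits" "?X \<inter> ?Z \<subseteq> dec (Suc t) b y"
     "card (cut (Suc t) (?X \<inter> ?Z) (dec (Suc t) b y)) + q' \<le> q2" "card (dec (Suc t) b y - ?X \<inter> ?Z) + c' \<le> c2"
     "spread (L - Suc t) ?Z (dec (Suc t) b y) c' q'" unfolding step by blast
    have "spread (L - Suc t) ?Z (dec (Suc t) b y) (c - (c1 + card (dec (Suc t) b y - ?X \<inter> ?Z))) q'"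
      by (rule spread_mono[OF y(5)]) (use y(4) 1(1) in auto)
    moreover have "c1 + card (dec (Suc t) b y - ?X \<inter> ?Z) \<le> c" using y(4) 1(1) by linarith
    moreover have "q1 + card (cut (Suc t) (?X \<inter> ?Z) (dec (Suc t) b y)) + q' \<le> q" using y(3) 1(2) by linarith
    ultimately show ?r using y(1,2) 1(3) by blast
  next
    assume ?r
    then obtain y c1 q1 q2 where y: "y < 2 ^ bits" "?X \<inter> ?Z \<subseteq> dec (Suc t) b y"
      "c1 + card (dec (Suc t) b y - ?X \<inter> ?Z) \<le> c"
      "q1 + card (cut (Suc t) (?X \<inter> ?Z) (dec (Suc t) b y)) + q2 \<le> q"
      "spread (L - t) ?U (?X \<inter> ?U) c1 q1"
      "spread (L - Suc t) ?Z (dec (Suc t) b y) (c - (c1 + card (dec (Suc t) b y - ?X \<inter> ?Z))) q2" by blast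
    have "spread (L - t) ?Z (?X \<inter> ?Z) (c - c1) (card (cut (Suc t) (?X \<inter> ?Z) (dec (Suc t) b y)) + q2)"
      unfolding step
      by (rule exI[of _ y], rule exI[of _ "c - (c1 + card (dec (Suc t) b y - ?X \<inter> ?Z))"], rule exI[of _ q2])
        (use y(1,2,3,6) in auto)
    moreover have "c1 + (c - c1) \<le> c" using y(3) by simp
    moreover have "q1 + (card (cut (Suc t) (?X \<inter> ?Z) (dec (Suc t) b y)) + q2) \<le> q" using y(4) by simp
    ultimately show ?l unfolding split using y(5) by blast
  qed
qed

text \<open>Choosing the sets one step at a time yields a chain. Since it grows, the numbers of new
  vertices telescope to \<open>card (S L - X)\<close>.\<close>

lemma spread_chain:
  assumes "d \<le> L"
  shows "spread d Z X c q \<longleftrightarrow> (\<exists>S. S (L - d) = X \<and>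
    (\<forall>t. L - d \<le> t \<longrightarrow> t < L \<longrightarrow> S t \<subseteq> S (Suc t) \<and> S (Suc t) \<subseteq> Z \<inter> arrived (Suc t)) \<and>
    (\<Sum>t=L-d..<L. card (cut (Suc t) (S t) (S (Suc t)))) \<le> q \<and> card (S L - X) \<le> c)"
  using assms
proof (induction d arbitrary: X c q)
  case 0
  show ?case by (auto intro!: exI[of _ "\<lambda>_. X"])
next
  case (Suc d)
  let ?t = "L - Suc d"
  have t: "Suc ?t = L - d" "?t < L" using Suc.prems by auto
  have fin: "finite Y" if "Y \<subseteq> Z \<inter> arrived (L - d)" for Y using that by (meson finite_arrived finite_subset le_infE)
  show ?case
  proof
    assume "spread (Suc d) Z X c q"
    then obtain Y c' q' where Y: "X \<subseteq> Y" "Y \<subseteq> Z \<inter> arrived (L - d)" "card (cut (L - d) X Y) + q' \<le> q"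
        "card (Y - X) + c' \<le> c" "spread d Z Y c' q'" by auto
    obtain S where S: "S (L - d) = Y"
      "\<forall>t. L - d \<le> t \<longrightarrow> t < L \<longrightarrow> S t \<subseteq> S (Suc t) \<and> S (Suc t) \<subseteq> Z \<inter> arrived (Suc t)"
      "(\<Sum>t=L-d..<L. card (cut (Suc t) (S t) (S (Suc t)))) \<le> q'" "card (S L - Y) \<le> c'"
      using Y(5) Suc.IH[of Y c' q'] Suc.prems by auto
    define S' where "S' t = (if t = ?t then X else S t)" for t
    have S'S: "S' t = S t" if "L - d \<le> t" for t using that t by (auto simp: S'_def)
    have S't: "S' ?t = X" by (simp add: S'_def)
    have "S' t \<subseteq> S' (Suc t) \<and> S' (Suc t) \<subseteq> Z \<inter> arrived (Suc t)" if "?t \<le> t" "t < L" for t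
    proof (cases "t = ?t")
      case True
      then show ?thesis using Y(1,2) S(1) S't S'S[of "L - d"] t by simp
    next
      case False
      then have "L - d \<le> t" using that by linarith
      then show ?thesis using S(2) that S'S by simp
    qed
    moreover have "(\<Sum>t=?t..<L. card (cut (Suc t) (S' t) (S' (Suc t)))) \<le> q"
    proof -
      have "(\<Sum>t=?t..<L. card (cut (Suc t) (S' t) (S' (Suc t)))) = card (cut (L - d) X Y) +
         (\<Sum>t=L-d..<L. card (cut (Suc t) (S' t) (S' (Suc t))))"
        using S't S'S S(1) t(1) by (simp add: sum.atLeast_Suc_lessThan[OF t(2)])
      also have "(\<Sum>t=L-d..<L. card (cut (Suc t) (S' t) (S' (Suc t)))) = (\<Sum>t=L-d..<L. card (cut (Suc t) (S t) (S (Suc t))))"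
        by (rule sum.cong) (auto simp: S'S)
      finally show ?thesis using S(3) Y(3) by simp
    qed
    moreover have "card (S' L - X) \<le> c"
    proof -
      have "S' L - X \<subseteq> (S L - Y) \<union> (Y - X)" using S'S[of L] by auto
      moreover have "finite (S L)" 
      proof (cases "d = 0")
        case True
        then show ?thesis using S(1) fin[OF Y(2)] by simp
      next
        case False
        then have "S (Suc (L - 1)) \<subseteq> arrived (Suc (L - 1))" using S(2)[rule_format, of "L - 1"] Suc.prems by auto
        then show ?thesis using Suc.prems False by (metis One_nat_def Suc_pred finite_arrived finite_subset le_zero_eq neq0_conv nat.distinct(1))
      qed
      ultimately have "card (S' L - X) \<le> card ((S L - Y) \<union> (Y - X))" using fin[OF Y(2)] by (intro card_mono) auto
      also have "\<dots> \<le> card (S L - Y) + card (Y - X)" by (rule card_Un_le)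
      finally show ?thesis using S(4) Y(4) by simp
    qed
    ultimately show "\<exists>S. S ?t = X \<and>
    (\<forall>t. ?t \<le> t \<longrightarrow> t < L \<longrightarrow> S t \<subseteq> S (Suc t) \<and> S (Suc t) \<subseteq> Z \<inter> arrived (Suc t)) \<and>
    (\<Sum>t=?t..<L. card (cut (Suc t) (S t) (S (Suc t)))) \<le> q \<and> card (S L - X) \<le> c"
      using S't by blast
  next
    assume "\<exists>S. S ?t = X \<and>
    (\<forall>t. ?t \<le> t \<longrightarrow> t < L \<longrightarrow> S t \<subseteq> S (Suc t) \<and> S (Suc t) \<subseteq> Z \<inter> arrived (Suc t)) \<and>
    (\<Sum>t=?t..<L. card (cut (Suc t) (S t) (S (Suc t)))) \<le> q \<and> card (S L - X) \<le> c"
    then obtain S where S: "S ?t = X"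
      "\<And>t. ?t \<le> t \<Longrightarrow> t < L \<Longrightarrow> S t \<subseteq> S (Suc t) \<and> S (Suc t) \<subseteq> Z \<inter> arrived (Suc t)"
      "(\<Sum>t=?t..<L. card (cut (Suc t) (S t) (S (Suc t)))) \<le> q" "card (S L - X) \<le> c" by blast
    let ?Y = "S (L - d)"
    have Y: "X \<subseteq> ?Y" "?Y \<subseteq> Z \<inter> arrived (L - d)" using S(2)[of ?t] S(1) t by auto
    have YL: "?Y \<subseteq> S L \<and> finite (S L)"
    proof -
      have "i \<le> d \<Longrightarrow> ?Y \<subseteq> S (L - d + i) \<and> finite (S (L - d + i))" for i
      proof (induction i)
        case (Suc i)
        have "S (L - d + i) \<subseteq> S (Suc (L - d + i)) \<and> S (Suc (L - d + i)) \<subseteq> Z \<inter> arrived (Suc (L - d + i))"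
          using S(2)[of "L - d + i"] Suc.prems \<open>Suc d \<le> L\<close> by simp
        moreover from this have "finite (S (Suc (L - d + i)))" by (meson finite_arrived finite_subset le_infE)
        ultimately show ?case using Suc by auto
      qed (use fin[OF Y(2)] in auto)
      from this[of d] show ?thesis using Suc.prems by simp
    qed
    have "(\<Sum>t=?t..<L. card (cut (Suc t) (S t) (S (Suc t)))) = card (cut (L - d) X ?Y) +
         (\<Sum>t=L-d..<L. card (cut (Suc t) (S t) (S (Suc t))))"
      using S(1) t(1) by (simp add: sum.atLeast_Suc_lessThan[OF t(2)])
    moreover have "card (S L - X) = card (S L - ?Y) + card (?Y - X)"
    proof -
      have "S L - X = (S L - ?Y) \<union> (?Y - X)" using Y YL by auto
      moreover have "card ((S L - ?Y) \<union> (?Y - X)) = card (S L - ?Y) + card (?Y - X)"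
        by (rule card_Un_disjoint) (use fin[OF Y(2)] YL in auto)
      ultimately show ?thesis by (rule trans[OF arg_cong[of _ _ card]])
    qed
    moreover have "spread d Z ?Y (card (S L - ?Y)) (\<Sum>t=L-d..<L. card (cut (Suc t) (S t) (S (Suc t))))"
    proof -
      have "S t \<subseteq> S (Suc t) \<and> S (Suc t) \<subseteq> Z \<inter> arrived (Suc t)" if "L - d \<le> t" "t < L" for t
        by (rule S(2)) (use that in auto)
      then show ?thesis unfolding Suc.IH[OF Suc_leD[OF Suc.prems]] by (intro exI[of _ S] conjI) auto
    qed
    ultimately show "spread (Suc d) Z X c q" unfolding spread.simps using Y S(3,4)
      by (intro exI[of _ ?Y] exI[of _ "card (S L - ?Y)"] exI[of _ "\<Sum>t=L-d..<L. card (cut (Suc t) (S t) (S (Suc t)))"]) auto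
  qed
qed

end

section \<open>Deletion sets and growing reached sets\<close>

locale listed_graph = edge_list n src es
  for n src es +
  fixes G :: "nat temporal_graph"
  assumes verts: "tverts G = {..<n}" and listed: "lists_time_edges es G"
begin

definition te where "te e = ({ta e, he e}, ti e)"

lemma time_edges_eq: "time_edges G = te ` {..<m}" and te_inj: "inj_on te {..<m}"
proof -
  have "map (\<lambda>(u, v, t). ({u, v}, t)) es = map te [0..<m]"
    by (rule nth_equalityI) (auto simp: te_def m_def ta_def he_def ti_def split: prod.splits)
  then have 1: "distinct (map te [0..<m])" "set (map te [0..<m]) = time_edges G"
    using listed by (auto simp: lists_time_edges_def Let_def)
  show "time_edges G = te ` {..<m}" using 1(2) by (auto simp: atLeast0LessThan)
  show "inj_on te {..<m}" using 1(1) by (simp add: distinct_map atLeast0LessThan)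
qed

definition after where "after D t = reached_by (delete_time_edges G D) src t"

lemma after_Suc: "after D (Suc t) = after D t \<union> {w. \<exists>v\<in>after D t. ({v, w}, Suc t) \<in> time_edges G - D}"
  by (simp add: after_def time_edges_delete)

lemma reachable_after: "{v \<in> tverts G. temporally_reachable (delete_time_edges G D) src v} = after D L"
proof -
  have "temporally_reachable (delete_time_edges G D) src v \<longleftrightarrow> v \<in> after D L" for v
    unfolding after_def
    by (rule temporally_reachable_iff_reached_by) (auto simp: time_edges_delete time_edges_eq te_def edge_props)
  moreover have "after D t \<subseteq> {..<n}" for t
  proof (induction t)
    case 0
    then show ?case using src by (simp add: after_def)
  next
    case (Suc t)
    have "w < n" if "({v, w}, Suc t) \<in> time_edges G" for v w
      using that edge_props(1,2) by (auto simp: time_edges_eq te_def doubleton_eq_iff)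
    then show ?case using Suc by (auto simp: after_Suc)
  qed
  ultimately show ?thesis using verts by blast
qed

lemma after_arrived: "after D t \<subseteq> arrived t"
proof (induction t)
  case 0
  then show ?case using src arr_eq_0 by (simp add: after_def arrived_def)
next
  case (Suc t)
  have "w \<in> arrived (Suc t)" if vw: "v \<in> after D t" "({v, w}, Suc t) \<in> time_edges G" for v w
  proof -
    obtain e where e: "e < m" "{ta e, he e} = {v, w}" "ti e = Suc t"
      using vw(2) by (auto simp: time_edges_eq te_def)
    have "arr v < Suc t" using vw(1) Suc by (auto simp: arrived_def)
    then show ?thesis using e arr_edge[OF e(1)] edge_props(1,2)[OF e(1)]
      by (auto simp: doubleton_eq_iff arrived_def)
  qed
  moreover have "arrived t \<subseteq> arrived (Suc t)" by (auto simp: arrived_def)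
  ultimately show ?case using Suc by (auto simp: after_Suc)
qed

text \<open>Cuts at different times are disjoint, and distinct list positions are distinct
  time-edges.\<close>

lemma card_cuts:
  assumes "\<And>t. t < L \<Longrightarrow> S t \<subseteq> S (Suc t)"
  shows "(\<Sum>t=0..<L. card (cut (Suc t) (S t) (S (Suc t)))) = card (te ` (\<Union>t<L. cut (Suc t) (S t) (S (Suc t))))"
proof -
  have "card (te ` (\<Union>t<L. cut (Suc t) (S t) (S (Suc t)))) = card (\<Union>t<L. cut (Suc t) (S t) (S (Suc t)))"
    by (rule card_image, rule inj_on_subset[OF te_inj]) (auto simp: cut_def)
  also have "\<dots> = (\<Sum>t<L. card (cut (Suc t) (S t) (S (Suc t))))"
    by (rule card_UN_disjoint) (auto simp: cut_def)
  finally show ?thesis by (simp add: atLeast0LessThan)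
qed

text \<open>Given \<open>D\<close>, the sets \<open>after D t\<close> form a chain whose cut edges
  all lie in \<open>D\<close>. Given a chain, deleting exactly its cut edges keeps the reached sets
  inside it. The budget is \<open>r - 1\<close> because the source is in the chain from the
  start.\<close>

lemma temporal_reachability_edge_deletion_iff_spread:
  assumes "0 < r"
  shows "temporal_reachability_edge_deletion G src r h \<longleftrightarrow> spread L {..<n} {src} (r - 1) h"
proof -
  let ?cuts = "\<lambda>S. te ` (\<Union>t<L. cut (Suc t) (S t) (S (Suc t)))"
  have "temporal_reachability_edge_deletion G src r h \<longleftrightarrow> (\<exists>D \<subseteq> time_edges G. card D \<le> h \<and> card (after D L) \<le> r)"
    by (simp add: temporal_reachability_edge_deletion_def reachable_after)
  also have "\<dots> \<longleftrightarrow> (\<exists>S. S 0 = {src} \<and>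
    (\<forall>t. 0 \<le> t \<longrightarrow> t < L \<longrightarrow> S t \<subseteq> S (Suc t) \<and> S (Suc t) \<subseteq> {..<n} \<inter> arrived (Suc t)) \<and>
    (\<Sum>t=0..<L. card (cut (Suc t) (S t) (S (Suc t)))) \<le> h \<and> card (S L - {src}) \<le> r - 1)" (is "?l = ?r")
  proof
    assume ?l
    then obtain D where D: "D \<subseteq> time_edges G" "card D \<le> h" "card (after D L) \<le> r" by blast
    have mono: "after D t \<subseteq> after D (Suc t)" for t by (auto simp: after_Suc)
    have "?cuts (after D) \<subseteq> D"
    proof -
      have "te e \<in> D" if "e \<in> cut (Suc t) (after D t) (after D (Suc t))" for e t
      proof (rule ccontr)
        assume "te e \<notin> D"
        then have "({ta e, he e}, Suc t) \<in> time_edges G - D" "({he e, ta e}, Suc t) \<in> time_edges G - D"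
          using that by (auto simp: cut_def time_edges_eq te_def insert_commute)
        then have "ta e \<in> after D t \<Longrightarrow> he e \<in> after D (Suc t)" "he e \<in> after D t \<Longrightarrow> ta e \<in> after D (Suc t)"
          unfolding after_Suc by blast+
        then show False using that by (auto simp: cut_def)
      qed
      then show ?thesis by blast
    qed
    moreover have "finite D" by (rule finite_subset[OF D(1)]) (simp add: time_edges_eq)
    ultimately have "card (?cuts (after D)) \<le> h" using D(2) card_mono[of D "?cuts (after D)"] by linarith
    then have "(\<Sum>t=0..<L. card (cut (Suc t) (after D t) (after D (Suc t)))) \<le> h"
      using card_cuts[of "after D"] mono by simp
    moreover have "card (after D L - {src}) \<le> r - 1"
    proof -
      have "finite (after D L)" using after_arrived[of D L] finite_subset finite_arrived by blast
      moreover have "src \<in> after D L" using reached_by_mono[of 0 L "delete_time_edges G D" src] by (simp add: after_def)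
      ultimately show ?thesis using D(3) by simp
    qed
    moreover have "after D t \<subseteq> {..<n}" for t using after_arrived[of D t] by (auto simp: arrived_def)
    moreover have "after D 0 = {src}" by (simp add: after_def)
    ultimately show ?r using mono after_arrived by (intro exI[of _ "after D"] conjI allI impI le_infI)
  next
    assume ?r
    then obtain S where S: "S 0 = {src}"
      "\<And>t. t < L \<Longrightarrow> S t \<subseteq> S (Suc t) \<and> S (Suc t) \<subseteq> {..<n} \<inter> arrived (Suc t)"
      "(\<Sum>t=0..<L. card (cut (Suc t) (S t) (S (Suc t)))) \<le> h" "card (S L - {src}) \<le> r - 1" by auto
    let ?D = "?cuts S"
    have sub: "t \<le> L \<Longrightarrow> after ?D t \<subseteq> S t" for t
    proof (induction t)
      case (Suc t)
      have "w \<in> S (Suc t)" if vw: "v \<in> after ?D t" "({v, w}, Suc t) \<in> time_edges G - ?D" for v w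
      proof (rule ccontr)
        assume w: "w \<notin> S (Suc t)"
        obtain e where e: "e < m" "te e = ({v, w}, Suc t)" using vw(2) by (auto simp: time_edges_eq)
        have "v \<in> S t" using vw(1) Suc by auto
        then have "e \<in> cut (Suc t) (S t) (S (Suc t))" using e w by (auto simp: cut_def te_def doubleton_eq_iff)
        then have "e \<in> (\<Union>t<L. cut (Suc t) (S t) (S (Suc t)))" using Suc.prems by (intro UN_I[of t]) auto
        then have "te e \<in> ?D" by (rule imageI)
        then show False using vw(2) e(2) by simp
      qed
      then show ?case using Suc S(2)[of t] unfolding after_Suc by auto
    qed (simp add: after_def S(1))
    have finS: "finite (S L) \<and> src \<in> S L"
    proof -
      have "t \<le> L \<Longrightarrow> finite (S t) \<and> src \<in> S t" for t
      proof (induction t)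
        case (Suc t)
        then show ?case using S(2)[of t] by (meson Suc_le_lessD finite_arrived finite_subset le_infE less_imp_le subsetD)
      qed (simp add: S(1))
      then show ?thesis by blast
    qed
    then have "card (S L) \<le> r" using S(4) assms by (simp add: card_Diff_singleton)
    then have "card (after ?D L) \<le> r" using sub[of L] finS card_mono[of "S L" "after ?D L"] by simp
    moreover have "card ?D \<le> h" using card_cuts[of S] S(2,3) by simp
    moreover have "?D \<subseteq> time_edges G" by (auto simp: cut_def time_edges_eq)
    ultimately show ?l by blast
  qed
  also have "\<dots> \<longleftrightarrow> spread L {..<n} {src} (r - 1) h"
    using spread_chain[of L "{..<n}" "{src}" "r - 1" h] by simp
  finally show ?thesis .
qed

end

section \<open>Classes fit into bags\<close>

text \<open>\<open>directed_tree\<close> describes cycles by indices modulo the length; as a list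
  with a closing step they are easier to assemble.\<close>

lemma closed_walk_nth:
  assumes "successively (\<lambda>x y. (x, y) \<in> R) c" "(last c, hd c) \<in> R" "k < length c"
  shows "(c ! k, c ! (Suc k mod length c)) \<in> R"
proof (cases "Suc k = length c")
  case True
  then have "c \<noteq> []" "k = length c - 1" by auto
  then show ?thesis using assms(2) True by (simp add: last_conv_nth hd_conv_nth)
next
  case False
  then have "Suc k < length c" using assms(3) by simp
  then show ?thesis using assms(1) by (simp add: successively_conv_nth)
qed

text \<open>From the last common node of the two paths on, they and \<open>k\<close> would form a cycle.\<close>

lemma directed_tree_unique_path:
  fixes p q :: "nat \<Rightarrow> 'n" and \<tau> :: "'n \<Rightarrow> nat"
  assumes tree: "directed_tree N A" and lev: "\<And>i j. (i, j) \<in> A \<Longrightarrow> \<tau> j = Suc (\<tau> i)"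
    and pq: "p 1 = q 1" "\<tau> (p 1) = 1" and t: "1 \<le> t"
    and p: "\<And>l. 1 \<le> l \<Longrightarrow> l < t \<Longrightarrow> (p l, p (Suc l)) \<in> A"
    and q: "\<And>l. 1 \<le> l \<Longrightarrow> l < t \<Longrightarrow> (q l, q (Suc l)) \<in> A"
    and k: "(p t, k) \<in> A" "(q t, k) \<in> A"
  shows "p t = q t"
proof (rule ccontr)
  assume ne: "p t \<noteq> q t"
  define s where "s = Max {l. 1 \<le> l \<and> l \<le> t \<and> p l = q l}"
  have fin: "finite {l. 1 \<le> l \<and> l \<le> t \<and> p l = q l}" by (rule finite_subset[of _ "{..t}"]) auto
  have "s \<in> {l. 1 \<le> l \<and> l \<le> t \<and> p l = q l}"
    unfolding s_def by (rule Max_in[OF fin]) (use pq(1) t in auto)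
  then have s: "1 \<le> s" "s < t" "p s = q s" using ne by (auto simp: le_less)
  have ps: "p l \<noteq> q l" if "s < l" "l \<le> t" for l
    using Max_ge[OF fin, of l] that s(1) unfolding s_def[symmetric] by auto
  have "l \<le> t \<Longrightarrow> \<tau> (p l) = l \<and> \<tau> (q l) = l" if "1 \<le> l" for l
    using that
  proof (induction l rule: dec_induct)
    case (step l)
    then show ?case using lev[OF p[of l]] lev[OF q[of l]] by auto
  qed (use pq in auto)
  then have \<tau>p: "\<tau> (p l) = l" and \<tau>q: "\<tau> (q l) = l" if "1 \<le> l" "l \<le> t" for l using that by auto
  have \<tau>k: "\<tau> k = Suc t" using lev[OF k(1)] \<tau>p[of t] t by simp
  let ?R = "A \<union> A\<inverse>"
  \<comment> \<open>The list goes along \<open>p\<close> to \<open>p t\<close>, over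
    \<open>k\<close>, and back along \<open>q\<close> to \<open>q (Suc s)\<close>. As
    \<open>\<tau>\<close> gives the position on either path, nodes of one path are distinct, and the
    two paths could only meet at equal positions, which is excluded after \<open>s\<close>.\<close>
  define c where "c = map p [s..<Suc t] @ k # map q (rev [Suc s..<Suc t])"
  have "inj_on p {s..<Suc t}"
    by (rule inj_on_inverseI[of _ \<tau>]) (use \<tau>p s in auto)
  moreover have "inj_on q {Suc s..<Suc t}"
    by (rule inj_on_inverseI[of _ \<tau>]) (use \<tau>q s in auto)
  moreover have "k \<noteq> p l" if "l \<in> {s..<Suc t}" for l
  proof
    assume "k = p l"
    then have "\<tau> k = l" using \<tau>p[of l] s that by simp
    then show False using \<tau>k that by simp
  qed
  moreover have "k \<noteq> q l" if "l \<in> {Suc s..<Suc t}" for l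
  proof
    assume "k = q l"
    then have "\<tau> k = l" using \<tau>q[of l] s that by simp
    then show False using \<tau>k that by simp
  qed
  moreover have "p l \<noteq> q l'" if "l \<in> {s..<Suc t}" "l' \<in> {Suc s..<Suc t}" for l l'
  proof
    assume eq: "p l = q l'"
    then have "\<tau> (p l) = \<tau> (q l')" by simp
    then have "l = l'" using \<tau>p[of l] \<tau>q[of l'] that s by simp
    then show False using ps[of l] eq that by simp
  qed
  ultimately have "distinct c"
    unfolding c_def by (simp only: distinct_append distinct_map distinct.simps distinct_rev set_map set_rev set_upt set_simps distinct_upt) blast
  moreover have "3 \<le> length c" using s by (simp add: c_def)
  moreover have "(c ! j, c ! (Suc j mod length c)) \<in> ?R" if "j < length c" for j
  proof (rule closed_walk_nth[OF _ _ that])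
    have 1: "successively (\<lambda>x y. (x, y) \<in> ?R) (map p [s..<Suc t])"
      unfolding successively_conv_nth
    proof (intro allI impI)
      fix i assume "Suc i < length (map p [s..<Suc t])"
      then show "(map p [s..<Suc t] ! i, map p [s..<Suc t] ! Suc i) \<in> ?R"
        using p[of "s + i"] s by (simp del: upt_Suc)
    qed
    have 2: "successively (\<lambda>x y. (x, y) \<in> ?R) (map q (rev [Suc s..<Suc t]))"
      unfolding successively_conv_nth
    proof (intro allI impI)
      fix i assume i: "Suc i < length (map q (rev [Suc s..<Suc t]))"
      then have "map q (rev [Suc s..<Suc t]) ! i = q (Suc (t - Suc i))" "map q (rev [Suc s..<Suc t]) ! Suc i = q (t - Suc i)"
        by (simp_all add: rev_nth nth_append del: upt_Suc) (simp_all add: Suc_diff_Suc)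
      moreover have "1 \<le> t - Suc i" "t - Suc i < t" using i s by auto
      ultimately show "(map q (rev [Suc s..<Suc t]) ! i, map q (rev [Suc s..<Suc t]) ! Suc i) \<in> ?R"
        using q[of "t - Suc i"] by simp
    qed
    have 3: "last (map p [s..<Suc t]) = p t" "hd (map q (rev [Suc s..<Suc t])) = q t" "map q (rev [Suc s..<Suc t]) \<noteq> []"
      using s by (simp_all add: last_map hd_map hd_rev)
    show "successively (\<lambda>x y. (x, y) \<in> ?R) c"
      unfolding c_def successively_append_iff successively_Cons using 1 2 3 k by auto
    have "last c = q (Suc s)" using s by (simp add: c_def last_map last_rev hd_upt del: upt_Suc)
    moreover have "hd c = p s" using s by (simp add: c_def upt_rec del: upt_Suc)
    ultimately show "(last c, hd c) \<in> ?R" using q[of s] s by simp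
  qed
  ultimately show False using tree unfolding directed_tree_def by blast
qed

section \<open>Reached vertices and the bags of a decomposition\<close>

context listed_graph
begin

lemma L_eq_lifetime:
  assumes "time_edges G \<noteq> {}"
  shows "L = lifetime G"
proof -
  have "(\<Union>e\<in>tedges G. tlabels G e) = snd ` time_edges G" by (force simp: time_edges_def)
  also have "\<dots> = ti ` {..<m}" by (simp add: time_edges_eq image_image te_def)
  finally have "lifetime G = Max (ti ` {..<m})" by (simp add: lifetime_def)
  moreover have "ti ` {..<m} \<noteq> {}" using assms by (simp add: time_edges_eq)
  ultimately show ?thesis unfolding L_def by (simp add: Max_insert)
qed

text \<open>\<open>lab_finest\<close> applies to the map from vertices to their bags: the ends of an
  edge share a bag, and two reached vertices that share a bag at \<open>Suc t\<close> already do so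
  at \<open>t\<close>, by \<open>directed_tree_unique_path\<close>. So the reached part of a class
  fits into a bag.\<close>

lemma bits_le_width:
  assumes ne: "time_edges G \<noteq> {}" and tim: "tim_decomposition G (N :: 'n set) A B \<tau>"
  shows "bits \<le> decomposition_width N B"
proof -
  have tree: "directed_tree N A"
    and verts_bags: "\<And>i. i \<in> N \<Longrightarrow> B i \<subseteq> {..<n}"
    and ex1: "\<And>v t. v < n \<Longrightarrow> 1 \<le> t \<Longrightarrow> t \<le> L \<Longrightarrow> \<exists>!i. i \<in> N \<and> v \<in> B i \<and> \<tau> i = t"
    and edge_bag: "\<And>e t. (e, t) \<in> time_edges G \<Longrightarrow> \<exists>!i. i \<in> N \<and> e \<subseteq> B i \<and> \<tau> i = t"
    and A: "A = {(i, j). i \<in> N \<and> j \<in> N \<and> B i \<inter> B j \<noteq> {} \<and> \<tau> j = \<tau> i + 1}"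
    using tim verts L_eq_lifetime[OF ne] by (auto simp: tim_decomposition_def)
  define bag where "bag t v = (THE i. i \<in> N \<and> v \<in> B i \<and> \<tau> i = t)" for t v
  have bag: "bag t v \<in> N" "v \<in> B (bag t v)" "\<tau> (bag t v) = t" if "v < n" "1 \<le> t" "t \<le> L" for v t
    using theI'[OF ex1[OF that]] unfolding bag_def by auto
  have bag_eq: "bag t v = i" if "v < n" "1 \<le> t" "t \<le> L" "i \<in> N" "v \<in> B i" "\<tau> i = t" for v t i
    unfolding bag_def by (rule the1_equality[OF ex1[OF that(1-3)]]) (use that in auto)
  have arc: "(bag t v, bag (Suc t) v) \<in> A" if "v < n" "1 \<le> t" "t < L" for v t
    using bag[of v t] bag[of v "Suc t"] that unfolding A by auto
  have bag_edge: "bag (ti e) (ta e) = bag (ti e) (he e)" if e: "e < m" for e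
  proof -
    have "({ta e, he e}, ti e) \<in> time_edges G" using e by (auto simp: time_edges_eq te_def)
    from edge_bag[OF this] obtain i where "i \<in> N" "{ta e, he e} \<subseteq> B i" "\<tau> i = ti e" by blast
    then show ?thesis
      using bag_eq[of "ta e" "ti e" i] bag_eq[of "he e" "ti e" i] edge_props[OF e] by simp
  qed
  have pred: "\<exists>w. w < n \<and> arr w < arr v \<and> bag (arr v) v = bag (arr v) w" if h: "0 < arr v" "arr v \<le> L" for v
  proof -
    obtain e where e: "e < m" "ti e = arr v" "he e = v \<and> arr (ta e) < arr v \<or> ta e = v \<and> arr (he e) < arr v"
      using arr_pred[OF h] by blast
    then show ?thesis using bag_edge[OF e(1)] edge_props(1,2)[OF e(1)] by metis
  qed
  have path: "\<exists>p. p 1 = bag 1 src \<and> p t = bag t v \<and> (\<forall>l. 1 \<le> l \<longrightarrow> l < t \<longrightarrow> (p l, p (Suc l)) \<in> A)"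
    if "1 \<le> t" "t \<le> L" "v < n" "arr v \<le> t" for t v
    using that
  proof (induction t arbitrary: v rule: dec_induct)
    case base
    have "bag 1 v = bag 1 src"
    proof (cases "arr v = 0")
      case False
      then have "arr v = 1" using base by simp
      then show ?thesis using pred[of v] base arr_eq_0 by auto
    qed (simp add: arr_eq_0)
    then show ?case by (intro exI[of _ "\<lambda>_. bag 1 src"]) simp
  next
    case (step t)
    \<comment> \<open>In the last step the path may change vertices: a \<open>v\<close> reached
      exactly at \<open>Suc t\<close> shares its bag with a vertex reached earlier, whose path is
      extended instead.\<close>
    have "\<exists>w<n. arr w \<le> t \<and> bag (Suc t) v = bag (Suc t) w"
    proof (cases "arr v \<le> t")
      case False
      then have "arr v = Suc t" using step.prems by simp
      then show ?thesis using pred[of v] step.prems by auto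
    qed (use step.prems in blast)
    then obtain w where w: "w < n" "arr w \<le> t" "bag (Suc t) v = bag (Suc t) w" by blast
    have tL: "t \<le> L" "t < L" using step.prems by auto
    from step.IH[OF tL(1) w(1,2)] obtain p where p: "p 1 = bag 1 src" "p t = bag t w"
      "\<forall>l. 1 \<le> l \<longrightarrow> l < t \<longrightarrow> (p l, p (Suc l)) \<in> A" by blast
    let ?p = "p(Suc t := bag (Suc t) v)"
    have "(?p l, ?p (Suc l)) \<in> A" if "1 \<le> l" "l < Suc t" for l
      using arc[of w t] p that w tL step.hyps by (cases "l = t") auto
    then show ?case using p step.hyps by (intro exI[of _ ?p]) auto
  qed
  have B: "bag t u = bag t v" if h: "1 \<le> t" "t < L" "u < n" "v < n" "arr u \<le> t" "arr v \<le> t"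
    "bag (Suc t) u = bag (Suc t) v" for t u v
  proof -
    obtain p where p: "p 1 = bag 1 src" "p t = bag t u" "\<And>l. 1 \<le> l \<Longrightarrow> l < t \<Longrightarrow> (p l, p (Suc l)) \<in> A"
      using path[of t u] h by auto
    obtain q where q: "q 1 = bag 1 src" "q t = bag t v" "\<And>l. 1 \<le> l \<Longrightarrow> l < t \<Longrightarrow> (q l, q (Suc l)) \<in> A"
      using path[of t v] h by auto
    have "p t = q t"
    proof (rule directed_tree_unique_path[OF tree, of \<tau> p q t "bag (Suc t) u"])
      show "\<tau> j = Suc (\<tau> i)" if "(i, j) \<in> A" for i j using that by (simp add: A)
      show "\<tau> (p 1) = 1" using p(1) bag[of src 1] src h by simp
      show "(p t, bag (Suc t) u) \<in> A" using p(2) arc[of u t] h by simp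
      show "(q t, bag (Suc t) u) \<in> A" using q(2) arc[of v t] h by simp
    qed (use p q h in auto)
    then show ?thesis using p q by simp
  qed
  have width: "card (B i) \<le> decomposition_width N B" if "i \<in> N" for i
    unfolding decomposition_width_def using tree that by (intro Max_ge) (auto simp: directed_tree_def)
  have finB: "finite (B i)" if "i \<in> N" for i using verts_bags[OF that] finite_subset by blast
  have L1: "1 \<le> L"
  proof -
    obtain e where "e < m" using ne by (auto simp: time_edges_eq)
    then show ?thesis using edge_props(4,5)[of e] by simp
  qed
  show ?thesis
  proof (rule bits_leI)
    fix t v assume h: "t \<le> L" "v < n" "arr v \<le> t"
    let ?C = "{w. w < n \<and> arr w \<le> t \<and> lab t w = lab t v}"
    have "card ?C \<le> decomposition_width N B"
    \<comment> \<open>Bags exist only for positive times. At time 0 the source alone has been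
      reached, and any nonempty bag is large enough.\<close>
    proof (cases "t = 0")
      case True
      then have v: "v = src" using h(3) by (simp add: arr_eq_0)
      have "?C \<subseteq> {src}" using True by (auto simp: arr_eq_0)
      then have "card ?C \<le> 1" using card_mono[of "{src}" ?C] by simp
      moreover have "bag 1 src \<in> N" "src \<in> B (bag 1 src)" using bag[OF src] L1 by auto
      then have "0 < card (B (bag 1 src))" using finB[of "bag 1 src"] by (metis card_gt_0_iff empty_iff)
      ultimately show ?thesis using width[OF \<open>bag 1 src \<in> N\<close>] by linarith
    next
      case False
      have "?C \<subseteq> B (bag t v)"
      proof
        fix w assume w: "w \<in> ?C"
        have "bag t w = bag t v"
          by (rule lab_finest[of bag, OF bag_edge B]) (use h w False in simp_all)
        then show "w \<in> B (bag t v)" using bag[of w t] w h False by simp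
      qed
      then have "card ?C \<le> card (B (bag t v))" using bag[of v t] h False finB by (intro card_mono) auto
      then show ?thesis using width[of "bag t v"] bag[of v t] h False by simp
    qed
    then show "rank t v < decomposition_width N B" using rank_le[OF h(2,3)] by simp
  qed
qed

text \<open>A minimum defined by \<open>LEAST\<close> is attained only if something satisfies the
  condition; the trivial decomposition provides that.\<close>

lemma bits_le_tim_width:
  assumes ne: "time_edges G \<noteq> {}" and G: "is_temporal_graph G"
  shows "bits \<le> tim_width G"
proof -
  let ?P = "\<lambda>w. \<exists>(N :: nat set) A B \<tau>. tim_decomposition G N A B \<tau> \<and> decomposition_width N B = w"
  have "tverts G \<noteq> {}" using src verts by auto
  from trivial_tim_decomposition[OF G this ne] have "\<exists>w. ?P w" by blast
  then have "?P (tim_width G)" unfolding tim_width_def by (rule LeastI_ex)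
  then obtain N :: "nat set" and A B \<tau> where "tim_decomposition G N A B \<tau>" "decomposition_width N B = tim_width G"
    by blast
  then show ?thesis using bits_le_width[OF ne, of N A B \<tau>] by simp
qed

end

section \<open>The program: arrival times, classes and ranks\<close>

definition V :: "string \<Rightarrow> ram_exp" where "V x = Load x (Const 0)"
text \<open>Truncated subtraction from 1 is negation, and it also turns every test into 0 or 1. The
  other connectives are built from it.\<close>

definition Eq where "Eq a b = Sub (Const 1) (Add (Sub a b) (Sub b a))"
definition Lt where "Lt a b = Sub (Const 1) (Sub (Const 1) (Sub b a))"
definition And where "And a b = Sub (Const 1) (Add (Sub (Const 1) a) (Sub (Const 1) b))"
definition Or where "Or a b = Sub (Const 1) (Sub (Const 1) (Add a b))"
definition Neg where "Neg a = Sub (Const 1) a"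
definition Set :: "string \<Rightarrow> ram_exp \<Rightarrow> lp" where "Set x e = Put x (Const 0) e"
definition When where "When e p = Cond e p Nop"

lemma ram_val_macros [simp]:
  "ram_val (V x) s = s x 0"
  "ram_val (Eq a b) s = of_bool (ram_val a s = ram_val b s)"
  "ram_val (Lt a b) s = of_bool (ram_val a s < ram_val b s)"
  "ram_val (And a b) s = of_bool (ram_val a s \<noteq> 0 \<and> ram_val b s \<noteq> 0)"
  "ram_val (Or a b) s = of_bool (ram_val a s \<noteq> 0 \<or> ram_val b s \<noteq> 0)"
  "ram_val (Neg a) s = of_bool (ram_val a s = 0)"
  by (auto simp: V_def Eq_def Lt_def And_def Or_def Neg_def of_bool_def)

lemma lp_macros [simp]:
  "run (Set x e) s = upd x 0 (ram_val e s) s" "writes (Set x e) = {x}" "bounds (Set x e) = {}" "well_formed (Set x e)"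
  "run (When e p) s = (if ram_val e s \<noteq> 0 then run p s else s)" "writes (When e p) = writes p"
  "bounds (When e p) = bounds p" "well_formed (When e p) = well_formed p"
  by (simp_all add: Set_def When_def)

lemma card_less_Suc_if: "card {w. w < Suc i \<and> P w} = card {w. w < i \<and> P w} + (if P i then 1 else 0)"
proof -
  have "{w. w < Suc i \<and> P w} = (if P i then insert i {w. w < i \<and> P w} else {w. w < i \<and> P w})"
    by (auto simp: less_Suc_eq)
  then show ?thesis by simp
qed

definition p_lifetime where
  "p_lifetime = For ''e'' ''m'' (When (Lt (V ''L'') (Load ''time'' (V ''e''))) (Set ''L'' (Load ''time'' (V ''e''))))
    ;; Set ''L1'' (Add (V ''L'') (Const 1))"

text \<open>The loop variable \<open>t\<close> starts at 0 while times start at 1, so the round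
  treats time \<open>t + 1\<close>.\<close>

definition p_relax where
  "p_relax a b = When (And (Lt (Load ''arr'' (Load a (V ''e''))) (Add (V ''t'') (Const 1)))
       (Lt (Add (V ''t'') (Const 1)) (Load ''arr'' (Load b (V ''e'')))))
     (Put ''arr'' (Load b (V ''e'')) (Add (V ''t'') (Const 1)))"
definition p_relax_edge where
  "p_relax_edge = When (Eq (Load ''time'' (V ''e'')) (Add (V ''t'') (Const 1)))
     (p_relax ''tail'' ''head'' ;; p_relax ''head'' ''tail'')"
definition p_relax_all where "p_relax_all = For ''e'' ''m'' p_relax_edge"
definition p_arr where
  "p_arr = For ''v'' ''n'' (Put ''arr'' (V ''v'') (V ''L1''));;
    Put ''arr'' (V ''source'') (Const 0);;
    For ''t'' ''L'' p_relax_all"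

text \<open>Multiplication by repeated addition. All multiples are stored, so later programs look
  products up.\<close>

definition p_multiples where
  "p_multiples a y e = For ''i'' y (Put a (Add (V ''i'') (Const 1)) (Add (Load a (V ''i'')) e))"

text \<open>Both labels are saved before the loop, because the loop overwrites the entry of the head
  from which \<open>q\<close> was read.\<close>

definition p_merge where
  "p_merge = Set ''p'' (Load ''cl'' (Load ''tail'' (V ''e''))) ;; Set ''q'' (Load ''cl'' (Load ''head'' (V ''e''))) ;;
     For ''w'' ''n'' (When (Eq (Load ''cl'' (V ''w'')) (V ''q'')) (Put ''cl'' (V ''w'') (V ''p'')))"
definition p_merge_all where
  "p_merge_all = For ''e'' ''m'' (When (And (Eq (Load ''time'' (V ''e'')) (V ''t''))
     (Or (Lt (Load ''arr'' (Load ''tail'' (V ''e''))) (V ''t'')) (Lt (Load ''arr'' (Load ''head'' (V ''e''))) (V ''t''))))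
     p_merge)"
definition p_level where
  "p_level = Set ''t'' (Sub (V ''L'') (V ''d'')) ;; p_merge_all ;;
     For ''v'' ''n'' (Put ''lab'' (Add (Load ''tn'' (V ''t'')) (V ''v'')) (Load ''cl'' (V ''v'')))"
text \<open>Rows are written for the times \<open>L\<close> down to 1. Row 0 keeps its initial
  zeros, which is \<open>lab 0\<close>.\<close>

definition p_lab where
  "p_lab = For ''v'' ''n'' (Put ''cl'' (V ''v'') (V ''v'')) ;; For ''d'' ''L'' p_level"

definition lab_at where "lab_at t v = Load ''lab'' (Add (Load ''tn'' t) v)"
definition rank_at where "rank_at t v = Load ''rank'' (Add (Load ''tn'' t) v)"

definition p_count where
  "p_count = Set ''q'' (Const 0) ;; For ''w'' ''n'' (When (And (Lt (V ''w'') (V ''v''))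
     (And (Neg (Lt (V ''t'') (Load ''arr'' (V ''w'')))) (Eq (lab_at (V ''t'') (V ''w'')) (lab_at (V ''t'') (V ''v'')))))
     (Set ''q'' (Add (V ''q'') (Const 1))))"
text \<open>The scalar \<open>k\<close> keeps the largest successor of a rank seen so far and ends
  up as \<open>bits\<close>.\<close>

definition p_rank_vertex where
  "p_rank_vertex = Cond (Lt (V ''t'') (Load ''arr'' (V ''v'')))
     (Put ''rank'' (Add (Load ''tn'' (V ''t'')) (V ''v'')) (V ''n''))
     (p_count ;; Put ''rank'' (Add (Load ''tn'' (V ''t'')) (V ''v'')) (V ''q'') ;;
      When (Neg (Lt (V ''q'') (V ''k''))) (Set ''k'' (Add (V ''q'') (Const 1))))"
definition p_rank_level where "p_rank_level = For ''v'' ''n'' p_rank_vertex"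
definition p_rank where "p_rank = For ''t'' ''L1'' p_rank_level"

lemma writes_graph_programs [simp]:
  "writes p_lifetime = {''e'', ''L'', ''L1''}" "writes (p_relax a b) = {''arr''}"
  "writes p_relax_edge = {''arr''}" "writes p_relax_all = {''e'', ''arr''}" "writes p_arr = {''v'', ''t'', ''e'', ''arr''}"
  "writes (p_multiples a y e) = {''i'', a}"
  "writes p_merge = {''p'', ''q'', ''w'', ''cl''}" "writes p_merge_all = {''e'', ''p'', ''q'', ''w'', ''cl''}"
  "writes p_level = {''t'', ''v'', ''lab'', ''e'', ''p'', ''q'', ''w'', ''cl''}"
  "writes p_lab = {''d'', ''t'', ''v'', ''lab'', ''e'', ''p'', ''q'', ''w'', ''cl''}"
  "writes p_count = {''q'', ''w''}" "writes p_rank_vertex = {''rank'', ''k'', ''q'', ''w''}"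
  "writes p_rank_level = {''v'', ''rank'', ''k'', ''q'', ''w''}" "writes p_rank = {''t'', ''v'', ''rank'', ''k'', ''q'', ''w''}"
  by (auto simp: p_lifetime_def p_relax_def p_relax_edge_def p_relax_all_def p_arr_def p_multiples_def p_merge_def
      p_merge_all_def p_level_def p_lab_def p_count_def p_rank_vertex_def p_rank_level_def p_rank_def)

section \<open>Correctness of the preparatory programs\<close>

lemma run_multiples:
  assumes "a \<noteq> y" "''i'' \<noteq> a" "y \<noteq> ''i''" "s a 0 = 0"
    and e: "\<And>s'. (\<And>b. b \<noteq> ''i'' \<Longrightarrow> b \<noteq> a \<Longrightarrow> s' b = s b) \<Longrightarrow> ram_val e s' = k"
    and "i \<le> s y 0"
  shows "run (p_multiples a y e) s a i = i * k"
proof -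
  have "\<forall>j\<le>s y 0. run (p_multiples a y e) s a j = j * k"
    unfolding p_multiples_def
  proof (rule run_For_induct[where I = "\<lambda>i s. \<forall>j\<le>i. s a j = j * k"], goal_cases)
    case (5 i s')
    then have "ram_val e s' = k" using e[of s'] by simp
    then show ?case using 5 assms by (auto simp: le_Suc_eq)
  qed (use assms in auto)
  then show ?thesis using assms by simp
qed

context edge_list
begin

declare lev.simps(2) [simp del]

definition graph_in :: "ram_state \<Rightarrow> bool" where
  "graph_in s \<longleftrightarrow> s ''n'' 0 = n \<and> s ''m'' 0 = m \<and> s ''source'' 0 = src \<and>
     (\<forall>e<m. s ''tail'' e = ta e \<and> s ''head'' e = he e \<and> s ''time'' e = ti e)"

lemma run_lifetime:
  assumes "graph_in s" "s ''L'' 0 = 0"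
  shows "run p_lifetime s ''L'' 0 = L" "run p_lifetime s ''L1'' 0 = Suc L"
proof -
  let ?p = "For ''e'' ''m'' (When (Lt (V ''L'') (Load ''time'' (V ''e''))) (Set ''L'' (Load ''time'' (V ''e''))))"
  have "run ?p s ''L'' 0 = Max (insert 0 (ti ` {..<s ''m'' 0}))"
  proof (rule run_For_induct[where I = "\<lambda>i s. s ''L'' 0 = Max (insert 0 (ti ` {..<i}))"], goal_cases)
    case (5 i s')
    have "Max (insert 0 (ti ` {..<Suc i})) = max (ti i) (Max (insert 0 (ti ` {..<i})))"
      by (simp add: lessThan_Suc insert_commute[of 0 "ti i"])
    moreover have "upd ''e'' 0 (Suc i) (run (When (Lt (V ''L'') (Load ''time'' (V ''e''))) (Set ''L'' (Load ''time'' (V ''e'')))) s') ''L'' 0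
      = max (ti i) (s' ''L'' 0)"
      using 5(1,2,3) assms by (simp add: graph_in_def max_def)
    ultimately show ?case using 5(4) by (simp only:)
  qed (use assms in auto)
  then show "run p_lifetime s ''L'' 0 = L" "run p_lifetime s ''L1'' 0 = Suc L"
    using assms by (simp_all add: p_lifetime_def L_def graph_in_def)
qed

lemma run_relax_edge:
  assumes "graph_in s" "e < m" "s ''e'' 0 = e" "s ''t'' 0 = t" "\<forall>v<n. s ''arr'' v = f v"
  shows "\<forall>v<n. run p_relax_edge s ''arr'' v = relax_edge (Suc t) e f v"
  using assms edge_props[OF assms(2)]
  by (auto simp: p_relax_edge_def p_relax_def relax_edge_def relax_def graph_in_def)

lemma run_relax_all:
  assumes "graph_in s" "s ''t'' 0 = t" "\<forall>v<n. s ''arr'' v = f v"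
  shows "\<forall>v<n. run p_relax_all s ''arr'' v = relax_all (Suc t) f v"
proof -
  have "\<forall>v<n. run p_relax_all s ''arr'' v = fold (relax_edge (Suc t)) [0..<s ''m'' 0] f v"
    unfolding p_relax_all_def
  proof (rule run_For_induct[where I = "\<lambda>i s. \<forall>v<n. s ''arr'' v = fold (relax_edge (Suc t)) [0..<i] f v"], goal_cases)
    case (5 i s')
    then have "graph_in s'" "i < m" using assms by (auto simp: graph_in_def)
    then show ?case using run_relax_edge[of s' i t "fold (relax_edge (Suc t)) [0..<i] f"] 5 assms by simp
  qed (use assms in auto)
  then show ?thesis using assms by (simp add: relax_all_def graph_in_def)
qed

lemma run_arr:
  assumes "graph_in s" "s ''L'' 0 = L" "s ''L1'' 0 = Suc L"
  shows "\<forall>v<n. run p_arr s ''arr'' v = arr v"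
proof -
  define s1 where "s1 = run (For ''v'' ''n'' (Put ''arr'' (V ''v'') (V ''L1''))) s"
  define s2 where "s2 = run (Put ''arr'' (V ''source'') (Const 0)) s1"
  have fr: "s1 a = s a" if "a \<noteq> ''v''" "a \<noteq> ''arr''" for a
    unfolding s1_def by (rule run_frame) (use that in simp)
  have "\<forall>v<s ''n'' 0. s1 ''arr'' v = Suc L"
    unfolding s1_def
    by (rule run_For_induct[where I = "\<lambda>i s. \<forall>v<i. s ''arr'' v = Suc L"])
       (use assms in \<open>auto simp: less_Suc_eq\<close>)
  then have s2: "\<forall>v<n. s2 ''arr'' v = (if v = src then 0 else Suc L)"
    using assms fr by (simp add: s2_def graph_in_def)
  have g2: "graph_in s2" "s2 ''L'' 0 = L" using assms fr by (auto simp: s2_def graph_in_def)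
  have "\<forall>v<n. run (For ''t'' ''L'' p_relax_all) s2 ''arr'' v =
     fold (\<lambda>t. relax_all (Suc t)) [0..<s2 ''L'' 0] (\<lambda>v. if v = src then 0 else Suc L) v"
  proof (rule run_For_induct[where I = "\<lambda>i s. \<forall>v<n. s ''arr'' v =
     fold (\<lambda>t. relax_all (Suc t)) [0..<i] (\<lambda>v. if v = src then 0 else Suc L) v"], goal_cases)
    case (5 i s')
    then have "graph_in s'" using g2 by (auto simp: graph_in_def)
    from run_relax_all[OF this 5(2) 5(4)] show ?case by simp
  qed (use s2 in auto)
  then show ?thesis using g2 by (simp add: p_arr_def s1_def s2_def arr_def)
qed

lemma run_merge:
  assumes "graph_in s" "e < m" "s ''e'' 0 = e" "\<forall>v<n. s ''cl'' v = f v"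
  shows "\<forall>v<n. run p_merge s ''cl'' v = merge (ta e) (he e) f v"
proof -
  define s1 where "s1 = run (Set ''p'' (Load ''cl'' (Load ''tail'' (V ''e''))) ;; Set ''q'' (Load ''cl'' (Load ''head'' (V ''e'')))) s"
  let ?w = "For ''w'' ''n'' (When (Eq (Load ''cl'' (V ''w'')) (V ''q'')) (Put ''cl'' (V ''w'') (V ''p'')))"
  have s1: "s1 ''p'' 0 = f (ta e)" "s1 ''q'' 0 = f (he e)" "s1 ''n'' 0 = n" "\<forall>v<n. s1 ''cl'' v = f v"
    using assms edge_props[OF assms(2)] by (auto simp: s1_def graph_in_def)
  have "\<forall>v<n. run ?w s1 ''cl'' v = (if v < s1 ''n'' 0 then merge (ta e) (he e) f v else f v)"
  proof (rule run_For_induct[where I = "\<lambda>i s. \<forall>v<n. s ''cl'' v = (if v < i then merge (ta e) (he e) f v else f v)"], goal_cases)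
    case (5 i s')
    then show ?case using s1 by (auto simp: merge_def less_Suc_eq)
  qed (use s1 in auto)
  then show ?thesis using s1(3) by (simp add: p_merge_def s1_def)
qed

lemma run_merge_all:
  assumes "graph_in s" "\<forall>v<n. s ''arr'' v = arr v" "s ''t'' 0 = L - d" "\<forall>v<n. s ''cl'' v = lev d v"
  shows "\<forall>v<n. run p_merge_all s ''cl'' v = lev (Suc d) v"
proof -
  have "\<forall>v<n. run p_merge_all s ''cl'' v = fold (merge_edge (L - d)) [0..<s ''m'' 0] (lev d) v"
    unfolding p_merge_all_def
  proof (rule run_For_induct[where I = "\<lambda>i s. \<forall>v<n. s ''cl'' v = fold (merge_edge (L - d)) [0..<i] (lev d) v"], goal_cases)
    case (5 i s')
    then have g: "graph_in s'" "i < m" using assms by (auto simp: graph_in_def)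
    then have "active i (L - d) \<longleftrightarrow> s' ''time'' i = s' ''t'' 0 \<and>
       (s' ''arr'' (s' ''tail'' i) < s' ''t'' 0 \<or> s' ''arr'' (s' ''head'' i) < s' ''t'' 0)"
      using 5 assms edge_props[OF g(2)] by (simp add: active_def graph_in_def)
    then show ?case using run_merge[OF g 5(2) 5(4)] 5(2,4)
      by (cases "active i (L - d)") (auto simp: merge_edge_def)
  qed (use assms in auto)
  then show ?thesis using assms(1) by (simp add: graph_in_def lev.simps(2))
qed

lemma run_lab:
  assumes "graph_in s" "\<forall>v<n. s ''arr'' v = arr v" "s ''L'' 0 = L" "\<forall>t\<le>L. s ''tn'' t = t * n"
    and "\<forall>v<n. s ''lab'' v = 0"
  shows "\<forall>t\<le>L. \<forall>v<n. run p_lab s ''lab'' (t * n + v) = lab t v"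
proof -
  define s1 where "s1 = run (For ''v'' ''n'' (Put ''cl'' (V ''v'') (V ''v''))) s"
  have fr: "s1 a = s a" if "a \<noteq> ''v''" "a \<noteq> ''cl''" for a
    unfolding s1_def by (rule run_frame) (use that in simp)
  have "\<forall>v<s ''n'' 0. s1 ''cl'' v = v"
    unfolding s1_def
    by (rule run_For_induct[where I = "\<lambda>i s. \<forall>v<i. s ''cl'' v = v"]) (auto simp: less_Suc_eq)
  then have cl: "\<forall>v<n. s1 ''cl'' v = lev 0 v" using assms(1) by (simp add: graph_in_def)
  have s1: "graph_in s1" "\<forall>v<n. s1 ''arr'' v = arr v" "s1 ''L'' 0 = L" "\<forall>t\<le>L. s1 ''tn'' t = t * n"
    "\<forall>v<n. s1 ''lab'' v = 0"
    using assms fr by (auto simp: graph_in_def)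
  \<comment> \<open>After \<open>i\<close> rounds the rows of the last \<open>i\<close> times are
    finished; row 0 is correct from the start.\<close>
  let ?I = "\<lambda>i s. (\<forall>v<n. s ''cl'' v = lev i v) \<and>
     (\<forall>t\<le>L. \<forall>v<n. t = 0 \<or> L - i < t \<longrightarrow> s ''lab'' (t * n + v) = lab t v)"
  have "?I (s1 ''L'' 0) (run (For ''d'' ''L'' p_level) s1)"
  proof (rule run_For_induct[where I = ?I], goal_cases)
    case (5 i s')
    have i: "i < L" using 5(1) s1(3) by simp
    have cl5: "\<forall>v<n. s' ''cl'' v = lev i v"
      and lab5: "\<forall>t\<le>L. \<forall>v<n. t = 0 \<or> L - i < t \<longrightarrow> s' ''lab'' (t * n + v) = lab t v"
      using 5(4) by blast+
    have s1': "s' ''n'' = s1 ''n''" "s' ''m'' = s1 ''m''" "s' ''source'' = s1 ''source''" "s' ''tail'' = s1 ''tail''"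
      "s' ''head'' = s1 ''head''" "s' ''time'' = s1 ''time''" "s' ''arr'' = s1 ''arr''" "s' ''L'' = s1 ''L''" "s' ''tn'' = s1 ''tn''"
      using 5(3) by simp_all
    define s2 where "s2 = run (Set ''t'' (Sub (V ''L'') (V ''d''))) s'"
    define s3 where "s3 = run p_merge_all s2"
    let ?c = "For ''v'' ''n'' (Put ''lab'' (Add (Load ''tn'' (V ''t'')) (V ''v'')) (Load ''cl'' (V ''v'')))"
    have s2: "graph_in s2" "\<forall>v<n. s2 ''arr'' v = arr v" "s2 ''t'' 0 = L - i" "\<forall>v<n. s2 ''cl'' v = lev i v"
      "\<forall>t\<le>L. s2 ''tn'' t = t * n" "s2 ''lab'' = s' ''lab''"
      using 5(2) s1 s1' cl5 by (simp_all add: s2_def graph_in_def)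
    have s3: "\<forall>v<n. s3 ''cl'' v = lev (Suc i) v" "s3 ''tn'' (L - i) = (L - i) * n" "s3 ''t'' 0 = L - i" "s3 ''n'' 0 = n"
      "s3 ''lab'' = s' ''lab''"
      using run_merge_all[OF s2(1-4)] s2 by (simp_all add: s3_def run_frame graph_in_def del: lev.simps)
    have "\<forall>j. run ?c s3 ''lab'' j = (if \<exists>v<s3 ''n'' 0. j = (L - i) * n + v then lev (Suc i) (j - (L - i) * n) else s3 ''lab'' j)"
    proof (rule run_For_induct[where I = "\<lambda>k s. \<forall>j. s ''lab'' j = (if \<exists>v<k. j = (L - i) * n + v then lev (Suc i) (j - (L - i) * n) else s3 ''lab'' j)"], goal_cases)
      case (5 k s4)
      have k: "k < n" using 5(1) s3 by simp
      have "s4 ''tn'' = s3 ''tn''" "s4 ''t'' = s3 ''t''" "s4 ''cl'' = s3 ''cl''" using 5(3) by simp_all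
      then have "run (Put ''lab'' (Add (Load ''tn'' (V ''t'')) (V ''v'')) (Load ''cl'' (V ''v''))) s4 ''lab'' =
          (s4 ''lab'')((L - i) * n + k := lev (Suc i) k)"
        using 5(2) s3 k by simp
      then show ?case using 5(4) by (auto simp: less_Suc_eq)
    qed simp_all
    then have c: "run ?c s3 ''lab'' j = (if \<exists>v<n. j = (L - i) * n + v then lev (Suc i) (j - (L - i) * n) else s' ''lab'' j)" for j
      unfolding s3(4,5) by (rule spec)
    have "run ?c s3 ''lab'' (t * n + v) = lab t v" if t: "t \<le> L" "v < n" "t = 0 \<or> L - Suc i < t" for t v
    proof (cases "t = L - i")
      case True
      then show ?thesis using c[of "t * n + v"] t i by (auto simp: lab_def Suc_diff_le)
    next
      case False
      have "t * n + v \<noteq> (L - i) * n + w" if "w < n" for w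
      proof
        assume "t * n + v = (L - i) * n + w"
        then have "(t * n + v) div n = ((L - i) * n + w) div n" by simp
        then show False using that t False by simp
      qed
      then show ?thesis using c[of "t * n + v"] t False lab5 by auto
    qed
    moreover have "run ?c s3 ''cl'' = s3 ''cl''" by (rule run_frame) simp
    ultimately show ?case using s3(1) by (simp add: p_level_def s2_def s3_def del: lev.simps)
  next
    case 4
    then show ?case using s1 cl by (auto simp: lab_def)
  qed auto
  then have "\<forall>t\<le>L. \<forall>v<n. run (For ''d'' ''L'' p_level) s1 ''lab'' (t * n + v) = lab t v"
    unfolding s1(3) by (metis diff_self_eq_0 gr0I)
  then show ?thesis by (simp add: p_lab_def s1_def)
qed

lemma rank_late: "\<not> arr v \<le> t \<Longrightarrow> rank t v = n"
  by (simp add: rank_def)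

lemma run_rank_vertex:
  assumes "graph_in s" "\<forall>v<n. s ''arr'' v = arr v" "\<forall>t\<le>L. s ''tn'' t = t * n"
    and "\<forall>t\<le>L. \<forall>v<n. s ''lab'' (t * n + v) = lab t v"
    and "s ''t'' 0 = t" "t \<le> L" "s ''v'' 0 = v" "v < n"
  shows "run p_rank_vertex s ''rank'' = (s ''rank'')(t * n + v := rank t v)"
    and "run p_rank_vertex s ''k'' 0 = (if arr v \<le> t then max (Suc (rank t v)) (s ''k'' 0) else s ''k'' 0)"
proof -
  let ?P = "\<lambda>w. w < v \<and> arr w \<le> t \<and> lab t w = lab t v"
  let ?p = "For ''w'' ''n'' (When (And (Lt (V ''w'') (V ''v''))
     (And (Neg (Lt (V ''t'') (Load ''arr'' (V ''w'')))) (Eq (lab_at (V ''t'') (V ''w'')) (lab_at (V ''t'') (V ''v'')))))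
     (Set ''q'' (Add (V ''q'') (Const 1))))"
  define s1 where "s1 = run (Set ''q'' (Const 0)) s"
  have s1: "graph_in s1" "\<forall>v<n. s1 ''arr'' v = arr v" "\<forall>t\<le>L. s1 ''tn'' t = t * n"
    "\<forall>t\<le>L. \<forall>v<n. s1 ''lab'' (t * n + v) = lab t v" "s1 ''t'' 0 = t" "s1 ''v'' 0 = v" "s1 ''q'' 0 = 0"
    using assms by (auto simp: s1_def graph_in_def)
  have "run ?p s1 ''q'' 0 = card {w. w < s1 ''n'' 0 \<and> ?P w}"
  proof (rule run_For_induct[where I = "\<lambda>i s. s ''q'' 0 = card {w. w < i \<and> ?P w}"], goal_cases)
    case (5 i s')
    have i: "i < n" using 5(1) s1 by (simp add: graph_in_def)
    show ?case unfolding card_less_Suc_if using 5(2,3,4) s1 i assms(6,8) by (auto simp: lab_at_def)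
  qed (use s1 in auto)
  moreover have "{w. w < n \<and> ?P w} = {w. ?P w}" using assms(8) by auto
  ultimately have q: "arr v \<le> t \<Longrightarrow> run p_count s ''q'' 0 = rank t v"
    using s1(1) by (simp add: p_count_def s1_def rank_def graph_in_def)
  have fr: "run p_count s a = s a" if "a \<noteq> ''q''" "a \<noteq> ''w''" for a by (rule run_frame) (use that in simp)
  have c: "run p_count s ''tn'' t = t * n" "run p_count s ''t'' 0 = t" "run p_count s ''v'' 0 = v"
    "run p_count s ''rank'' = s ''rank''" "run p_count s ''k'' = s ''k''"
    using fr assms(3,5,6,7) by simp_all
  have s: "s ''tn'' t = t * n" "s ''n'' 0 = n" "s ''arr'' v = arr v"
    using assms by (simp_all add: graph_in_def)
  show "run p_rank_vertex s ''rank'' = (s ''rank'')(t * n + v := rank t v)"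
  proof (cases "t < arr v")
    case True
    then show ?thesis using rank_late[of v t] assms(5,7) s by (simp add: p_rank_vertex_def)
  next
    case False
    then show ?thesis using q c assms(5,7) s(3) by (auto simp: p_rank_vertex_def fun_eq_iff)
  qed
  show "run p_rank_vertex s ''k'' 0 = (if arr v \<le> t then max (Suc (rank t v)) (s ''k'' 0) else s ''k'' 0)"
  proof (cases "t < arr v")
    case True
    then show ?thesis using assms(5,7) s by (simp add: p_rank_vertex_def)
  next
    case False
    then show ?thesis using q c assms(5,7) s(3) by (simp add: p_rank_vertex_def)
  qed
qed

lemma run_rank:
  assumes "graph_in s" "\<forall>v<n. s ''arr'' v = arr v" "\<forall>t\<le>L. s ''tn'' t = t * n"
    and "\<forall>t\<le>L. \<forall>v<n. s ''lab'' (t * n + v) = lab t v"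
    and "s ''L1'' 0 = Suc L" "s ''k'' 0 = 0"
  shows "\<forall>t\<le>L. \<forall>v<n. run p_rank s ''rank'' (t * n + v) = rank t v" "run p_rank s ''k'' 0 = bits"
proof -
  have ne: "t * n + v \<noteq> t' * n + v'" if "v < n" "v' < n" "t \<noteq> t' \<or> v \<noteq> v'" for t t' v v'
  proof
    assume eq: "t * n + v = t' * n + v'"
    then have "(t * n + v) div n = (t' * n + v') div n" by simp
    then have "t = t'" using that by simp
    then show False using that eq by simp
  qed
  let ?S = "\<lambda>s. graph_in s \<and> (\<forall>v<n. s ''arr'' v = arr v) \<and> (\<forall>t\<le>L. s ''tn'' t = t * n) \<and>
    (\<forall>t\<le>L. \<forall>v<n. s ''lab'' (t * n + v) = lab t v)"
  \<comment> \<open>The value of \<open>k\<close> is described by its upper bounds, which makes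
    sense for an empty \<open>D\<close> and fits \<open>bits_leI\<close> at the end.\<close>
  let ?J = "\<lambda>D s. (\<forall>(t, v)\<in>D. s ''rank'' (t * n + v) = rank t v) \<and>
    (\<forall>z. s ''k'' 0 \<le> z \<longleftrightarrow> (\<forall>(t, v)\<in>D. arr v \<le> t \<longrightarrow> rank t v < z))"
  have level: "?J (D \<union> {t} \<times> {..<n}) (run p_rank_level s)"
    if s: "?S s" "s ''t'' 0 = t" "t \<le> L" "?J D s" "D \<subseteq> {..<t} \<times> {..<n}" for s D t
  proof -
    have "?J (D \<union> {t} \<times> {..<s ''n'' 0}) (run p_rank_level s)"
      unfolding p_rank_level_def
    proof (rule run_For_induct[where I = "\<lambda>i. ?J (D \<union> {t} \<times> {..<i})"], goal_cases)
      case (5 v s')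
      have v: "v < n" using 5(1) s(1) by (simp add: graph_in_def)
      have S': "graph_in s'" "\<forall>v<n. s' ''arr'' v = arr v" "\<forall>t\<le>L. s' ''tn'' t = t * n"
        "\<forall>t\<le>L. \<forall>v<n. s' ''lab'' (t * n + v) = lab t v" "s' ''t'' 0 = t"
        using 5(3) s by (auto simp: graph_in_def)
      note r = run_rank_vertex[OF S' s(3) 5(2) v]
      have D: "D \<union> {t} \<times> {..<Suc v} = insert (t, v) (D \<union> {t} \<times> {..<v})" by auto
      have "run p_rank_vertex s' ''rank'' (t' * n + v') = rank t' v'"
        if "(t', v') \<in> D \<union> {t} \<times> {..<Suc v}" for t' v'
      proof (cases "(t', v') = (t, v)")
        case False
        then have "(t', v') \<in> D \<union> {t} \<times> {..<v}" using that unfolding D by blast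
        then show ?thesis using 5(4) ne[of v' v t' t] s(5) v unfolding r(1) by auto
      qed (simp add: r(1))
      then have "\<forall>(t', v')\<in>D \<union> {t} \<times> {..<Suc v}. run p_rank_vertex s' ''rank'' (t' * n + v') = rank t' v'"
        by blast
      moreover have "\<forall>z. run p_rank_vertex s' ''k'' 0 \<le> z \<longleftrightarrow> (\<forall>(t', v')\<in>D \<union> {t} \<times> {..<Suc v}. arr v' \<le> t' \<longrightarrow> rank t' v' < z)"
        using 5(4) unfolding D r(2) by (auto simp: Suc_le_eq)
      ultimately show ?case by simp
    qed (use s in auto)
    then show ?thesis using s(1) by (simp add: graph_in_def)
  qed
  have "?J ({..<s ''L1'' 0} \<times> {..<n}) (run p_rank s)"
    unfolding p_rank_def
  proof (rule run_For_induct[where I = "\<lambda>i. ?J ({..<i} \<times> {..<n})"], goal_cases)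
    case (5 i s')
    have i: "i \<le> L" using 5(1) assms by simp
    have S': "?S s'" using 5(3) assms by (auto simp: graph_in_def)
    have "{..<Suc i} \<times> {..<n} = {..<i} \<times> {..<n} \<union> {i} \<times> {..<n}" by auto
    then show ?case using level[OF S' 5(2) i 5(4)] by simp
  qed (use assms in auto)
  then have J: "?J ({..L} \<times> {..<n}) (run p_rank s)" using assms(5) by (simp add: lessThan_Suc_atMost)
  then show "\<forall>t\<le>L. \<forall>v<n. run p_rank s ''rank'' (t * n + v) = rank t v" by auto
  have k: "run p_rank s ''k'' 0 \<le> z \<longleftrightarrow> (\<forall>t\<le>L. \<forall>v<n. arr v \<le> t \<longrightarrow> rank t v < z)" for z using J by auto
  have "run p_rank s ''k'' 0 \<le> bits" unfolding k using rank_less_bits by blast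
  moreover have "bits \<le> run p_rank s ''k'' 0" by (rule bits_leI) (use k[of "run p_rank s ''k'' 0"] in auto)
  ultimately show "run p_rank s ''k'' 0 = bits" by simp
qed

end

section \<open>The program: the table\<close>

definition p_powers where
  "p_powers = Set ''K'' (Const 1) ;; For ''i'' ''k'' (Set ''K'' (Add (V ''K'') (V ''K''))) ;;
     Set ''N'' (Add (V ''n'') (Add (V ''m'') (Add (V ''L'') (Add (V ''K'') (Add (V ''K'') (Const 2)))))) ;;
     Set ''n1'' (Add (V ''n'') (Const 1))"
text \<open>Each table supplies the step of the next one: its entry at \<open>N\<close> is the next
  power of \<open>N\<close>. Together they place five digits in base \<open>N\<close> by additions
  only.\<close>

definition p_digits where
  "p_digits = p_multiples ''M1'' ''N'' (V ''N'') ;; Set ''N2'' (Load ''M1'' (V ''N'')) ;;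
     p_multiples ''M2'' ''N'' (V ''N2'') ;; Set ''N3'' (Load ''M2'' (V ''N'')) ;;
     p_multiples ''M3'' ''N'' (V ''N3'') ;; Set ''N4'' (Load ''M3'' (V ''N'')) ;;
     p_multiples ''M4'' ''N'' (V ''N4'')"

definition bit_at where "bit_at x i = Load ''bit'' (Add (Load ''M1'' x) i)"

definition p_bit_row where
  "p_bit_row = For ''i'' ''n'' (
     Put ''bit'' (Add (Load ''M1'' (Add (V ''x'') (V ''x''))) (Add (V ''i'') (Const 1))) (bit_at (V ''x'') (V ''i'')) ;;
     Put ''bit'' (Add (Load ''M1'' (Add (Add (V ''x'') (V ''x'')) (Const 1))) (Add (V ''i'') (Const 1))) (bit_at (V ''x'') (V ''i'')))
   ;; Put ''bit'' (Load ''M1'' (Add (Add (V ''x'') (V ''x'')) (Const 1))) (Const 1)"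
text \<open>Row \<open>x\<close> of the bit table is shifted by one into the rows \<open>2 x\<close> and \<open>2 x + 1\<close>; column \<open>0\<close> of the even
  row keeps its initial value \<open>0\<close>.\<close>

definition p_bits where "p_bits = For ''x'' ''K'' p_bit_row"

text \<open>Entry \<open>(t, a, x, b, c)\<close> of the table is the least cost, capped at \<open>h + 1\<close>, of the times after \<open>t\<close> on
  those children of class \<open>a\<close> at time \<open>t\<close> whose label is below \<open>b\<close>, if \<open>x\<close> encodes the vertices of the class
  reached by time \<open>t\<close> and at most \<open>c\<close> more vertices may be reached. The entries with \<open>t = L\<close> or \<open>b = 0\<close>
  keep their initial value \<open>0\<close>.\<close>

definition table_index where
  "table_index t a x b c = Add (Load ''M4'' t) (Add (Load ''M3'' a) (Add (Load ''M2'' x) (Add (Load ''M1'' b) c)))"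
definition next_t where "next_t = Add (V ''t'') (Const 1)"
definition mem where "mem t v x = bit_at x (rank_at t v)"

definition p_vertices where
  "p_vertices = For ''v'' ''n'' (When (Eq (lab_at next_t (V ''v'')) (V ''b''))
     (Cond (mem (V ''t'') (V ''v'') (V ''x''))
       (When (Neg (mem next_t (V ''v'') (V ''y''))) (Set ''ok'' (Const 0)))
       (When (mem next_t (V ''v'') (V ''y'')) (Set ''new'' (Add (V ''new'') (Const 1))))))"
definition tail_e where "tail_e = Load ''tail'' (V ''e'')"
definition head_e where "head_e = Load ''head'' (V ''e'')"
text \<open>Only the tail is compared with class \<open>b\<close>. An edge of the next time with an
  end in the reached set is active, so its head lies in the same class.\<close>

definition p_edges where
  "p_edges = For ''e'' ''m'' (When (And
     (And (Eq (Load ''time'' (V ''e'')) next_t) (Eq (lab_at next_t tail_e) (V ''b'')))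
     (Or (And (mem (V ''t'') tail_e (V ''x'')) (Neg (mem next_t head_e (V ''y''))))
         (And (mem (V ''t'') head_e (V ''x'')) (Neg (mem next_t tail_e (V ''y''))))))
     (Set ''cost'' (Add (V ''cost'') (Const 1))))"
definition p_split where
  "p_split = For ''c1'' ''n1'' (When (Neg (Lt (V ''c'') (Add (V ''c1'') (V ''new''))))
     (Set ''val'' (Add (Add (Load ''T'' (table_index (V ''t'') (V ''a'') (V ''x'') (V ''b'') (V ''c1''))) (V ''cost''))
        (Load ''T'' (table_index next_t (V ''b'') (V ''y'') (V ''n'') (Sub (V ''c'') (Add (V ''c1'') (V ''new'')))))) ;;
      When (Lt (V ''val'') (V ''best'')) (Set ''best'' (V ''val''))))"
definition p_code where
  "p_code = Set ''ok'' (Const 1) ;; Set ''new'' (Const 0) ;; Set ''cost'' (Const 0) ;;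
     p_vertices ;; p_edges ;; When (V ''ok'') p_split"
text \<open>A vertex \<open>b\<close> that does not represent a child of \<open>a\<close> adds
  nothing, and the old entry is carried over. Otherwise the search over codes starts from
  \<open>h + 1\<close>, meaning too expensive.\<close>

definition p_best where
  "p_best = Cond (And (Eq (lab_at next_t (V ''b'')) (V ''b'')) (Eq (lab_at (V ''t'') (V ''b'')) (V ''a'')))
     (Set ''best'' (Add (V ''h'') (Const 1)) ;; For ''y'' ''K'' p_code)
     (Set ''best'' (Load ''T'' (table_index (V ''t'') (V ''a'') (V ''x'') (V ''b'') (V ''c''))))"
definition p_cell where
  "p_cell = p_best ;;
     Put ''T'' (table_index (V ''t'') (V ''a'') (V ''x'') (Add (V ''b'') (Const 1)) (V ''c'')) (V ''best'')"
definition p_loop_c where "p_loop_c = For ''c'' ''n1'' p_cell"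
definition p_loop_x where "p_loop_x = For ''x'' ''K'' p_loop_c"
definition p_loop_a where "p_loop_a = For ''a'' ''n'' p_loop_x"
definition p_loop_b where "p_loop_b = For ''b'' ''n'' p_loop_a"
definition p_table where
  "p_table = For ''d'' ''L'' (Set ''t'' (Sub (V ''L'') (Add (V ''d'') (Const 1))) ;; p_loop_b)"
text \<open>The nested subtraction is \<open>min n (r - 1)\<close>, which keeps the index inside the
  table. Code 1 stands for the source alone, and class 0 at time 0 contains every vertex.\<close>

definition p_out where
  "p_out = Set ''out'' (Neg (Lt (V ''h'') (Load ''T'' (table_index (Const 0) (Const 0) (Const 1) (V ''n'')
     (Sub (V ''n'') (Sub (V ''n'') (Sub (V ''r'') (Const 1))))))))"

lemma writes_table_programs [simp]:
  "writes p_powers = {''K'', ''i'', ''N'', ''n1''}"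
  "writes p_digits = {''i'', ''M1'', ''N2'', ''M2'', ''N3'', ''M3'', ''N4'', ''M4''}"
  "writes p_bit_row = {''i'', ''bit''}" "writes p_bits = {''x'', ''i'', ''bit''}"
  "writes p_vertices = {''v'', ''ok'', ''new''}" "writes p_edges = {''e'', ''cost''}"
  "writes p_split = {''c1'', ''val'', ''best''}"
  "writes p_code = {''ok'', ''new'', ''cost'', ''v'', ''e'', ''c1'', ''val'', ''best''}"
  "writes p_best = {''y'', ''ok'', ''new'', ''cost'', ''v'', ''e'', ''c1'', ''val'', ''best''}"
  "writes p_cell = {''y'', ''ok'', ''new'', ''cost'', ''v'', ''e'', ''c1'', ''val'', ''best'', ''T''}"
  "writes p_loop_c = {''c'', ''y'', ''ok'', ''new'', ''cost'', ''v'', ''e'', ''c1'', ''val'', ''best'', ''T''}"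
  "writes p_loop_x = {''x'', ''c'', ''y'', ''ok'', ''new'', ''cost'', ''v'', ''e'', ''c1'', ''val'', ''best'', ''T''}"
  "writes p_loop_a = {''a'', ''x'', ''c'', ''y'', ''ok'', ''new'', ''cost'', ''v'', ''e'', ''c1'', ''val'', ''best'', ''T''}"
  "writes p_loop_b = {''b'', ''a'', ''x'', ''c'', ''y'', ''ok'', ''new'', ''cost'', ''v'', ''e'', ''c1'', ''val'', ''best'', ''T''}"
  by (auto simp: p_powers_def p_digits_def p_bit_row_def p_bits_def p_vertices_def p_edges_def p_split_def
      p_code_def p_best_def p_cell_def p_loop_c_def p_loop_x_def p_loop_a_def p_loop_b_def)

section \<open>Indices and the static memory of the table phase\<close>

lemma digit_eq:
  fixes N :: nat
  assumes "u * N + v = u' * N + v'" "v < N" "v' < N"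
  shows "u = u' \<and> v = v'"
proof -
  have "(u * N + v) div N = (u' * N + v') div N" using assms(1) by simp
  then have "u = u'" using assms(2,3) by simp
  then show ?thesis using assms(1) by simp
qed

context edge_list
begin

text \<open>Large enough to be a base for all index digits and a bound for all loops.
  \<open>2 ^ bits\<close> enters twice because building the bit table touches the rows
  \<open>2 * x\<close> and \<open>2 * x + 1\<close> for every code \<open>x\<close>.\<close>

definition base where "base = n + m + L + 2 ^ bits + 2 ^ bits + 2"

definition index where
  "index t a x b c = t * (base * (base * (base * base))) + (a * (base * (base * base)) + (x * (base * base) + (b * base + c)))"

definition valid :: "nat \<Rightarrow> nat \<Rightarrow> nat \<Rightarrow> nat \<Rightarrow> nat \<Rightarrow> bool" where
  "valid t a x b c \<longleftrightarrow> t \<le> L \<and> a < n \<and> x < 2 ^ bits \<and> b \<le> n \<and> c \<le> n"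

lemma index_inj:
  assumes "index t a x b c = index t' a' x' b' c'" "valid t a x b c" "valid t' a' x' b' c'"
  shows "t = t' \<and> a = a' \<and> x = x' \<and> b = b' \<and> c = c'"
proof -
  have horner: "index t a x b c = (((t * base + a) * base + x) * base + b) * base + c" for t a x b c
    by (simp add: index_def algebra_simps)
  have lt: "a < base \<and> x < base \<and> b < base \<and> c < base" if "valid t a x b c" for t a x b c
    using that by (auto simp: valid_def base_def)
  note l1 = lt[OF assms(2)] and l2 = lt[OF assms(3)]
  note e = assms(1)[unfolded horner]
  have 1: "((t * base + a) * base + x) * base + b = ((t' * base + a') * base + x') * base + b'" "c = c'"
    using digit_eq[OF e] l1 l2 by auto
  have 2: "(t * base + a) * base + x = (t' * base + a') * base + x'" "b = b'" using digit_eq[OF 1(1)] l1 l2 by auto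
  have 3: "t * base + a = t' * base + a'" "x = x'" using digit_eq[OF 2(1)] l1 l2 by auto
  show ?thesis using digit_eq[OF 3(1)] l1 l2 1 2 3 by auto
qed

text \<open>What the filling of the table presupposes and leaves untouched.\<close>

definition ready :: "nat \<Rightarrow> ram_state \<Rightarrow> bool" where
  "ready h s \<longleftrightarrow> graph_in s \<and> s ''L'' 0 = L \<and> s ''K'' 0 = 2 ^ bits \<and> s ''n1'' 0 = Suc n \<and> s ''h'' 0 = h \<and>
     (\<forall>t\<le>L. s ''tn'' t = t * n) \<and>
     (\<forall>t\<le>L. \<forall>v<n. s ''lab'' (t * n + v) = lab t v) \<and>
     (\<forall>t\<le>L. \<forall>v<n. s ''rank'' (t * n + v) = rank t v) \<and>
     (\<forall>x<2 ^ bits. \<forall>j\<le>n. s ''bit'' (x * base + j) = of_bool (bit x j)) \<and>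
     (\<forall>i\<le>base. s ''M1'' i = i * base \<and> s ''M2'' i = i * (base * base) \<and>
        s ''M3'' i = i * (base * (base * base)) \<and> s ''M4'' i = i * (base * (base * (base * base))))"

definition static :: "string set" where
  "static = {''n'', ''m'', ''source'', ''tail'', ''head'', ''time'', ''L'', ''K'', ''n1'', ''h'', ''tn'', ''lab'',
     ''rank'', ''bit'', ''M1'', ''M2'', ''M3'', ''M4''}"

lemma ready_frame:
  assumes "ready h s" "insert x W \<inter> static = {}" "\<And>a. a \<noteq> x \<Longrightarrow> a \<notin> W \<Longrightarrow> s' a = s a"
  shows "ready h s'"
proof -
  have "s' a = s a" if "a \<in> static" for a using assms(2,3) that by blast
  then show ?thesis using assms(1) unfolding ready_def graph_in_def static_def by simp
qed

lemma ready_run: "ready h s \<Longrightarrow> writes p \<inter> static = {} \<Longrightarrow> ready h (run p s)"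
  by (rule ready_frame[of h s "''d''" "writes p"]) (auto simp: static_def run_frame)

lemma readyD:
  assumes "ready h s"
  shows "s ''n'' 0 = n" "s ''m'' 0 = m" "s ''L'' 0 = L" "s ''K'' 0 = 2 ^ bits" "s ''n1'' 0 = Suc n" "s ''h'' 0 = h"
    "e < m \<Longrightarrow> s ''tail'' e = ta e" "e < m \<Longrightarrow> s ''head'' e = he e" "e < m \<Longrightarrow> s ''time'' e = ti e"
  using assms by (simp_all add: ready_def graph_in_def)

lemma rank_le_n: "v < n \<Longrightarrow> rank t v \<le> n"
  using rank_less_n[of v t] rank_late[of v t] by (cases "arr v \<le> t") auto

lemma ram_val_lab_at:
  assumes "ready h s" "ram_val t s = t'" "ram_val v s = v'" "t' \<le> L" "v' < n"
  shows "ram_val (lab_at t v) s = lab t' v'"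
  using assms by (simp add: lab_at_def ready_def)

lemma ram_val_mem:
  assumes "ready h s" "ram_val t s = t'" "ram_val v s = v'" "ram_val x s = x'" "t' \<le> L" "v' < n" "x' < 2 ^ bits"
  shows "ram_val (mem t v x) s = of_bool (bit x' (rank t' v'))"
proof -
  have "x' \<le> base" using assms(7) by (simp add: base_def)
  then show ?thesis using assms rank_le_n[of v' t'] by (simp add: mem_def bit_at_def rank_at_def ready_def)
qed

lemma ram_val_table_index:
  assumes "ready h s" "valid t' a' x' b' c'"
    "ram_val t s = t'" "ram_val a s = a'" "ram_val x s = x'" "ram_val b s = b'" "ram_val c s = c'"
  shows "ram_val (table_index t a x b c) s = index t' a' x' b' c'"
proof -
  have "t' \<le> base" "a' \<le> base" "x' \<le> base" "b' \<le> base" using assms(2) by (auto simp: valid_def base_def)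
  then show ?thesis using assms by (simp add: table_index_def index_def ready_def)
qed

section \<open>Correctness of a single table entry\<close>

lemma run_vertices:
  assumes r: "ready h s" and s: "s ''t'' 0 = t" "s ''b'' 0 = b" "s ''x'' 0 = x" "s ''y'' 0 = y" "s ''ok'' 0 = 1" "s ''new'' 0 = 0"
    and v: "t < L" "x < 2 ^ bits" "y < 2 ^ bits" "child t a b"
  shows "run p_vertices s ''ok'' 0 = of_bool (dec t a x \<inter> cls (Suc t) b \<subseteq> dec (Suc t) b y)"
    and "run p_vertices s ''new'' 0 = card (dec (Suc t) b y - dec t a x \<inter> cls (Suc t) b)"
proof -
  let ?I = "\<lambda>i s. s ''ok'' 0 = of_bool (\<forall>v<i. lab (Suc t) v = b \<longrightarrow> bit x (rank t v) \<longrightarrow> bit y (rank (Suc t) v)) \<and>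
     s ''new'' 0 = card {v. v < i \<and> lab (Suc t) v = b \<and> bit y (rank (Suc t) v) \<and> \<not> bit x (rank t v)}"
  have "?I (s ''n'' 0) (run p_vertices s)"
    unfolding p_vertices_def
  proof (rule run_For_induct[where I = ?I], goal_cases)
    case (5 i s')
    have r': "ready h s'"
      by (rule ready_frame[OF r, of "''v''" "{''ok'', ''new''}"]) (simp_all add: static_def 5(3))
    have s': "s' ''t'' 0 = t" "s' ''b'' 0 = b" "s' ''x'' 0 = x" "s' ''y'' 0 = y" using 5(3) s by simp_all
    have i: "i < n" using 5(1) readyD[OF r] by simp
    have "ram_val (lab_at next_t (V ''v'')) s' = lab (Suc t) i"
      by (rule ram_val_lab_at[OF r']) (use s' 5(2) v i in \<open>auto simp: next_t_def\<close>)
    moreover have "ram_val (mem next_t (V ''v'') (V ''y'')) s' = of_bool (bit y (rank (Suc t) i))"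
      by (rule ram_val_mem[OF r']) (use s' 5(2) v i in \<open>auto simp: next_t_def\<close>)
    moreover have "ram_val (mem (V ''t'') (V ''v'') (V ''x'')) s' = of_bool (bit x (rank t i))"
      by (rule ram_val_mem[OF r']) (use s' 5(2) v i in auto)
    ultimately show ?case using 5(4) s' unfolding card_less_Suc_if All_less_Suc by auto
  qed (use s in auto)
  then have I: "?I n (run p_vertices s)" using readyD[OF r] by simp
  \<comment> \<open>Testing the label at \<open>Suc t\<close> is enough: class \<open>b\<close>
    there lies inside class \<open>a\<close> at time \<open>t\<close>.\<close>
  have lab: "lab t v = a" if "v < n" "lab (Suc t) v = b" for v
    using cls_child[OF v(1,4)] that by (auto simp: cls_def)
  have "(\<forall>v<n. lab (Suc t) v = b \<longrightarrow> bit x (rank t v) \<longrightarrow> bit y (rank (Suc t) v)) \<longleftrightarrow>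
      dec t a x \<inter> cls (Suc t) b \<subseteq> dec (Suc t) b y"
    using lab by (auto simp: dec_def cls_def)
  then show "run p_vertices s ''ok'' 0 = of_bool (dec t a x \<inter> cls (Suc t) b \<subseteq> dec (Suc t) b y)" using I by simp
  have "{v. v < n \<and> lab (Suc t) v = b \<and> bit y (rank (Suc t) v) \<and> \<not> bit x (rank t v)} =
      dec (Suc t) b y - dec t a x \<inter> cls (Suc t) b"
    using lab by (auto simp: dec_def cls_def)
  then show "run p_vertices s ''new'' 0 = card (dec (Suc t) b y - dec t a x \<inter> cls (Suc t) b)" using I by simp
qed

lemma run_edges:
  assumes r: "ready h s" and s: "s ''t'' 0 = t" "s ''b'' 0 = b" "s ''x'' 0 = x" "s ''y'' 0 = y" "s ''cost'' 0 = 0"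
    and v: "t < L" "x < 2 ^ bits" "y < 2 ^ bits" "child t a b"
  shows "run p_edges s ''cost'' 0 = card (cut (Suc t) (dec t a x \<inter> cls (Suc t) b) (dec (Suc t) b y))"
proof -
  let ?P = "\<lambda>e. ti e = Suc t \<and> lab (Suc t) (ta e) = b \<and>
     (bit x (rank t (ta e)) \<and> \<not> bit y (rank (Suc t) (he e)) \<or> bit x (rank t (he e)) \<and> \<not> bit y (rank (Suc t) (ta e)))"
  have "run p_edges s ''cost'' 0 = card {e. e < s ''m'' 0 \<and> ?P e}"
    unfolding p_edges_def
  proof (rule run_For_induct[where I = "\<lambda>i s. s ''cost'' 0 = card {e. e < i \<and> ?P e}"], goal_cases)
    case (5 i s')
    have r': "ready h s'"
      by (rule ready_frame[OF r, of "''e''" "{''cost''}"]) (simp_all add: static_def 5(3))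
    have s': "s' ''t'' 0 = t" "s' ''b'' 0 = b" "s' ''x'' 0 = x" "s' ''y'' 0 = y" using 5(3) s by simp_all
    have i: "i < m" using 5(1) readyD[OF r] by simp
    have ends: "ram_val tail_e s' = ta i" "ram_val head_e s' = he i" "s' ''time'' i = ti i"
      using readyD[OF r'] i 5(2) by (simp_all add: tail_e_def head_e_def)
    note lt = edge_props(1,2)[OF i]
    have "ram_val (lab_at next_t tail_e) s' = lab (Suc t) (ta i)"
      by (rule ram_val_lab_at[OF r' _ ends(1)]) (use s' v lt in \<open>auto simp: next_t_def\<close>)
    moreover have "ram_val (mem next_t u (V ''y'')) s' = of_bool (bit y (rank (Suc t) u'))"
      if "ram_val u s' = u'" "u' < n" for u u'
      by (rule ram_val_mem[OF r' _ that(1)]) (use s' v that in \<open>auto simp: next_t_def\<close>)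
    moreover have "ram_val (mem (V ''t'') u (V ''x'')) s' = of_bool (bit x (rank t u'))"
      if "ram_val u s' = u'" "u' < n" for u u'
      by (rule ram_val_mem[OF r' _ that(1)]) (use s' v that in auto)
    ultimately show ?case using 5(2,4) s' ends lt unfolding card_less_Suc_if by (auto simp: next_t_def)
  qed (use s in auto)
  moreover have "{e. e < m \<and> ?P e} = cut (Suc t) (dec t a x \<inter> cls (Suc t) b) (dec (Suc t) b y)"
  proof -
    have "?P e \<longleftrightarrow> ti e = Suc t \<and> (ta e \<in> dec t a x \<inter> cls (Suc t) b \<and> he e \<notin> dec (Suc t) b y \<or>
       he e \<in> dec t a x \<inter> cls (Suc t) b \<and> ta e \<notin> dec (Suc t) b y)" (is "_ \<longleftrightarrow> ?Q") if e: "e < m" for e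
    proof (cases "active e (Suc t)")
      case True
      have same: "lab (Suc t) (ta e) = lab (Suc t) (he e)" by (rule lab_active[OF e True])
      have "lab t u = a" if "u < n" "lab (Suc t) u = b" for u
        using cls_child[OF v(1,4)] that by (auto simp: cls_def)
      then show ?thesis using same edge_props(1,2)[OF e] by (auto simp: dec_def cls_def)
    next
      case False
      \<comment> \<open>Codes contain only vertices reached by time \<open>t\<close>. An inactive
        edge of time \<open>Suc t\<close> has no such end, so neither side counts it.\<close>
      have "\<not> bit x (rank t u)" if "u < n" "\<not> arr u < Suc t" for u
        using dec_arrived[of t x "lab t u"] v that by (auto simp: dec_def cls_def arrived_def)
      then show ?thesis using False edge_props(1,2)[OF e] by (auto simp: active_def dec_def)
    qed
    then show ?thesis unfolding cut_def by blast
  qed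
  ultimately show ?thesis using readyD[OF r] by simp
qed

definition entry :: "ram_state \<Rightarrow> nat \<Rightarrow> nat \<Rightarrow> nat \<Rightarrow> nat \<Rightarrow> nat \<Rightarrow> nat" where
  "entry s t a x b c = s ''T'' (index t a x b c)"

text \<open>An entry is specified by the budgets it meets rather than as a minimum, which avoids
  infinite values. Nothing is said beyond \<open>h\<close>, since entries are capped at
  \<open>h + 1\<close>.\<close>

definition good where
  "good h s t a x b c \<longleftrightarrow> (\<forall>q\<le>h. entry s t a x b c \<le> q \<longleftrightarrow>
     spread (L - t) (below t a b) (dec t a x \<inter> below t a b) c q)"

lemma run_split:
  assumes r: "ready h s" and s: "s ''t'' 0 = t" "s ''a'' 0 = a" "s ''x'' 0 = x" "s ''b'' 0 = b" "s ''c'' 0 = c" "s ''y'' 0 = y"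
    and v: "t < L" "a < n" "x < 2 ^ bits" "b < n" "c \<le> n" "y < 2 ^ bits"
  shows "run p_split s ''best'' 0 \<le> q \<longleftrightarrow> s ''best'' 0 \<le> q \<or>
    (\<exists>c1. c1 + s ''new'' 0 \<le> c \<and>
       entry s t a x b c1 + s ''cost'' 0 + entry s (Suc t) b y n (c - (c1 + s ''new'' 0)) \<le> q)"
proof -
  let ?P = "\<lambda>c1. c1 + s ''new'' 0 \<le> c \<and>
       entry s t a x b c1 + s ''cost'' 0 + entry s (Suc t) b y n (c - (c1 + s ''new'' 0)) \<le> q"
  have "run p_split s ''best'' 0 \<le> q \<longleftrightarrow> s ''best'' 0 \<le> q \<or> (\<exists>c1<s ''n1'' 0. ?P c1)"
    unfolding p_split_def
  proof (rule run_For_induct[where I = "\<lambda>i s'. s' ''best'' 0 \<le> q \<longleftrightarrow> s ''best'' 0 \<le> q \<or> (\<exists>c1<i. ?P c1)"], goal_cases)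
    case (5 i s')
    have r': "ready h s'"
      by (rule ready_frame[OF r, of "''c1''" "{''val'', ''best''}"]) (simp_all add: static_def 5(3))
    have s': "s' ''t'' 0 = t" "s' ''a'' 0 = a" "s' ''x'' 0 = x" "s' ''b'' 0 = b" "s' ''c'' 0 = c" "s' ''y'' 0 = y"
      "s' ''new'' = s ''new''" "s' ''cost'' = s ''cost''" "s' ''T'' = s ''T''"
      using 5(3) s by simp_all
    have i: "i \<le> n" using 5(1) readyD[OF r] by simp
    have 1: "ram_val (table_index (V ''t'') (V ''a'') (V ''x'') (V ''b'') (V ''c1'')) s' = index t a x b i"
      by (rule ram_val_table_index[OF r']) (use s' 5(2) v i in \<open>auto simp: valid_def\<close>)
    have 2: "ram_val (table_index next_t (V ''b'') (V ''y'') (V ''n'') (Sub (V ''c'') (Add (V ''c1'') (V ''new'')))) s'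
        = index (Suc t) b y n (c - (i + s ''new'' 0))"
      by (rule ram_val_table_index[OF r']) (use s' 5(2) v i readyD[OF r'] in \<open>auto simp: valid_def next_t_def\<close>)
    show ?case
    proof (cases "i + s ''new'' 0 \<le> c")
      case True
      then show ?thesis using 5(2,4) s' 1 2 by (auto simp: entry_def less_Suc_eq not_less)
    next
      case False
      then show ?thesis using 5(2,4) s' by (auto simp: less_Suc_eq)
    qed
  qed (use s in auto)
  moreover have "c1 < Suc n" if "?P c1" for c1 using v(5) that by linarith
  then have "(\<exists>c1<Suc n. ?P c1) \<longleftrightarrow> (\<exists>c1. ?P c1)" by blast
  ultimately show ?thesis unfolding readyD(5)[OF r] by blast
qed

lemma good_cong: "s' ''T'' = s ''T'' \<Longrightarrow> good h s' t a x b c = good h s t a x b c"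
  by (simp add: good_def entry_def)

text \<open>The part of the recurrence \<open>spread_below_child\<close> that concerns a fixed code
  \<open>y\<close>.\<close>

definition extends where
  "extends t a x b c y q \<longleftrightarrow> dec t a x \<inter> cls (Suc t) b \<subseteq> dec (Suc t) b y \<and>
      (\<exists>c1 q1 q2. c1 + card (dec (Suc t) b y - dec t a x \<inter> cls (Suc t) b) \<le> c \<and>
        q1 + card (cut (Suc t) (dec t a x \<inter> cls (Suc t) b) (dec (Suc t) b y)) + q2 \<le> q \<and>
        spread (L - t) (below t a b) (dec t a x \<inter> below t a b) c1 q1 \<and>
        spread (L - Suc t) (cls (Suc t) b) (dec (Suc t) b y)
          (c - (c1 + card (dec (Suc t) b y - dec t a x \<inter> cls (Suc t) b))) q2)"

lemma run_code:
  assumes r: "ready h s" and s: "s ''t'' 0 = t" "s ''a'' 0 = a" "s ''x'' 0 = x" "s ''b'' 0 = b" "s ''c'' 0 = c" "s ''y'' 0 = y"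
    and v: "t < L" "a < n" "x < 2 ^ bits" "b < n" "c \<le> n" "y < 2 ^ bits" "child t a b"
    and g: "\<And>c. c \<le> n \<Longrightarrow> good h s t a x b c" "\<And>c. c \<le> n \<Longrightarrow> good h s (Suc t) b y n c"
    and q: "q \<le> h"
  shows "run p_code s ''best'' 0 \<le> q \<longleftrightarrow> s ''best'' 0 \<le> q \<or> extends t a x b c y q"
proof -
  define s1 where "s1 = run (Set ''ok'' (Const 1) ;; Set ''new'' (Const 0) ;; Set ''cost'' (Const 0)) s"
  define s2 where "s2 = run p_vertices s1"
  define s3 where "s3 = run p_edges s2"
  let ?X = "dec t a x \<inter> cls (Suc t) b" and ?Y = "dec (Suc t) b y"
  have r1: "ready h s1" unfolding s1_def by (rule ready_run[OF r]) (simp add: static_def)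
  have r2: "ready h s2" unfolding s2_def by (rule ready_run[OF r1]) (simp add: static_def)
  have r3: "ready h s3" unfolding s3_def by (rule ready_run[OF r2]) (simp add: static_def)
  have s1: "s1 ''t'' 0 = t" "s1 ''b'' 0 = b" "s1 ''x'' 0 = x" "s1 ''y'' 0 = y" "s1 ''ok'' 0 = 1" "s1 ''new'' 0 = 0"
    "s1 ''cost'' 0 = 0" using s by (simp_all add: s1_def)
  have s2: "s2 ''t'' 0 = t" "s2 ''b'' 0 = b" "s2 ''x'' 0 = x" "s2 ''y'' 0 = y" "s2 ''cost'' 0 = 0"
    using s1 by (simp_all add: s2_def run_frame)
  have ok: "s3 ''ok'' 0 = of_bool (?X \<subseteq> ?Y)" and new: "s3 ''new'' 0 = card (?Y - ?X)"
    using run_vertices[OF r1 s1(1-6) v(1,3,6,7)] by (simp_all add: s3_def s2_def run_frame)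
  have cost: "s3 ''cost'' 0 = card (cut (Suc t) ?X ?Y)"
    using run_edges[OF r2 s2 v(1,3,6,7)] by (simp add: s3_def)
  have s3: "s3 ''t'' 0 = t" "s3 ''a'' 0 = a" "s3 ''x'' 0 = x" "s3 ''b'' 0 = b" "s3 ''c'' 0 = c" "s3 ''y'' 0 = y"
    "s3 ''T'' = s ''T''" "s3 ''best'' = s ''best''"
    using s by (simp_all add: s3_def s2_def s1_def run_frame)
  have run: "run p_code s = (if ?X \<subseteq> ?Y then run p_split s3 else s3)"
    using ok by (simp add: p_code_def s1_def s2_def s3_def)
  have e1: "entry s3 t a x b c' \<le> q' \<longleftrightarrow> spread (L - t) (below t a b) (dec t a x \<inter> below t a b) c' q'"
    if "c' \<le> n" "q' \<le> h" for c' q'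
    using g(1)[OF that(1)] that(2) s3(7) by (simp add: good_def entry_def)
  have "?Y \<inter> cls (Suc t) b = ?Y" by (auto simp: dec_def)
  then have e2: "entry s3 (Suc t) b y n c' \<le> q' \<longleftrightarrow> spread (L - Suc t) (cls (Suc t) b) ?Y c' q'"
    if "c' \<le> n" "q' \<le> h" for c' q'
    using g(2)[OF that(1)] that(2) s3(7) by (simp add: good_def entry_def below_n)
  show ?thesis
  proof (cases "?X \<subseteq> ?Y")
    case False
    then show ?thesis using run s3(8) by (simp add: extends_def)
  next
    case True
    have "(\<exists>c1. c1 + card (?Y - ?X) \<le> c \<and>
       entry s3 t a x b c1 + card (cut (Suc t) ?X ?Y) + entry s3 (Suc t) b y n (c - (c1 + card (?Y - ?X))) \<le> q)
       \<longleftrightarrow> extends t a x b c y q" (is "(\<exists>c1. ?A c1) \<longleftrightarrow> _")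
    proof
      assume "\<exists>c1. ?A c1"
      then obtain c1 where c1: "?A c1" by blast
      \<comment> \<open>The entries themselves serve as \<open>q1\<close> and \<open>q2\<close>;
        being at most \<open>q\<close>, hence at most \<open>h\<close>, they lie in the range where
        \<open>good\<close> speaks.\<close>
      have "spread (L - t) (below t a b) (dec t a x \<inter> below t a b) c1 (entry s3 t a x b c1)"
        using e1[of c1 "entry s3 t a x b c1"] c1 v(5) q by linarith
      moreover have "spread (L - Suc t) (cls (Suc t) b) ?Y (c - (c1 + card (?Y - ?X)))
          (entry s3 (Suc t) b y n (c - (c1 + card (?Y - ?X))))"
        using e2[of "c - (c1 + card (?Y - ?X))" "entry s3 (Suc t) b y n (c - (c1 + card (?Y - ?X)))"] c1 v(5) q by linarith
      ultimately show "extends t a x b c y q" unfolding extends_def using True c1 by blast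
    next
      assume "extends t a x b c y q"
      then obtain c1 q1 q2 where e: "c1 + card (?Y - ?X) \<le> c" "q1 + card (cut (Suc t) ?X ?Y) + q2 \<le> q"
        "spread (L - t) (below t a b) (dec t a x \<inter> below t a b) c1 q1"
        "spread (L - Suc t) (cls (Suc t) b) ?Y (c - (c1 + card (?Y - ?X))) q2"
        unfolding extends_def by blast
      have "entry s3 t a x b c1 \<le> q1" using e1[of c1 q1] e v(5) q by simp
      moreover have "entry s3 (Suc t) b y n (c - (c1 + card (?Y - ?X))) \<le> q2"
        using e2[of "c - (c1 + card (?Y - ?X))" q2] e v(5) q by simp
      ultimately have "?A c1" using e(1,2) by simp
      then show "\<exists>c1. ?A c1" by blast
    qed
    then show ?thesis
      using run_split[OF r3 s3(1-6) v(1-6), of q] run True s3(8) new cost by simp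
  qed
qed

lemma run_best:
  assumes r: "ready h s" and s: "s ''t'' 0 = t" "s ''a'' 0 = a" "s ''x'' 0 = x" "s ''b'' 0 = b" "s ''c'' 0 = c"
    and v: "t < L" "a < n" "x < 2 ^ bits" "b < n" "c \<le> n"
    and g: "\<And>c. c \<le> n \<Longrightarrow> good h s t a x b c" "\<And>y c. y < 2 ^ bits \<Longrightarrow> c \<le> n \<Longrightarrow> good h s (Suc t) b y n c"
    and q: "q \<le> h"
  shows "run p_best s ''best'' 0 \<le> q \<longleftrightarrow>
    spread (L - t) (below t a (Suc b)) (dec t a x \<inter> below t a (Suc b)) c q"
proof -
  have "ram_val (lab_at next_t (V ''b'')) s = lab (Suc t) b"
    by (rule ram_val_lab_at[OF r]) (use s v in \<open>auto simp: next_t_def\<close>)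
  moreover have "ram_val (lab_at (V ''t'') (V ''b'')) s = lab t b"
    by (rule ram_val_lab_at[OF r]) (use s v in auto)
  ultimately have test: "ram_val (And (Eq (lab_at next_t (V ''b'')) (V ''b'')) (Eq (lab_at (V ''t'') (V ''b'')) (V ''a''))) s
      = of_bool (child t a b)"
    using s by (simp add: child_def)
  show ?thesis
  proof (cases "child t a b")
    case False
    have "ram_val (table_index (V ''t'') (V ''a'') (V ''x'') (V ''b'') (V ''c'')) s = index t a x b c"
      by (rule ram_val_table_index[OF r]) (use s v in \<open>auto simp: valid_def\<close>)
    then have "run p_best s ''best'' 0 = entry s t a x b c"
      using False test by (simp add: p_best_def entry_def)
    then show ?thesis using g(1)[OF v(5)] q below_not_child[OF v(1) False] by (simp add: good_def)
  next
    case True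
    define s1 where "s1 = run (Set ''best'' (Add (V ''h'') (Const 1))) s"
    have r1: "ready h s1" unfolding s1_def by (rule ready_run[OF r]) (simp add: static_def)
    have "run (For ''y'' ''K'' p_code) s1 ''best'' 0 \<le> q \<longleftrightarrow> (\<exists>y<s1 ''K'' 0. extends t a x b c y q)"
    proof (rule run_For_induct[where I = "\<lambda>i s. s ''best'' 0 \<le> q \<longleftrightarrow> (\<exists>y<i. extends t a x b c y q)"], goal_cases)
      case (5 i s')
      have r': "ready h s'"
        by (rule ready_frame[OF r1, of "''y''" "writes p_code"]) (simp_all add: static_def 5(3))
      have s': "s' ''t'' 0 = t" "s' ''a'' 0 = a" "s' ''x'' 0 = x" "s' ''b'' 0 = b" "s' ''c'' 0 = c" "s' ''T'' = s ''T''"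
        using 5(3) s by (simp_all add: s1_def)
      have i: "i < 2 ^ bits" using 5(1) readyD[OF r1] by simp
      have g': "good h s' t a x b c" if "c \<le> n" for c
        using g(1)[OF that] good_cong[of s' s, OF s'(6)] by simp
      have g'': "good h s' (Suc t) b i n c" if "c \<le> n" for c
        using g(2)[OF i that] good_cong[of s' s, OF s'(6)] by simp
      have "run p_code s' ''best'' 0 \<le> q \<longleftrightarrow> s' ''best'' 0 \<le> q \<or> extends t a x b c i q"
        by (rule run_code[OF r' s'(1-5) 5(2) v i True g' g'' q])
      then show ?case using 5(4) by (auto simp: less_Suc_eq)
    qed (use q readyD[OF r] in \<open>auto simp: s1_def\<close>)
    moreover have "run p_best s = run (For ''y'' ''K'' p_code) s1"
      using True test by (simp add: p_best_def s1_def)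
    ultimately show ?thesis
      using spread_below_child[OF v(1) True v(3), of c q] readyD[OF r1] by (simp add: extends_def)
  qed
qed

text \<open>Validity of the indices is recorded because \<open>index_inj\<close> needs it: storing a
  new entry then leaves the others unchanged.\<close>

definition all_good where
  "all_good h C s \<longleftrightarrow> (\<forall>(t, a, x, b, c)\<in>C. valid t a x b c \<and> good h s t a x b c)"

text \<open>These are the entries read while column \<open>Suc b\<close> of time \<open>t\<close> is
  computed: the previous column, and the last column of class \<open>b\<close> at the next time,
  where all its children are included.\<close>

definition prepared where
  "prepared t b C \<longleftrightarrow> t < L \<and> b < n \<and>
     (\<forall>a<n. \<forall>x<2 ^ bits. \<forall>c\<le>n. (t, a, x, b, c) \<in> C \<and> (Suc t, b, x, n, c) \<in> C)"

lemma prepared_Un: "prepared t b C \<Longrightarrow> prepared t b (C \<union> D)"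
  by (simp add: prepared_def)

lemma all_good_upd: "y \<noteq> ''T'' \<Longrightarrow> all_good h C (upd y i k s) = all_good h C s"
  by (simp add: all_good_def good_def entry_def)

section \<open>Filling the table column by column\<close>

lemma run_cell:
  assumes r: "ready h s" and s: "s ''t'' 0 = t" "s ''a'' 0 = a" "s ''x'' 0 = x" "s ''b'' 0 = b" "s ''c'' 0 = c"
    and v: "a < n" "x < 2 ^ bits" "c \<le> n" and C: "all_good h C s" "prepared t b C"
  shows "all_good h (insert (t, a, x, Suc b, c) C) (run p_cell s)"
proof -
  have tb: "t < L" "b < n" using C(2) by (auto simp: prepared_def)
  have g: "good h s t a x b c" "good h s (Suc t) b y n c" if "c \<le> n" "y < 2 ^ bits" for y c
    using C that v unfolding prepared_def all_good_def by fast+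
  define s1 where "s1 = run p_best s"
  have r1: "ready h s1" unfolding s1_def by (rule ready_run[OF r]) (simp add: static_def)
  have s1: "s1 ''t'' 0 = t" "s1 ''a'' 0 = a" "s1 ''x'' 0 = x" "s1 ''b'' 0 = b" "s1 ''c'' 0 = c" "s1 ''T'' = s ''T''"
    using s by (simp_all add: s1_def run_frame)
  have best: "s1 ''best'' 0 \<le> q \<longleftrightarrow> spread (L - t) (below t a (Suc b)) (dec t a x \<inter> below t a (Suc b)) c q"
    if "q \<le> h" for q
    unfolding s1_def by (rule run_best[OF r s tb(1) v(1,2) tb(2) v(3)]) (use g v that in auto)
  have val: "valid t a x (Suc b) c" using v tb by (simp add: valid_def)
  have "ram_val (table_index (V ''t'') (V ''a'') (V ''x'') (Add (V ''b'') (Const 1)) (V ''c'')) s1 = index t a x (Suc b) c"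
    by (rule ram_val_table_index[OF r1 val]) (use s1 in auto)
  then have T: "run p_cell s ''T'' = (s ''T'')(index t a x (Suc b) c := s1 ''best'' 0)"
    using s1(6) by (simp add: p_cell_def s1_def)
  have "good h (run p_cell s) t a x (Suc b) c" using best by (simp add: good_def entry_def T)
  moreover have "good h (run p_cell s) t' a' x' b' c'"
    if "(t', a', x', b', c') \<in> C" "(t', a', x', b', c') \<noteq> (t, a, x, Suc b, c)" for t' a' x' b' c'
  proof -
    have "valid t' a' x' b' c'" "good h s t' a' x' b' c'" using C(1) that(1) unfolding all_good_def by fast+
    moreover from this have "index t' a' x' b' c' \<noteq> index t a x (Suc b) c"
      using index_inj[of t' a' x' b' c' t a x "Suc b" c] val that(2) by auto
    ultimately show ?thesis by (simp add: good_def entry_def T)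
  qed
  ultimately show ?thesis using C(1) val unfolding all_good_def by fastforce
qed

lemma run_loop_c:
  assumes r: "ready h s" and s: "s ''t'' 0 = t" "s ''a'' 0 = a" "s ''x'' 0 = x" "s ''b'' 0 = b"
    and v: "a < n" "x < 2 ^ bits" and C: "all_good h C s" "prepared t b C"
  shows "all_good h (C \<union> {t} \<times> {a} \<times> {x} \<times> {Suc b} \<times> {..n}) (run p_loop_c s)"
proof -
  have "all_good h (C \<union> {t} \<times> {a} \<times> {x} \<times> {Suc b} \<times> {..<s ''n1'' 0}) (run p_loop_c s)"
    unfolding p_loop_c_def
  proof (rule run_For_induct[where I = "\<lambda>i s. all_good h (C \<union> {t} \<times> {a} \<times> {x} \<times> {Suc b} \<times> {..<i}) s"], goal_cases)
    case (5 i s')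
    have r': "ready h s'" by (rule ready_frame[OF r, of "''c''" "writes p_cell"]) (simp_all add: static_def 5(3))
    have s': "s' ''t'' 0 = t" "s' ''a'' 0 = a" "s' ''x'' 0 = x" "s' ''b'' 0 = b" using 5(3) s by simp_all
    have i: "i \<le> n" using 5(1) readyD[OF r] by simp
    have "C \<union> {t} \<times> {a} \<times> {x} \<times> {Suc b} \<times> {..<Suc i} =
        insert (t, a, x, Suc b, i) (C \<union> {t} \<times> {a} \<times> {x} \<times> {Suc b} \<times> {..<i})" by auto
    then show ?case
      using run_cell[OF r' s' 5(2) v i 5(4) prepared_Un[OF C(2)]] by (simp add: all_good_upd)
  qed (use C(1) in \<open>auto simp: all_good_upd\<close>)
  then show ?thesis using readyD[OF r] by (simp add: lessThan_Suc_atMost)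
qed

lemma run_loop_x:
  assumes r: "ready h s" and s: "s ''t'' 0 = t" "s ''a'' 0 = a" "s ''b'' 0 = b"
    and v: "a < n" and C: "all_good h C s" "prepared t b C"
  shows "all_good h (C \<union> {t} \<times> {a} \<times> {..<2 ^ bits} \<times> {Suc b} \<times> {..n}) (run p_loop_x s)"
proof -
  have "all_good h (C \<union> {t} \<times> {a} \<times> {..<s ''K'' 0} \<times> {Suc b} \<times> {..n}) (run p_loop_x s)"
    unfolding p_loop_x_def
  proof (rule run_For_induct[where I = "\<lambda>i s. all_good h (C \<union> {t} \<times> {a} \<times> {..<i} \<times> {Suc b} \<times> {..n}) s"], goal_cases)
    case (5 i s')
    have r': "ready h s'" by (rule ready_frame[OF r, of "''x''" "writes p_loop_c"]) (simp_all add: static_def 5(3))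
    have s': "s' ''t'' 0 = t" "s' ''a'' 0 = a" "s' ''b'' 0 = b" using 5(3) s by simp_all
    have i: "i < 2 ^ bits" using 5(1) readyD[OF r] by simp
    have "C \<union> {t} \<times> {a} \<times> {..<Suc i} \<times> {Suc b} \<times> {..n} =
        (C \<union> {t} \<times> {a} \<times> {..<i} \<times> {Suc b} \<times> {..n}) \<union> {t} \<times> {a} \<times> {i} \<times> {Suc b} \<times> {..n}" by auto
    then show ?case
      using run_loop_c[OF r' s'(1,2) 5(2) s'(3) v i 5(4) prepared_Un[OF C(2)]] by (simp add: all_good_upd)
  qed (use C(1) in \<open>auto simp: all_good_upd\<close>)
  then show ?thesis using readyD[OF r] by simp
qed

lemma run_loop_a:
  assumes r: "ready h s" and s: "s ''t'' 0 = t" "s ''b'' 0 = b"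
    and C: "all_good h C s" "prepared t b C"
  shows "all_good h (C \<union> {t} \<times> {..<n} \<times> {..<2 ^ bits} \<times> {Suc b} \<times> {..n}) (run p_loop_a s)"
proof -
  have "all_good h (C \<union> {t} \<times> {..<s ''n'' 0} \<times> {..<2 ^ bits} \<times> {Suc b} \<times> {..n}) (run p_loop_a s)"
    unfolding p_loop_a_def
  proof (rule run_For_induct[where I = "\<lambda>i s. all_good h (C \<union> {t} \<times> {..<i} \<times> {..<2 ^ bits} \<times> {Suc b} \<times> {..n}) s"], goal_cases)
    case (5 i s')
    have r': "ready h s'" by (rule ready_frame[OF r, of "''a''" "writes p_loop_x"]) (simp_all add: static_def 5(3))
    have s': "s' ''t'' 0 = t" "s' ''b'' 0 = b" using 5(3) s by simp_all
    have i: "i < n" using 5(1) readyD[OF r] by simp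
    have "C \<union> {t} \<times> {..<Suc i} \<times> {..<2 ^ bits} \<times> {Suc b} \<times> {..n} =
        (C \<union> {t} \<times> {..<i} \<times> {..<2 ^ bits} \<times> {Suc b} \<times> {..n}) \<union> {t} \<times> {i} \<times> {..<2 ^ bits} \<times> {Suc b} \<times> {..n}" by auto
    then show ?case
      using run_loop_x[OF r' s'(1) 5(2) s'(2) i 5(4) prepared_Un[OF C(2)]] by (simp add: all_good_upd)
  qed (use C(1) in \<open>auto simp: all_good_upd\<close>)
  then show ?thesis using readyD[OF r] by simp
qed

lemma run_loop_b:
  assumes r: "ready h s" and t: "s ''t'' 0 = t" "t < L" and C: "all_good h C s"
    "{t} \<times> {..<n} \<times> {..<2 ^ bits} \<times> {0} \<times> {..n} \<subseteq> C" "{Suc t} \<times> {..<n} \<times> {..<2 ^ bits} \<times> {n} \<times> {..n} \<subseteq> C"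
  shows "all_good h (C \<union> {t} \<times> {..<n} \<times> {..<2 ^ bits} \<times> {1..n} \<times> {..n}) (run p_loop_b s)"
proof -
  have "all_good h (C \<union> {t} \<times> {..<n} \<times> {..<2 ^ bits} \<times> {1..s ''n'' 0} \<times> {..n}) (run p_loop_b s)"
    unfolding p_loop_b_def
  proof (rule run_For_induct[where I = "\<lambda>i s. all_good h (C \<union> {t} \<times> {..<n} \<times> {..<2 ^ bits} \<times> {1..i} \<times> {..n}) s"], goal_cases)
    case (5 i s')
    have r': "ready h s'" by (rule ready_frame[OF r, of "''b''" "writes p_loop_a"]) (simp_all add: static_def 5(3))
    have s': "s' ''t'' 0 = t" using 5(3) t by simp_all
    have i: "i < n" using 5(1) readyD[OF r] by simp
    \<comment> \<open>For \<open>i = 0\<close> the previous column comes from \<open>C\<close>;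
      afterwards it is the one just filled.\<close>
    have "prepared t i (C \<union> {t} \<times> {..<n} \<times> {..<2 ^ bits} \<times> {1..i} \<times> {..n})"
      unfolding prepared_def using t(2) i C(2,3) by (cases "i = 0") auto
    moreover have "C \<union> {t} \<times> {..<n} \<times> {..<2 ^ bits} \<times> {1..Suc i} \<times> {..n} =
        (C \<union> {t} \<times> {..<n} \<times> {..<2 ^ bits} \<times> {1..i} \<times> {..n}) \<union> {t} \<times> {..<n} \<times> {..<2 ^ bits} \<times> {Suc i} \<times> {..n}"
      by (auto simp: le_Suc_eq)
    ultimately show ?case
      using run_loop_a[OF r' s'(1) 5(2) 5(4)] by (simp add: all_good_upd)
  qed (use C(1) in \<open>auto simp: all_good_upd\<close>)
  then show ?thesis using readyD[OF r] by simp
qed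

lemma run_table:
  assumes r: "ready h s" and T: "s ''T'' = (\<lambda>_. 0)"
  shows "all_good h {(t, a, x, b, c). valid t a x b c} (run p_table s)"
proof -
  \<comment> \<open>After \<open>i\<close> rounds all times from \<open>L - i\<close> on are
    complete, and column 0 is so from the start.\<close>
  let ?C = "\<lambda>i. {(t, a, x, b, c). valid t a x b c \<and> (L \<le> t + i \<or> b = 0)}"
  have start: "all_good h (?C 0) s'" if "s' ''T'' = (\<lambda>_. 0)" for s'
  proof -
    have "good h s' t a x b c" if "valid t a x b c" "L \<le> t \<or> b = 0" for t a x b c
    proof -
      \<comment> \<open>Zero is the correct value: no step is left at time \<open>L\<close>, and
        without children the empty set stays empty at no cost.\<close>
      have "spread (L - t) (below t a b) (dec t a x \<inter> below t a b) c q" for q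
      proof (cases "L \<le> t")
        case False
        then have "below t a b = {}" using that by simp
        moreover have "spread d {} {} c q" for d 
        proof (induction d)
          case (Suc d)
          then show ?case unfolding spread.simps
            by (intro exI[of _ "{}"] exI[of _ c] exI[of _ q]) (simp add: cut_def)
        qed simp
        ultimately show ?thesis by simp
      qed simp
      then show ?thesis using \<open>s' ''T'' = (\<lambda>_. 0)\<close> by (simp add: good_def entry_def)
    qed
    then show ?thesis by (auto simp: all_good_def)
  qed
  have "all_good h (?C (s ''L'' 0)) (run p_table s)"
    unfolding p_table_def
  proof (rule run_For_induct[where I = "\<lambda>i. all_good h (?C i)"], goal_cases)
    case (5 i s')
    have r': "ready h s'"
      by (rule ready_frame[OF r, of "''d''" "insert ''t'' (writes p_loop_b)"]) (simp_all add: static_def 5(3))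
    define s1 where "s1 = run (Set ''t'' (Sub (V ''L'') (Add (V ''d'') (Const 1)))) s'"
    have r1: "ready h s1" unfolding s1_def by (rule ready_run[OF r']) (simp add: static_def)
    have i: "i < L" using 5(1) readyD[OF r] by simp
    let ?t = "L - Suc i"
    have t: "s1 ''t'' 0 = ?t" using 5(2) readyD[OF r'] by (simp add: s1_def)
    have g1: "all_good h (?C i) s1" using 5(4) by (simp add: s1_def all_good_upd)
    have "all_good h (?C i \<union> {?t} \<times> {..<n} \<times> {..<2 ^ bits} \<times> {1..n} \<times> {..n}) (run p_loop_b s1)"
      by (rule run_loop_b[OF r1 t _ g1]) (use i in \<open>auto simp: valid_def\<close>)
    moreover have "?C (Suc i) \<subseteq> ?C i \<union> {?t} \<times> {..<n} \<times> {..<2 ^ bits} \<times> {1..n} \<times> {..n}"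
      using i by (auto simp: valid_def)
    ultimately have "all_good h (?C (Suc i)) (run p_loop_b s1)" unfolding all_good_def by blast
    then show ?case by (simp add: s1_def all_good_upd)
  qed (use start T in \<open>auto simp: p_loop_b_def\<close>)
  moreover have "?C (s ''L'' 0) = {(t, a, x, b, c). valid t a x b c}" using readyD[OF r] by auto
  ultimately show ?thesis by simp
qed

text \<open>Only vertices of \<open>Z - X\<close> can ever be added, so a vertex budget beyond their
  number changes nothing. This allows capping the budget at \<open>n\<close>.\<close>

lemma spread_saturate: "spread d Z X c q \<Longrightarrow> finite Z \<Longrightarrow> spread d Z X (card (Z - X)) q"
proof (induction d arbitrary: X c q)
  case (Suc d)
  then obtain Y c' q' where Y: "X \<subseteq> Y" "Y \<subseteq> Z \<inter> arrived (L - d)" "card (cut (L - d) X Y) + q' \<le> q"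
    "spread d Z Y c' q'" by auto
  have "Z - X = (Y - X) \<union> (Z - Y)" using Y by blast
  moreover have "card ((Y - X) \<union> (Z - Y)) = card (Y - X) + card (Z - Y)"
    using Y Suc.prems(2) by (intro card_Un_disjoint) (auto intro: finite_subset)
  ultimately have "card (Y - X) + card (Z - Y) \<le> card (Z - X)" by (metis order_refl)
  then show ?case unfolding spread.simps using Y Suc.IH[OF Y(4) Suc.prems(2)] by blast
qed simp

lemma run_out:
  assumes r: "ready h s" and g: "all_good h {(t, a, x, b, c). valid t a x b c} s" and "0 < s ''r'' 0"
  shows "run p_out s ''out'' 0 = of_bool (spread L {..<n} {src} (s ''r'' 0 - 1) h)"
proof -
  let ?c = "min n (s ''r'' 0 - 1)"
  have v: "valid 0 0 1 n ?c" using src one_less_power[of "2 :: nat" bits] bits_pos by (simp add: valid_def)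
  have idx: "ram_val (table_index (Const 0) (Const 0) (Const 1) (V ''n'') (Sub (V ''n'') (Sub (V ''n'') (Sub (V ''r'') (Const 1))))) s
      = index 0 0 1 n ?c"
    by (rule ram_val_table_index[OF r v]) (use readyD[OF r] in auto)
  have "cls 0 0 = {..<n}" by (auto simp: cls_def lab_def)
  \<comment> \<open>The source is the only vertex reached at time 0, so its rank is 0. All others
    have rank \<open>n\<close>, which is positive, while the number 1 has only bit 0.\<close>
  moreover have "dec 0 0 1 = {src}"
  proof -
    have "bit (1::nat) (rank 0 v) \<longleftrightarrow> v = src" if "v < n" for v
    proof (cases "v = src")
      case True
      have "{w. w < src \<and> arr w \<le> 0 \<and> lab 0 w = lab 0 src} = {}" by (auto simp: arr_eq_0)
      moreover have "arr src \<le> 0" by (simp add: arr_eq_0)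
      ultimately have "rank 0 src = 0" unfolding rank_def by (simp only: card.empty if_True)
      then show ?thesis using True by (simp add: bit_0)
    next
      case False
      then have "rank 0 v = n" using arr_eq_0 by (intro rank_late) auto
      then show ?thesis using False that bit_high[of 1 1 n] by simp
    qed
    then show ?thesis using src by (auto simp: dec_def \<open>cls 0 0 = {..<n}\<close>)
  qed
  ultimately have "good h s 0 0 1 n ?c \<longleftrightarrow> (\<forall>q\<le>h. entry s 0 0 1 n ?c \<le> q \<longleftrightarrow> spread L {..<n} {src} ?c q)"
    using src by (simp add: good_def below_n)
  moreover have "good h s 0 0 1 n ?c" using g v by (auto simp: all_good_def)
  ultimately have e: "entry s 0 0 1 n ?c \<le> h \<longleftrightarrow> spread L {..<n} {src} ?c h" by blast
  have "spread L {..<n} {src} (s ''r'' 0 - 1) h \<longleftrightarrow> spread L {..<n} {src} ?c h"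
  proof (cases "s ''r'' 0 - 1 \<le> n")
    case False
    then have c: "?c = n" "n \<le> s ''r'' 0 - 1" by simp_all
    have "card ({..<n} - {src}) \<le> n" using src by simp
    then have "spread L {..<n} {src} n h" if "spread L {..<n} {src} c h" for c
      using spread_mono[OF spread_saturate[OF that]] by simp
    then show ?thesis unfolding c(1) using spread_mono[OF _ c(2) order_refl] by blast
  qed simp
  then show ?thesis using e idx readyD[OF r] by (simp add: p_out_def entry_def not_less)
qed

section \<open>Correctness of the index and bit tables\<close>

lemma run_powers:
  assumes "graph_in s" "s ''L'' 0 = L" "s ''k'' 0 = bits"
  shows "run p_powers s ''K'' 0 = 2 ^ bits" "run p_powers s ''N'' 0 = base" "run p_powers s ''n1'' 0 = Suc n"
proof -
  define s1 where "s1 = run (For ''i'' ''k'' (Set ''K'' (Add (V ''K'') (V ''K'')))) (run (Set ''K'' (Const 1)) s)"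
  have "s1 ''K'' 0 = 2 ^ (run (Set ''K'' (Const 1)) s) ''k'' 0"
    unfolding s1_def by (rule run_For_induct[where I = "\<lambda>i s. s ''K'' 0 = 2 ^ i"]) auto
  then have K: "s1 ''K'' 0 = 2 ^ bits" using assms by simp
  have "run p_powers s = run (Set ''N'' (Add (V ''n'') (Add (V ''m'') (Add (V ''L'') (Add (V ''K'') (Add (V ''K'') (Const 2))))))
     ;; Set ''n1'' (Add (V ''n'') (Const 1))) s1"
    by (simp only: p_powers_def s1_def run.simps(3))
  moreover have "s1 ''n'' = s ''n''" "s1 ''m'' = s ''m''" "s1 ''L'' = s ''L''" by (simp_all add: s1_def run_frame)
  ultimately show "run p_powers s ''K'' 0 = 2 ^ bits" "run p_powers s ''N'' 0 = base" "run p_powers s ''n1'' 0 = Suc n"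
    using K assms by (simp_all add: base_def graph_in_def)
qed

lemma run_digits:
  assumes "s ''N'' 0 = base" "s ''M1'' 0 = 0" "s ''M2'' 0 = 0" "s ''M3'' 0 = 0" "s ''M4'' 0 = 0"
  shows "\<forall>i\<le>base. run p_digits s ''M1'' i = i * base \<and> run p_digits s ''M2'' i = i * (base * base) \<and>
        run p_digits s ''M3'' i = i * (base * (base * base)) \<and> run p_digits s ''M4'' i = i * (base * (base * (base * base)))"
proof -
  define s1 where "s1 = run (p_multiples ''M1'' ''N'' (V ''N'')) s"
  define s2 where "s2 = run (Set ''N2'' (Load ''M1'' (V ''N''))) s1"
  define s3 where "s3 = run (p_multiples ''M2'' ''N'' (V ''N2'')) s2"
  define s4 where "s4 = run (Set ''N3'' (Load ''M2'' (V ''N''))) s3"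
  define s5 where "s5 = run (p_multiples ''M3'' ''N'' (V ''N3'')) s4"
  define s6 where "s6 = run (Set ''N4'' (Load ''M3'' (V ''N''))) s5"
  define s7 where "s7 = run (p_multiples ''M4'' ''N'' (V ''N4'')) s6"
  note defs = s1_def s2_def s3_def s4_def s5_def s6_def s7_def
  have N: "s1 ''N'' = s ''N''" "s2 ''N'' = s ''N''" "s3 ''N'' = s ''N''" "s4 ''N'' = s ''N''" "s5 ''N'' = s ''N''" "s6 ''N'' = s ''N''"
    by (simp_all add: defs run_frame)
  have Z: "s2 ''M2'' = s ''M2''" "s4 ''M3'' = s ''M3''" "s6 ''M4'' = s ''M4''" by (simp_all add: defs run_frame)
  have F: "s7 ''M1'' = s1 ''M1''" "s7 ''M2'' = s3 ''M2''" "s7 ''M3'' = s5 ''M3''" by (simp_all add: defs run_frame)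
  have M1: "s1 ''M1'' i = i * base" if "i \<le> base" for i
    unfolding s1_def by (rule run_multiples) (use assms that in auto)
  have N2: "s2 ''N2'' 0 = base * base" using M1[of base] N assms by (simp add: s2_def)
  have M2: "s3 ''M2'' i = i * (base * base)" if "i \<le> base" for i
    unfolding s3_def by (rule run_multiples) (use assms N Z N2 that in auto)
  have N3: "s4 ''N3'' 0 = base * (base * base)" using M2[of base] N assms by (simp add: s4_def)
  have M3: "s5 ''M3'' i = i * (base * (base * base))" if "i \<le> base" for i
    unfolding s5_def by (rule run_multiples) (use assms N Z N3 that in auto)
  have N4: "s6 ''N4'' 0 = base * (base * (base * base))" using M3[of base] N assms by (simp add: s6_def)
  have M4: "s7 ''M4'' i = i * (base * (base * (base * base)))" if "i \<le> base" for i
    unfolding s7_def by (rule run_multiples) (use assms N Z N4 that in auto)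
  have "run p_digits s = s7" by (simp add: p_digits_def defs)
  then show ?thesis using M1 M2 M3 M4 F by simp
qed

lemma bit_row_eq_iff:
  assumes "j \<le> n" "j' \<le> n"
  shows "z * base + j = z' * base + j' \<longleftrightarrow> z = z' \<and> j = j'"
  using digit_eq[of z base j z' j'] assms by (auto simp: base_def)

text \<open>The state while row \<open>x\<close> is being shifted: rows below \<open>2 * x\<close>
  are final, rows \<open>2 * x\<close> and \<open>2 * x + 1\<close> are filled up to column
  \<open>i\<close>, and column 0 of the odd row is still missing.\<close>

definition bit_table where
  "bit_table x i s \<longleftrightarrow> (\<forall>z. \<forall>j\<le>n. s ''bit'' (z * base + j) =
     (if z < 2 * x then of_bool (bit z j)
      else of_bool (z div 2 = x \<and> 0 < j \<and> j \<le> i \<and> bit x (j - 1))))"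

text \<open>A positive \<open>x\<close> is less than \<open>2 * x\<close>, so its row is final when
  it is read. Row 0 is shifted onto itself, which is harmless as it is zero.\<close>

lemma bit_table_read:
  assumes "bit_table x i s" "i \<le> n"
  shows "s ''bit'' (x * base + i) = of_bool (bit x i)"
proof -
  have "s ''bit'' (x * base + i) = (if x < 2 * x then of_bool (bit x i)
      else of_bool (x div 2 = x \<and> 0 < i \<and> i \<le> i \<and> bit x (i - 1)))"
    using assms unfolding bit_table_def by blast
  then show ?thesis by (cases "x = 0") auto
qed

lemma run_bit_row:
  assumes "bit_table x 0 s" "x < 2 ^ bits" "s ''x'' 0 = x" "s ''n'' 0 = n" "\<forall>i\<le>base. s ''M1'' i = i * base"
  shows "bit_table (Suc x) 0 (run p_bit_row s)"
proof -
  have lt: "x \<le> base" "x + x \<le> base" "Suc (x + x) \<le> base" using assms(2) by (auto simp: base_def)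
  let ?p = "Put ''bit'' (Add (Load ''M1'' (Add (V ''x'') (V ''x''))) (Add (V ''i'') (Const 1))) (bit_at (V ''x'') (V ''i'')) ;;
     Put ''bit'' (Add (Load ''M1'' (Add (Add (V ''x'') (V ''x'')) (Const 1))) (Add (V ''i'') (Const 1))) (bit_at (V ''x'') (V ''i''))"
  define s1 where "s1 = run (For ''i'' ''n'' ?p) s"
  have "bit_table x (s ''n'' 0) s1"
    unfolding s1_def
  proof (rule run_For_induct[where I = "bit_table x"], goal_cases)
    case (5 i s')
    have i: "i < n" using 5(1) assms(4) by simp
    have s': "s' ''x'' 0 = x" "s' ''M1'' = s ''M1''" using 5(3) assms(3) by simp_all
    have rd: "s' ''bit'' (x * base + i) = of_bool (bit x i)" using bit_table_read[OF 5(4)] i by simp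
    have ne: "x * base + i \<noteq> (x + x) * base + Suc i"
      using bit_row_eq_iff[of i "Suc i" x "x + x"] i by simp
    have run: "run ?p s' ''bit'' = (s' ''bit'')((x + x) * base + Suc i := of_bool (bit x i), Suc (x + x) * base + Suc i := of_bool (bit x i))"
      using s' rd ne assms(5) lt 5(2) by (simp add: bit_at_def)
    have "run ?p s' ''bit'' (z * base + j) = (if z < 2 * x then of_bool (bit z j)
      else of_bool (z div 2 = x \<and> 0 < j \<and> j \<le> Suc i \<and> bit x (j - 1)))" if j: "j \<le> n" for z j
    proof -
      have old: "s' ''bit'' (z * base + j) = (if z < 2 * x then of_bool (bit z j)
        else of_bool (z div 2 = x \<and> 0 < j \<and> j \<le> i \<and> bit x (j - 1)))"
        using 5(4) j unfolding bit_table_def by blast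
      have eq: "z * base + j = (x + x) * base + Suc i \<longleftrightarrow> z = x + x \<and> j = Suc i"
        "z * base + j = Suc (x + x) * base + Suc i \<longleftrightarrow> z = Suc (x + x) \<and> j = Suc i"
        by (rule bit_row_eq_iff[OF j Suc_leI[OF i]])+
      have z: "z div 2 = x \<longleftrightarrow> z = x + x \<or> z = Suc (x + x)" by presburger
      show ?thesis unfolding run fun_upd_apply eq old using z by (auto simp: le_Suc_eq)
    qed
    then show ?case by (simp add: bit_table_def)
  qed (use assms in \<open>auto simp: bit_table_def bit_at_def\<close>)
  then have t: "bit_table x n s1" using assms(4) by simp
  have s1: "s1 ''x'' 0 = x" "s1 ''M1'' = s ''M1''" using assms(3) by (simp_all add: s1_def run_frame)
  have "run p_bit_row s = run (Put ''bit'' (Load ''M1'' (Add (Add (V ''x'') (V ''x'')) (Const 1))) (Const 1)) s1"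
    by (simp only: p_bit_row_def s1_def run.simps(3))
  then have run: "run p_bit_row s ''bit'' = (s1 ''bit'')(Suc (x + x) * base + 0 := 1)"
    using s1 assms(5) lt by simp
  have "run p_bit_row s ''bit'' (z * base + j) = (if z < 2 * Suc x then of_bool (bit z j)
      else of_bool (z div 2 = Suc x \<and> 0 < j \<and> j \<le> 0 \<and> bit (Suc x) (j - 1)))" if j: "j \<le> n" for z j
  proof -
    have old: "s1 ''bit'' (z * base + j) = (if z < 2 * x then of_bool (bit z j)
        else of_bool (z div 2 = x \<and> 0 < j \<and> j \<le> n \<and> bit x (j - 1)))"
      using t j unfolding bit_table_def by blast
    have eq: "z * base + j = Suc (x + x) * base + 0 \<longleftrightarrow> z = Suc (x + x) \<and> j = 0"
      by (rule bit_row_eq_iff[OF j le0])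
    have b: "bit z j \<longleftrightarrow> (if j = 0 then odd z else bit (z div 2) (j - 1))"
      by (cases j) (simp_all add: bit_0 bit_Suc)
    have z: "z < 2 * Suc x \<longleftrightarrow> z < 2 * x \<or> z div 2 = x" by presburger
    have odd: "z div 2 = x \<Longrightarrow> odd z \<longleftrightarrow> z = Suc (x + x)" by presburger
    have lt: "z < 2 * x \<Longrightarrow> z div 2 \<noteq> x" "z = Suc (x + x) \<Longrightarrow> z div 2 = x" by presburger+
    show ?thesis unfolding run fun_upd_apply eq old
      using z b odd lt j by (cases "z < 2 * x"; cases "z div 2 = x"; cases "j = 0") auto
  qed
  then show ?thesis by (simp add: bit_table_def)
qed

lemma run_bits:
  assumes "s ''K'' 0 = 2 ^ bits" "s ''n'' 0 = n" "\<forall>i\<le>base. s ''M1'' i = i * base" "s ''bit'' = (\<lambda>_. 0)"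
  shows "\<forall>x<2 ^ bits. \<forall>j\<le>n. run p_bits s ''bit'' (x * base + j) = of_bool (bit x j)"
proof -
  have "bit_table (s ''K'' 0) 0 (run p_bits s)"
    unfolding p_bits_def
  proof (rule run_For_induct[where I = "\<lambda>x. bit_table x 0"], goal_cases)
    case (5 x s')
    have "bit_table (Suc x) 0 (run p_bit_row s')"
      by (rule run_bit_row[OF 5(4) _ 5(2)]) (use 5(1,3) assms in simp_all)
    then show ?case by (simp add: bit_table_def)
  qed (use assms in \<open>auto simp: bit_table_def\<close>)
  then show ?thesis using assms(1) by (auto simp: bit_table_def)
qed

end

section \<open>Correctness and running time\<close>

text \<open>\<open>ram_exec_compile\<close> requires loop bounds that the program does not write.
  Therefore each phase computes bounds for the following ones: first \<open>L\<close>, then the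
  number \<open>k\<close> of bits, then \<open>2 ^ k\<close> and the base.\<close>

definition p_classes where
  "p_classes = p_multiples ''tn'' ''L'' (V ''n'') ;; p_arr ;; p_lab ;; p_rank"
definition p_solve where "p_solve = p_digits ;; p_bits ;; p_table ;; p_out"

definition p_main where "p_main = p_lifetime ;; p_classes ;; p_powers ;; p_solve"

lemma writes_phases:
  "writes p_classes = {''i'', ''tn'', ''v'', ''t'', ''e'', ''arr'', ''d'', ''lab'', ''p'', ''q'', ''w'', ''cl'', ''rank'', ''k''}"
  by (auto simp: p_classes_def)

lemmas program_defs = p_main_def p_classes_def p_solve_def p_lifetime_def p_relax_def p_relax_edge_def p_relax_all_def
  p_arr_def p_multiples_def p_merge_def p_merge_all_def p_level_def p_lab_def p_count_def p_rank_vertex_def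
  p_rank_level_def p_rank_def p_powers_def p_digits_def p_bit_row_def p_bits_def p_vertices_def p_edges_def p_split_def
  p_code_def p_best_def p_cell_def p_loop_c_def p_loop_x_def p_loop_a_def p_loop_b_def p_table_def p_out_def

lemma phases_bounds:
  "bounds p_lifetime = {''m''}" "bounds p_classes = {''L'', ''n'', ''m'', ''L1''}" "bounds p_powers = {''k''}"
  "bounds p_solve = {''N'', ''K'', ''n'', ''L'', ''n1'', ''m''}"
  by (auto simp: program_defs)

lemma phases_well_formed:
  "well_formed p_lifetime" "well_formed p_classes" "well_formed p_powers" "well_formed p_solve"
  by (auto simp: program_defs)

lemma phases_disjoint:
  "bounds p_lifetime \<inter> writes p_lifetime = {}" "bounds p_classes \<inter> writes p_classes = {}"
  "bounds p_powers \<inter> writes p_powers = {}" "bounds p_solve \<inter> writes p_solve = {}"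
proof -
  have "writes p_solve \<subseteq> writes p_digits \<union> writes p_bits \<union> writes p_loop_b \<union> {''t'', ''d'', ''out''}"
    by (auto simp: p_solve_def p_table_def p_out_def)
  then show "bounds p_solve \<inter> writes p_solve = {}" by (auto simp: phases_bounds)
qed (simp_all add: phases_bounds writes_phases)

section \<open>Correctness and cost of the whole program\<close>

context edge_list
begin

lemma input_state_props:
  fixes r h
  defines "s \<equiv> input_state n es src r h"
  shows "graph_in s" "s ''h'' 0 = h" "s ''r'' 0 = r"
    "s ''L'' 0 = 0" "s ''tn'' 0 = 0" "s ''lab'' = (\<lambda>_. 0)" "s ''k'' 0 = 0" "s ''bit'' = (\<lambda>_. 0)" "s ''T'' = (\<lambda>_. 0)"
    "s ''M1'' 0 = 0" "s ''M2'' 0 = 0" "s ''M3'' 0 = 0" "s ''M4'' 0 = 0"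
  by (auto simp: s_def input_state_def graph_in_def nth_or_0_def m_def ta_def he_def ti_def split: prod.splits)

lemma run_main:
  fixes r h
  defines "s0 \<equiv> input_state n es src r h"
  assumes r: "0 < r"
  defines "s1 \<equiv> run p_lifetime s0"
  defines "s2 \<equiv> run p_classes s1"
  defines "s3 \<equiv> run p_powers s2"
  shows "run p_solve s3 ''out'' 0 = of_bool (spread L {..<n} {src} (r - 1) h)"
    and "\<forall>y\<in>bounds p_lifetime. s0 y 0 \<le> base" "\<forall>y\<in>bounds p_classes. s1 y 0 \<le> base"
    and "\<forall>y\<in>bounds p_powers. s2 y 0 \<le> base" "\<forall>y\<in>bounds p_solve. s3 y 0 \<le> base"
proof -
  note i = input_state_props[of r h, folded s0_def]
  have f1: "s1 a = s0 a" if "a \<notin> {''e'', ''L'', ''L1''}" for a unfolding s1_def by (rule run_frame) (use that in simp)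
  have g1: "graph_in s1" using i(1) f1 by (simp add: graph_in_def)
  have L1: "s1 ''L'' 0 = L" "s1 ''L1'' 0 = Suc L" using run_lifetime[OF i(1,4)] by (simp_all add: s1_def)
  define a1 where "a1 = run (p_multiples ''tn'' ''L'' (V ''n'')) s1"
  define a2 where "a2 = run p_arr a1"
  define a3 where "a3 = run p_lab a2"
  have a4: "s2 = run p_rank a3" by (simp add: s2_def p_classes_def a1_def a2_def a3_def)
  have fa1: "a1 a = s1 a" if "a \<notin> {''i'', ''tn''}" for a unfolding a1_def by (rule run_frame) (use that in simp)
  have fa2: "a2 a = a1 a" if "a \<notin> {''v'', ''t'', ''e'', ''arr''}" for a unfolding a2_def by (rule run_frame) (use that in simp)
  have fa3: "a3 a = a2 a" if "a \<notin> {''d'', ''t'', ''v'', ''lab'', ''e'', ''p'', ''q'', ''w'', ''cl''}" for a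
    unfolding a3_def by (rule run_frame) (use that in simp)
  have fa4: "s2 a = a3 a" if "a \<notin> {''t'', ''v'', ''rank'', ''k'', ''q'', ''w''}" for a
    unfolding a4 by (rule run_frame) (use that in simp)
  have tn: "\<forall>t\<le>L. a1 ''tn'' t = t * n"
  proof (intro allI impI)
    fix t assume "t \<le> L"
    then show "a1 ''tn'' t = t * n" unfolding a1_def
      by (intro run_multiples) (use g1 L1 f1 i in \<open>auto simp: graph_in_def\<close>)
  qed
  have ga1: "graph_in a1" "a1 ''L'' 0 = L" "a1 ''L1'' 0 = Suc L" using g1 L1 fa1 by (simp_all add: graph_in_def)
  have arr2: "\<forall>v<n. a2 ''arr'' v = arr v" using run_arr[OF ga1] by (simp add: a2_def)
  have ga2: "graph_in a2" "a2 ''L'' 0 = L" "\<forall>t\<le>L. a2 ''tn'' t = t * n" "\<forall>v<n. a2 ''lab'' v = 0" "a2 ''L1'' 0 = Suc L"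
    using ga1 tn fa2 fa1 f1 i(6) by (simp_all add: graph_in_def)
  have lab3: "\<forall>t\<le>L. \<forall>v<n. a3 ''lab'' (t * n + v) = lab t v"
    using run_lab[OF ga2(1) arr2 ga2(2-4)] by (simp add: a3_def)
  have ga3: "graph_in a3" "\<forall>v<n. a3 ''arr'' v = arr v" "\<forall>t\<le>L. a3 ''tn'' t = t * n" "a3 ''L1'' 0 = Suc L" "a3 ''k'' 0 = 0"
    "a3 ''L'' 0 = L"
    using ga2 arr2 fa3 fa2 fa1 f1 i(7) by (simp_all add: graph_in_def)
  have rank: "\<forall>t\<le>L. \<forall>v<n. s2 ''rank'' (t * n + v) = rank t v" and k: "s2 ''k'' 0 = bits"
    using run_rank[OF ga3(1-3) lab3 ga3(4,5)] by (simp_all add: a4)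
  have g2: "graph_in s2" "s2 ''L'' 0 = L" "\<forall>t\<le>L. s2 ''tn'' t = t * n" "\<forall>t\<le>L. \<forall>v<n. s2 ''lab'' (t * n + v) = lab t v"
    using ga3 lab3 fa4 by (simp_all add: graph_in_def)
  note pw = run_powers[OF g2(1,2) k, folded s3_def]
  have f3: "s3 a = s2 a" if "a \<notin> {''K'', ''i'', ''N'', ''n1''}" for a unfolding s3_def by (rule run_frame) (use that in simp)
  have orig: "s3 ''h'' = s0 ''h''" "s3 ''r'' = s0 ''r''" "s3 ''bit'' = s0 ''bit''" "s3 ''T'' = s0 ''T''"
    "s3 ''M1'' = s0 ''M1''" "s3 ''M2'' = s0 ''M2''" "s3 ''M3'' = s0 ''M3''" "s3 ''M4'' = s0 ''M4''"
    using f3 fa4 fa3 fa2 fa1 f1 by simp_all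
  define b1 where "b1 = run p_digits s3"
  define b2 where "b2 = run p_bits b1"
  define b3 where "b3 = run p_table b2"
  have fb1: "b1 a = s3 a" if "a \<notin> {''i'', ''M1'', ''N2'', ''M2'', ''N3'', ''M3'', ''N4'', ''M4''}" for a
    unfolding b1_def by (rule run_frame) (use that in simp)
  have fb2: "b2 a = b1 a" if "a \<notin> {''x'', ''i'', ''bit''}" for a unfolding b2_def by (rule run_frame) (use that in simp)
  have M: "\<forall>i\<le>base. b1 ''M1'' i = i * base \<and> b1 ''M2'' i = i * (base * base) \<and>
        b1 ''M3'' i = i * (base * (base * base)) \<and> b1 ''M4'' i = i * (base * (base * (base * base)))"
    unfolding b1_def by (rule run_digits) (use pw orig i in simp_all)
  have "\<forall>x<2 ^ bits. \<forall>j\<le>n. b2 ''bit'' (x * base + j) = of_bool (bit x j)"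
    unfolding b2_def by (rule run_bits) (use pw orig i M fb1 f3 g2 in \<open>simp_all add: graph_in_def\<close>)
  then have ready: "ready h b2"
    using pw M g2 rank orig i(2) fb1 fb2 f3 by (simp add: ready_def graph_in_def)
  have T2: "b2 ''T'' = (\<lambda>_. 0)" and r2: "b2 ''r'' 0 = r" using orig i fb1 fb2 by simp_all
  have ready3: "ready h b3" unfolding b3_def
    by (rule ready_run[OF ready]) (simp add: static_def p_table_def)
  have r3: "b3 ''r'' 0 = r" using r2 by (simp add: b3_def run_frame p_table_def)
  have "run p_solve s3 = run p_out b3" by (simp add: p_solve_def b1_def b2_def b3_def)
  then show "run p_solve s3 ''out'' 0 = of_bool (spread L {..<n} {src} (r - 1) h)"
    using run_out[OF ready3] run_table[OF ready T2] r3 r by (simp add: b3_def)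
  show "\<forall>y\<in>bounds p_lifetime. s0 y 0 \<le> base" using i(1) by (simp add: phases_bounds graph_in_def base_def)
  show "\<forall>y\<in>bounds p_classes. s1 y 0 \<le> base" using g1 L1 by (simp add: phases_bounds graph_in_def base_def)
  show "\<forall>y\<in>bounds p_powers. s2 y 0 \<le> base" using k bits_le_n by (simp add: phases_bounds base_def)
  show "\<forall>y\<in>bounds p_solve. s3 y 0 \<le> base"
    using pw f3 g2 by (simp add: phases_bounds graph_in_def base_def)
qed

lemma main_exec:
  assumes "0 < r"
  shows "\<exists>k s. ram_exec (compile p_main) (input_state n es src r h) k s \<and>
    s ''out'' 0 = of_bool (spread L {..<n} {src} (r - 1) h) \<and>
    k \<le> weight p_main * Suc base ^ depth p_main"
proof -
  let ?s0 = "input_state n es src r h"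
  let ?s1 = "run p_lifetime ?s0"
  let ?s2 = "run p_classes ?s1"
  let ?s3 = "run p_powers ?s2"
  note m = run_main[OF assms, of h]
  obtain k1 where k1: "k1 \<le> weight p_lifetime * Suc base ^ depth p_lifetime" "ram_exec (compile p_lifetime) ?s0 k1 ?s1"
    using ram_exec_compile[of p_lifetime ?s0 base, OF phases_well_formed(1) phases_disjoint(1) m(2)] by blast
  obtain k2 where k2: "k2 \<le> weight p_classes * Suc base ^ depth p_classes" "ram_exec (compile p_classes) ?s1 k2 ?s2"
    using ram_exec_compile[of p_classes ?s1 base, OF phases_well_formed(2) phases_disjoint(2) m(3)] by blast
  obtain k3 where k3: "k3 \<le> weight p_powers * Suc base ^ depth p_powers" "ram_exec (compile p_powers) ?s2 k3 ?s3"
    using ram_exec_compile[of p_powers ?s2 base, OF phases_well_formed(3) phases_disjoint(3) m(4)] by blast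
  obtain k4 where k4: "k4 \<le> weight p_solve * Suc base ^ depth p_solve" "ram_exec (compile p_solve) ?s3 k4 (run p_solve ?s3)"
    using ram_exec_compile[of p_solve ?s3 base, OF phases_well_formed(4) phases_disjoint(4) m(5)] by blast
  have ex: "ram_exec (compile p_main) ?s0 (k1 + (k2 + (k3 + k4))) (run p_solve ?s3)"
    unfolding p_main_def compile.simps 
    by (rule ram_exec.Seq[OF k1(2) ram_exec.Seq[OF k2(2) ram_exec.Seq[OF k3(2) k4(2)]]])
  have pw: "a \<le> w * Suc base ^ depth p_main" if "a \<le> w * Suc base ^ d" "d \<le> depth p_main" for a w d
  proof -
    have "w * Suc base ^ d \<le> w * Suc base ^ depth p_main"
      using that(2) by (intro mult_le_mono2 power_increasing) simp_all
    then show ?thesis using that(1) by (rule order_trans[rotated])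
  qed
  have "k1 + (k2 + (k3 + k4)) \<le> weight p_main * Suc base ^ depth p_main"
    using pw[OF k1(1)] pw[OF k2(1)] pw[OF k3(1)] pw[OF k4(1)]
    by (simp add: p_main_def add_mult_distrib)
  then show ?thesis using ex m(1) by blast
qed

lemma m_le: "m \<le> n * n * L" if "distinct es"
proof -
  have "set es \<subseteq> {..<n} \<times> {..<n} \<times> {1..L}"
  proof
    fix x assume "x \<in> set es"
    then obtain e where e: "e < m" "x = es ! e" by (auto simp: m_def in_set_conv_nth)
    then show "x \<in> {..<n} \<times> {..<n} \<times> {1..L}"
      using edge_props[OF e(1)] by (simp add: ta_def he_def ti_def mem_Times_iff)
  qed
  then have "card (set es) \<le> card ({..<n} \<times> {..<n} \<times> {1..L})" by (intro card_mono) auto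
  then show ?thesis using that by (simp add: m_def distinct_card)
qed

text \<open>The estimate of \<open>2 ^ bits\<close> by \<open>w ^ (w ^ 3)\<close> works for
  \<open>w \<ge> 2\<close>. For \<open>w = 1\<close> the latter is 1, so the factor 2 is taken from
  \<open>n * L\<close>, which is at least 2 once there is an edge. The exponent 5 leaves room for
  \<open>m \<le> (n * L) ^ 2\<close> and the constants.\<close>

lemma base_le:
  assumes "distinct es" "es \<noteq> []" "bits \<le> w"
  shows "Suc base \<le> (n * L) ^ 5 * w ^ (w ^ 3)"
proof -
  let ?x = "n * L"
  have e: "0 < m" using assms(2) by (simp add: m_def)
  have L: "1 \<le> L" using edge_props(4,5)[OF e] by simp
  have "2 \<le> n" using edge_props(1-3)[OF e] by simp
  then have x: "2 \<le> ?x" using L mult_le_mono[of 2 n 1 L] by simp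
  have w: "1 \<le> w" using assms(3) bits_pos by simp
  have "(2::nat) ^ bits \<le> ?x * w ^ (w ^ 3)"
  proof (cases "w = 1")
    case True
    then have "bits = 1" using assms(3) bits_pos by simp
    then show ?thesis using x True by simp
  next
    case False
    have "(2::nat) ^ bits \<le> 2 ^ (w ^ 3)"
      using assms(3) self_le_power[OF w, of 3] by (intro power_increasing) auto
    also have "\<dots> \<le> w ^ (w ^ 3)" using False w by (intro power_mono) auto
    also have "\<dots> = 1 * w ^ (w ^ 3)" by simp
    also have "\<dots> \<le> ?x * w ^ (w ^ 3)" using x by (intro mult_le_mono1) linarith
    finally show ?thesis .
  qed
  moreover have "n \<le> ?x" "L \<le> ?x" using L \<open>2 \<le> n\<close> by auto
  moreover have "m \<le> ?x * ?x"
  proof -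
    have "n * n * L * 1 \<le> n * n * L * L" using L by (rule mult_le_mono2)
    moreover have "?x * ?x = n * n * L * L" by (simp add: algebra_simps)
    ultimately show ?thesis using m_le[OF assms(1)] by linarith
  qed
  ultimately have "Suc base \<le> ?x + ?x * ?x + ?x + 2 * (?x * w ^ (w ^ 3)) + 3"
    unfolding base_def by linarith
  also have "\<dots> \<le> (?x + ?x * ?x + ?x + 2 * ?x + 3) * w ^ (w ^ 3)"
  proof -
    have "1 \<le> w ^ (w ^ 3)" using w by simp
    then have "(?x + ?x * ?x + ?x + 3) * 1 \<le> (?x + ?x * ?x + ?x + 3) * w ^ (w ^ 3)" by (rule mult_le_mono2)
    then show ?thesis by (simp add: algebra_simps)
  qed
  also have "\<dots> \<le> ?x ^ 5 * w ^ (w ^ 3)"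
  proof (rule mult_le_mono1)
    \<comment> \<open>Substituting \<open>y + 2\<close> expands both sides into polynomials in
      \<open>y\<close> that can be compared coefficient by coefficient.\<close>
    obtain y where y: "?x = y + 2" using x by (metis add.commute le_Suc_ex)
    show "?x + ?x * ?x + ?x + 2 * ?x + 3 \<le> ?x ^ 5"
      unfolding y by (simp add: power_numeral_reduce algebra_simps)
  qed
  finally show ?thesis .
qed

end

theorem mainTheorem9:
  shows "\<exists>(P :: ram_prog) (c :: nat) (d :: nat).
    \<forall>(G :: nat temporal_graph) (n :: nat) L vs r h.
      is_temporal_graph G \<and> tverts G = {..<n} \<and> lists_time_edges L G \<and>
      vs \<in> tverts G \<and> 0 < r \<and> 0 < h \<longrightarrow>
      (\<exists>k s. ram_exec P (input_state n L vs r h) k s \<and>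
         s ''out'' 0 = (if temporal_reachability_edge_deletion G vs r h then 1 else 0) \<and>
         (time_edges G \<noteq> {} \<longrightarrow>
            k \<le> (n * lifetime G) ^ c * tim_width G ^ (d * tim_width G ^ 3)))"
proof (rule exI[of _ "compile p_main"], rule exI[of _ "weight p_main + 5 * depth p_main"], rule exI[of _ "depth p_main"],
    intro allI impI, elim conjE)
  fix G :: "nat temporal_graph" and n es src and r h :: nat
  assume G: "is_temporal_graph G" and verts: "tverts G = {..<n}" and es: "lists_time_edges es G"
    and src: "src \<in> tverts G" and r: "0 < r"
  let ?f = "\<lambda>(u, v, t). ({u, v}, t :: nat)"
  have es': "distinct (map ?f es)" "set (map ?f es) = time_edges G"
    using es by (simp_all add: lists_time_edges_def Let_def)
  interpret listed_graph n src es G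
  proof
    fix u v t assume "(u, v, t) \<in> set es"
    then have "?f (u, v, t) \<in> time_edges G" unfolding es'(2)[symmetric] set_map by (rule imageI)
    then have t: "{u, v} \<in> tedges G" "t \<in> tlabels G {u, v}" by (auto simp: time_edges_def)
    then obtain u' v' where "u' < n" "v' < n" "u' \<noteq> v'" "{u, v} = {u', v'}"
      using G verts by (fastforce simp: is_temporal_graph_def)
    moreover have "0 < t" using t G unfolding is_temporal_graph_def by (metis neq0_conv)
    ultimately show "u < n \<and> v < n \<and> u \<noteq> v \<and> 0 < t" by (auto simp: doubleton_eq_iff)
  qed (use verts src es in auto)
  obtain k s where k: "ram_exec (compile p_main) (input_state n es src r h) k s"
    "s ''out'' 0 = of_bool (spread L {..<n} {src} (r - 1) h)" "k \<le> weight p_main * Suc base ^ depth p_main"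
    using main_exec[OF r] by blast
  have "k \<le> (n * lifetime G) ^ (weight p_main + 5 * depth p_main) * tim_width G ^ (depth p_main * tim_width G ^ 3)"
    if ne: "time_edges G \<noteq> {}"
  proof -
    let ?x = "n * lifetime G" and ?w = "tim_width G"
    have L: "L = lifetime G" by (rule L_eq_lifetime[OF ne])
    have "es \<noteq> []" "distinct es" using es' ne by (auto simp: distinct_map)
    then have b: "Suc base \<le> ?x ^ 5 * ?w ^ (?w ^ 3)"
      using base_le[OF _ _ bits_le_tim_width[OF ne G]] by (simp add: L)
    have "2 \<le> ?x"
    proof -
      have e: "0 < m" using \<open>es \<noteq> []\<close> by (simp add: m_def)
      then show ?thesis using edge_props[OF e] mult_le_mono[of 2 n 1 L] by (simp add: L)
    qed
    \<comment> \<open>The claimed form has no constant factor, so \<open>weight p_main\<close> is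
      absorbed into a power of \<open>?x\<close>, using \<open>2 \<le> ?x\<close>. This is where the
      first summand of the exponent comes from.\<close>
    then have "2 ^ weight p_main \<le> ?x ^ weight p_main" by (intro power_mono) auto
    then have W: "weight p_main \<le> ?x ^ weight p_main" using less_exp[of "weight p_main"] by linarith
    have "k \<le> weight p_main * Suc base ^ depth p_main" by (rule k(3))
    also have "\<dots> \<le> ?x ^ weight p_main * (?x ^ 5 * ?w ^ (?w ^ 3)) ^ depth p_main"
      using W b by (intro mult_le_mono power_mono) auto
    also have "\<dots> = ?x ^ (weight p_main + 5 * depth p_main) * ?w ^ (depth p_main * ?w ^ 3)"
      by (simp only: power_mult_distrib power_add power_mult[symmetric] mult.assoc mult.commute[of "?w ^ 3"])
    finally show ?thesis .
  qed
  then show "\<exists>k s. ram_exec (compile p_main) (input_state n es src r h) k s \<and>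
         s ''out'' 0 = (if temporal_reachability_edge_deletion G src r h then 1 else 0) \<and>
         (time_edges G \<noteq> {} \<longrightarrow>
            k \<le> (n * lifetime G) ^ (weight p_main + 5 * depth p_main) * tim_width G ^ (depth p_main * tim_width G ^ 3))"
    using k(1,2) temporal_reachability_edge_deletion_iff_spread[OF r, of h]
    by (intro exI[of _ k] exI[of _ s]) simp
qed

end
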